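(* Let $A\subseteq[0,\infty)$ be realizable and assume at least one of the following holds: (1) $A$ has a maximum; (2) there is a function $f\colon A\to A$ which is Polish metric preserving, injective and not surjective; (3) $A$ contains an interval; (4) $A$ is not dense in any right neighborhood of $0$. Then $\cong_A\ \sim_B\ \cong^\star_A$.
   Context: $\mathbb U$ is the Urysohn space and $F(\mathbb U)$ its nonempty closed subsets with the Effros Borel structure. For $A\subseteq[0,\infty)$, $\mathcal V_A=\{U\in F(\mathbb U):$ all distances realized in $U$ lie in $A\}$ and $\mathcal V^\star_A=\{U\in F(\mathbb U):$ the set of distances realized in $U$ equals $A\}$, with relative Borel structures; $\cong_A$, $\cong^\star_A$ are isometry on these. $A$ is realizable if $\mathcal V^\star_A\ne\emptyset$. For $A\ni 0$, $f\colon A\to[0,\infty)$ is metric preserving if $f\circ d$ is a metric for every metric $d$ with values in $A$; it is Polish metric preserving if moreover $f$ and $f^{-1}$ are continuous at $0$. A right neighborhood of $0$ is $[0,\varepsilon)$ with $\varepsilon>0$. $\sim_B$ denotes Borel bireducibility. *)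

theory Defs
  imports "HOL-Analysis.Analysis"
begin

text \<open>
  The Urysohn space: the Polish metric space, unique up to isometry, that is universal for
  separable metric spaces and ultrahomogeneous. A class axiom cannot quantify over types, so
  universality is stated for metric spaces carried by sets of reals; this loses nothing, since a
  separable metric space has at most continuum many points.
\<close>
class urysohn_space = polish_space +
  assumes urysohn_universal:
    "\<And>(M :: real set) d. Metric_space M d \<Longrightarrow> separable_space (Metric_space.mtopology M d) \<Longrightarrow>
       \<exists>i :: real \<Rightarrow> 'a. \<forall>x\<in>M. \<forall>y\<in>M. dist (i x) (i y) = d x y"
  and urysohn_ultrahomogeneous:
    "\<And>(S :: 'a set) g. finite S \<Longrightarrow> \<forall>x\<in>S. \<forall>y\<in>S. dist (g x) (g y) = dist x y \<Longrightarrow>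
       \<exists>h :: 'a \<Rightarrow> 'a. surj h \<and> (\<forall>x y. dist (h x) (h y) = dist x y) \<and> (\<forall>x\<in>S. h x = g x)"

definition effros :: "'u::topological_space set measure" where
  "effros = sigma {F. closed F \<and> F \<noteq> {}} {{F. closed F \<and> F \<noteq> {} \<and> F \<inter> W \<noteq> {}} | W. open W}"

lemma space_effros: "space effros = {F. closed F \<and> F \<noteq> {}}"
  unfolding effros_def by (rule space_measure_of) auto

lemma sets_effros:
  "sets effros = sigma_sets {F. closed F \<and> F \<noteq> {}}
     {{F. closed F \<and> F \<noteq> {} \<and> F \<inter> W \<noteq> {}} | W. open W}"
  unfolding effros_def by (rule sets_measure_of) auto

definition distances :: "'u::metric_space set \<Rightarrow> real set" where
  "distances U = {dist x y | x y. x \<in> U \<and> y \<in> U}"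

definition V_sub :: "real set \<Rightarrow> 'u::metric_space set set" where
  "V_sub A = {U. closed U \<and> U \<noteq> {} \<and> distances U \<subseteq> A}"

definition V_star :: "real set \<Rightarrow> 'u::metric_space set set" where
  "V_star A = {U. closed U \<and> U \<noteq> {} \<and> distances U = A}"

definition realizable :: "'u::metric_space itself \<Rightarrow> real set \<Rightarrow> bool" where
  "realizable _ A \<longleftrightarrow> (V_star A :: 'u set set) \<noteq> {}"

definition isometric_sets :: "'u::metric_space set \<Rightarrow> 'v::metric_space set \<Rightarrow> bool" where
  "isometric_sets U V \<longleftrightarrow> (\<exists>f. f ` U = V \<and> (\<forall>x\<in>U. \<forall>y\<in>U. dist (f x) (f y) = dist x y))"

definition borel_reducible ::
    "'a measure \<Rightarrow> ('a \<Rightarrow> 'a \<Rightarrow> bool) \<Rightarrow> 'b measure \<Rightarrow> ('b \<Rightarrow> 'b \<Rightarrow> bool) \<Rightarrow> bool" where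
  "borel_reducible M E N F \<longleftrightarrow>
     (\<exists>f \<in> M \<rightarrow>\<^sub>M N. \<forall>x\<in>space M. \<forall>y\<in>space M. E x y \<longleftrightarrow> F (f x) (f y))"

definition borel_bireducible ::
    "'a measure \<Rightarrow> ('a \<Rightarrow> 'a \<Rightarrow> bool) \<Rightarrow> 'b measure \<Rightarrow> ('b \<Rightarrow> 'b \<Rightarrow> bool) \<Rightarrow> bool" where
  "borel_bireducible M E N F \<longleftrightarrow> borel_reducible M E N F \<and> borel_reducible N F M E"

text \<open>
  \<^const>\<open>Metric_space\<close> demands nonnegativity and symmetry also off the carrier, where \<open>f \<circ> d\<close> is
  arbitrary; hence the composition is replaced by 0 there. Restricting the carriers to sets of
  reals is harmless, as the metric axioms involve at most three points (see the lemma below).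
\<close>
definition metric_preserving :: "real set \<Rightarrow> (real \<Rightarrow> real) \<Rightarrow> bool" where
  "metric_preserving A f \<longleftrightarrow> f \<in> A \<rightarrow> {0..} \<and>
     (\<forall>(M :: real set) d. Metric_space M d \<and> (\<forall>x\<in>M. \<forall>y\<in>M. d x y \<in> A) \<longrightarrow>
        Metric_space M (\<lambda>x y. if x \<in> M \<and> y \<in> M then f (d x y) else 0))"

lemma metric_preserving_arbitrary_carrier:
  fixes M :: "'a set"
  assumes f: "metric_preserving A f" and M: "Metric_space M d"
    and A: "\<forall>x\<in>M. \<forall>y\<in>M. d x y \<in> A"
  shows "Metric_space M (\<lambda>x y. if x \<in> M \<and> y \<in> M then f (d x y) else 0)"
proof -
  interpret Metric_space M d by (rule M)
  have fnn: "0 \<le> f (d x y)" if "x \<in> M" "y \<in> M" for x y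
    using f A that unfolding metric_preserving_def by auto
  have three: "(f (d x y) = 0 \<longleftrightarrow> x = y) \<and> f (d x z) \<le> f (d x y) + f (d y z)"
    if xyz: "x \<in> M" "y \<in> M" "z \<in> M" for x y z
  proof -
    obtain e :: "'a \<Rightarrow> nat" where "inj_on e {x, y, z}"
      using finite_imp_inj_to_nat_seg[of "{x, y, z}"] by auto
    then have inj: "inj_on (\<lambda>t. real (e t)) {x, y, z}"
      by (auto simp: inj_on_def)
    define r where "r = inv_into {x, y, z} (\<lambda>t. real (e t))"
    define N where "N = (\<lambda>t. real (e t)) ` {x, y, z}"
    have r: "r (real (e t)) = t" if "t \<in> {x, y, z}" for t
      unfolding r_def using inv_into_f_f[OF inj that] .
    have rM: "r s \<in> M" if s: "s \<in> N" for s
    proof -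
      from s obtain t where t: "t \<in> {x, y, z}" and "s = real (e t)"
        unfolding N_def by blast
      with r[OF t] xyz show ?thesis by auto
    qed
    have r_section: "real (e (r s)) = s" if s: "s \<in> N" for s
    proof -
      from s obtain t where t: "t \<in> {x, y, z}" and "s = real (e t)"
        unfolding N_def by blast
      with r[OF t] show ?thesis by simp
    qed
    have r_inj: "r s = r t \<longleftrightarrow> s = t" if "s \<in> N" "t \<in> N" for s t
    proof
      assume "r s = r t"
      then have "real (e (r s)) = real (e (r t))" by (rule arg_cong)
      then show "s = t" by (simp only: r_section[OF that(1)] r_section[OF that(2)])
    qed (rule arg_cong)
    have "Metric_space N (\<lambda>s t. d (r s) (r t))"
    proof (rule Metric_space.intro)
      show "d (r s) (r t) = d (r t) (r s)" for s t
        by (rule commute)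
      show "d (r s) (r t) = 0 \<longleftrightarrow> s = t" if "s \<in> N" "t \<in> N" for s t
        using zero[OF rM[OF that(1)] rM[OF that(2)]] r_inj[OF that] by blast
      show "d (r s) (r u) \<le> d (r s) (r t) + d (r t) (r u)" if "s \<in> N" "t \<in> N" "u \<in> N" for s t u
        by (rule triangle[OF rM[OF that(1)] rM[OF that(2)] rM[OF that(3)]])
    qed (rule nonneg)
    then interpret N: Metric_space N
        "\<lambda>s t. if s \<in> N \<and> t \<in> N then f (d (r s) (r t)) else 0"
      using f[unfolded metric_preserving_def, THEN conjunct2, rule_format, of N "\<lambda>s t. d (r s) (r t)"]
        A rM by simp
    have in_N: "real (e x) \<in> N" "real (e y) \<in> N" "real (e z) \<in> N"
      by (auto simp: N_def)
    have "real (e x) = real (e y) \<longleftrightarrow> x = y"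
      using inj_on_eq_iff[OF inj, of x y] by auto
    moreover have "r (real (e x)) = x" "r (real (e y)) = y" "r (real (e z)) = z"
      by (intro r; simp)+
    ultimately show ?thesis
      using N.zero[OF in_N(1,2)] N.triangle[OF in_N] in_N by simp
  qed
  show ?thesis
  proof (rule Metric_space.intro, goal_cases)
    case (1 x y)
    then show ?case using fnn by simp
  next
    case (2 x y)
    then show ?case by (simp add: commute[of x y])
  next
    case (3 x y)
    then show ?case using three[of x y x] by simp
  next
    case (4 x y z)
    then show ?case using three[of x y z] by simp
  qed
qed

text \<open>
  The function \<open>f\<close> need not be injective here, so continuity of \<open>f\<^sup>-\<^sup>1\<close> at 0 is read as:
  preimages of small values are small. For injective \<open>f\<close> this is continuity at 0 of the inverse
  \<open>f ` A \<rightarrow> A\<close>.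
\<close>
definition polish_metric_preserving :: "real set \<Rightarrow> (real \<Rightarrow> real) \<Rightarrow> bool" where
  "polish_metric_preserving A f \<longleftrightarrow> metric_preserving A f \<and>
     continuous (at 0 within A) f \<and>
     (\<forall>\<epsilon>>0. \<exists>\<delta>>0. \<forall>a\<in>A. f a < \<delta> \<longrightarrow> a < \<epsilon>)"

end

theory Submission
  imports Defs
begin

text \<open>
  Inclusion reduces \<open>\<cong>\<^sup>\<star>\<^sub>A\<close> to \<open>\<cong>\<^sub>A\<close>, so only the converse reduction matters. If \<open>A\<close> has a maximum \<open>m\<close>, put
  a fixed space \<open>K\<close> at distance \<open>m\<close> from \<open>U\<close>, where \<open>K\<close> is connected by steps shorter than \<open>m\<close> and
  realizes \<open>A - {m}\<close>; then \<open>K\<close> can be cancelled. If \<open>A\<close> has no maximum, it suffices to encode \<open>U\<close> by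
  a space \<open>U'\<close> whose distances lie in \<open>A\<close> but miss some \<open>a > 0\<close> of \<open>A\<close>: choose \<open>Z\<close> realizing \<open>A\<close>
  in which exactly one point has no neighbour at distance \<open>a\<close>, and map \<open>U\<close> to \<open>U' \<times> Z\<close> with the
  maximum metric; the copy of \<open>U'\<close> over that point is definable. In case (2), \<open>U'\<close> is \<open>U\<close> with the
  metric \<open>f \<circ> d\<close>. In case (3), \<open>U'\<close> consists of two copies of \<open>U\<close> with truncated metrics, the
  distances between the copies being an injective, slowly varying function of \<open>d\<close> with values in the
  interval. In case (4), the gaps of \<open>A\<close> near 0 yield canonical countable partitions of \<open>U\<close> into ever
  smaller clopen pieces, so \<open>U\<close> amounts to a countable structure, hence to a graph, hence to a space
  with two nonzero distances \<open>a < b \<le> 2 a\<close> of \<open>A\<close>. When there are no such distances, \<open>A\<close> is so sparse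
  that all metrics in question are ultrametrics, and shifting large distances upwards gives case (2).
\<close>

section \<open>Embeddings into the Urysohn space and measurable selection\<close>

text \<open>Both ends of every reduction are spaces of closed subsets of one Urysohn space, so each
  construction must be carried out inside it and must depend on \<open>U\<close> in a Borel way.
  Where the new metric makes sense on all pairs of points of the Urysohn space (products, two
  copies, disjoint sums), one embedding of the whole construction yields continuous maps, and Borel
  dependence is immediate. In cases (2) and (4) this fails: \<open>f\<close> is controlled only on
  \<open>A\<close>, and the graph depends on the global structure of \<open>U\<close>. There the new
  space is described by a Borel family of pseudometrics on the naturals, computed from a dense
  sequence chosen Borel in \<open>U\<close>, and the family is realized by a Borel sequence of
  points. Products use the maximum metric because \<open>A\<close> is closed under maxima of two
  elements, but in general not under sums. A missed value \<open>a\<close> must lie below some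
  \<open>b\<close> in \<open>A\<close>, the distance that sets the distinguished point of
  \<open>Z\<close> apart; a maximum of \<open>A\<close> cannot play this role, and sets with a
  maximum are treated separately.\<close>

lemma dense_sequence:
  obtains c :: "nat \<Rightarrow> 'a::{metric_space, second_countable_topology}"
  where "\<And>x e. 0 < e \<Longrightarrow> \<exists>k. dist (c k) x < e"
proof -
  obtain C :: "'a set" where C: "countable C" "\<And>X. open X \<Longrightarrow> X \<noteq> {} \<Longrightarrow> \<exists>d\<in>C. d \<in> X"
    using countable_dense_setE by auto
  have "C \<noteq> {}" using C(2)[of UNIV] by auto
  show ?thesis
  proof
    fix x :: 'a and e :: real assume "0 < e"
    then obtain d where "d \<in> C" "d \<in> ball x e" using C(2)[of "ball x e"] by auto
    then show "\<exists>k. dist (from_nat_into C k) x < e"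
      by (metis C(1) dist_commute from_nat_into_surj mem_ball)
  qed
qed

text \<open>\<open>urysohn_universal\<close> only covers metric spaces carried by sets of reals. A
  point is determined by which balls of radius \<open>1 / Suc k\<close> around points of the dense
  set contain it, hence by a set of naturals, and there are only continuum many of these.\<close>

lemma separable_metric_inj_real:
  fixes X :: "'x set"
  assumes "Metric_space X D" and "countable C" and dense: "\<And>x e. x \<in> X \<Longrightarrow> 0 < e \<Longrightarrow> \<exists>c\<in>C. D x c < e"
    and "C \<subseteq> X"
  obtains j :: "'x \<Rightarrow> real" where "inj_on j X"
proof (cases "X = {}")
  case False
  interpret Metric_space X D by fact
  have "C \<noteq> {}" using False dense[of _ 1] by auto
  define c where "c = from_nat_into C"
  have c: "range c = C" unfolding c_def using \<open>C \<noteq> {}\<close> \<open>countable C\<close> by (rule range_from_nat_into)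
  define code where "code x = {prod_encode (p, k) | p k. D x (c p) < 1 / real (Suc k)}" for x
  have code: "prod_encode (p, k) \<in> code x \<longleftrightarrow> D x (c p) < 1 / real (Suc k)" for x p k
    unfolding code_def by auto
  have inj: "inj_on code X"
  proof (rule inj_onI, rule ccontr)
    fix x y assume xy: "x \<in> X" "y \<in> X" "code x = code y" "x \<noteq> y"
    then have pos: "0 < D x y" by (simp add: mdist_pos_less)
    then obtain k where k: "1 / real (Suc k) < D x y / 2"
      using reals_Archimedean[of "D x y / 2"] by (auto simp: inverse_eq_divide)
    obtain p where p: "D x (c p) < 1 / real (Suc k)"
      using dense[OF xy(1), of "1 / real (Suc k)"] c by auto
    then have q: "D y (c p) < 1 / real (Suc k)" using code xy(3) by blast
    have cX: "c p \<in> X" using c \<open>C \<subseteq> X\<close> by auto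
    have "D x y \<le> D x (c p) + D (c p) y" by (rule triangle[OF xy(1) cX xy(2)])
    then show False using p q k commute[of y "c p"] by linarith
  qed
  obtain g :: "nat set \<Rightarrow> real" where "inj g"
    using nat_sets_eqpoll_reals by (auto simp: eqpoll_def bij_betw_def)
  then have "inj_on (g \<circ> code) X"
    by (intro comp_inj_on[OF inj]) (auto intro: inj_on_subset)
  then show ?thesis by (rule that)
qed (auto intro: that)

lemma urysohn_embedding:
  fixes X :: "'x set" and D :: "'x \<Rightarrow> 'x \<Rightarrow> real"
  assumes met: "Metric_space X D" and "countable C" "C \<subseteq> X"
    and dense: "\<And>x e. x \<in> X \<Longrightarrow> 0 < e \<Longrightarrow> \<exists>c\<in>C. D x c < e"
  obtains i :: "'x \<Rightarrow> 'u::urysohn_space" where "\<And>x y. x \<in> X \<Longrightarrow> y \<in> X \<Longrightarrow> dist (i x) (i y) = D x y"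
proof -
  interpret Metric_space X D by fact
  obtain j :: "'x \<Rightarrow> real" where inj: "inj_on j X"
    using separable_metric_inj_real[OF met \<open>countable C\<close> dense \<open>C \<subseteq> X\<close>] by blast
  define r where "r = inv_into X j"
  define d where "d s t = D (r s) (r t)" for s t
  have rj: "r (j x) = x" if "x \<in> X" for x
    unfolding r_def using inj that by (rule inv_into_f_f)
  interpret N: Metric_space "j ` X" d
  proof
    fix s t
    show "0 \<le> d s t" "d s t = d t s" by (auto simp: d_def commute)
    assume "s \<in> j ` X" "t \<in> j ` X"
    then show "d s t = 0 \<longleftrightarrow> s = t"
      by (auto simp: d_def rj)
    fix u assume "u \<in> j ` X"
    with \<open>s \<in> j ` X\<close> \<open>t \<in> j ` X\<close> show "d s u \<le> d s t + d t u"
      by (auto simp: d_def rj intro!: triangle)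
  qed
  have "separable_space N.mtopology"
    unfolding separable_space_def
  proof (intro exI conjI)
    show "countable (j ` C)" using \<open>countable C\<close> by simp
    show "j ` C \<subseteq> topspace N.mtopology" using \<open>C \<subseteq> X\<close> by auto
    have "\<exists>y\<in>j ` C. y \<in> N.mball (j x) e" if x: "x \<in> X" and e: "0 < e" for x e
    proof -
      obtain y where "y \<in> C" "D x y < e" using dense[OF x e] by blast
      then show ?thesis using x \<open>C \<subseteq> X\<close>
        by (intro bexI[of _ "j y"]) (auto simp: d_def rj subset_iff)
    qed
    then show "N.mtopology closure_of j ` C = topspace N.mtopology"
      unfolding N.metric_closure_of N.topspace_mtopology by blast
  qed
  then obtain i :: "real \<Rightarrow> 'u" where i: "\<forall>x\<in>j ` X. \<forall>y\<in>j ` X. dist (i x) (i y) = d x y"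
    using urysohn_universal[OF N.Metric_space_axioms] by blast
  show ?thesis
  proof
    show "dist ((i \<circ> j) x) ((i \<circ> j) y) = D x y" if "x \<in> X" "y \<in> X" for x y
      using i that by (simp add: d_def rj)
  qed
qed

text \<open>The one-point extension property: \<rho> is a Katetov function on \<open>S\<close>. If
  it vanishes somewhere, that point is the answer; otherwise adjoining a point gives a metric space,
  universality embeds it, and ultrahomogeneity moves the embedded copy of \<open>S\<close> back onto
  \<open>S\<close> itself.\<close>

lemma urysohn_extension:
  fixes S :: "'u::urysohn_space set"
  assumes fin: "finite S"
    and lip: "\<And>x y. x \<in> S \<Longrightarrow> y \<in> S \<Longrightarrow> \<rho> x \<le> \<rho> y + dist x y"
    and tri: "\<And>x y. x \<in> S \<Longrightarrow> y \<in> S \<Longrightarrow> dist x y \<le> \<rho> x + \<rho> y"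
  obtains y where "\<And>x. x \<in> S \<Longrightarrow> dist y x = \<rho> x"
proof -
  have nn: "0 \<le> \<rho> x" if "x \<in> S" for x using tri[OF that that] by simp
  show ?thesis
  proof (cases "\<exists>z\<in>S. \<rho> z = 0")
    case True
    then obtain z where z: "z \<in> S" "\<rho> z = 0" by blast
    have "dist z x = \<rho> x" if "x \<in> S" for x
      using lip[OF that z(1)] tri[OF that z(1)] z by (simp add: dist_commute)
    then show ?thesis by (rule that)
  next
    case False
    have lip': "\<rho> y \<le> \<rho> x + dist x y" if "x \<in> S" "y \<in> S" for x y
      using lip[OF that(2,1)] by (simp add: dist_commute)
    define X where "X = insert None (Some ` S)"
    \<comment> \<open>The absolute values are for points off the carrier:
      \<open>Metric_space\<close> asks for nonnegativity there too, and \<rho> is arbitrary outside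
      \<open>S\<close>.\<close>
    define D where "D s t = (case s of
        None \<Rightarrow> (case t of None \<Rightarrow> 0 | Some y \<Rightarrow> \<bar>\<rho> y\<bar>)
      | Some x \<Rightarrow> (case t of None \<Rightarrow> \<bar>\<rho> x\<bar> | Some y \<Rightarrow> dist x y))" for s t
    have D: "D None None = 0" "D None (Some x) = \<bar>\<rho> x\<bar>" "D (Some x) None = \<bar>\<rho> x\<bar>"
      "D (Some x) (Some y) = dist x y" for x y by (auto simp: D_def)
    have met: "Metric_space X D"
    proof
      fix s t
      show "0 \<le> D s t" by (auto simp: D_def split: option.split)
      show "D s t = D t s" by (auto simp: D_def dist_commute split: option.split)
      assume st: "s \<in> X" "t \<in> X"
      then show "D s t = 0 \<longleftrightarrow> s = t" using False by (auto simp: X_def D)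
      fix u assume "u \<in> X"
      with st show "D s u \<le> D s t + D t u"
        using lip lip' tri nn dist_triangle
        by (auto simp: X_def D abs_of_nonneg) (smt (verit) dist_commute)+
    qed
    obtain i :: "'u option \<Rightarrow> 'u" where i: "\<And>s t. s \<in> X \<Longrightarrow> t \<in> X \<Longrightarrow> dist (i s) (i t) = D s t"
    proof (rule urysohn_embedding[OF met, of X])
      show "countable X" unfolding X_def using fin by (intro countable_finite) auto
      show "\<exists>c\<in>X. D x c < e" if "x \<in> X" "0 < e" for x e
        using that met by (intro bexI[of _ x]) (auto simp: D_def split: option.split)
    qed auto
    have inj: "inj_on (i \<circ> Some) S"
    proof (rule inj_onI)
      fix x y assume "x \<in> S" "y \<in> S" "(i \<circ> Some) x = (i \<circ> Some) y"
      then show "x = y" using i[of "Some x" "Some y"] by (simp add: X_def D)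
    qed
    define g where "g = inv_into S (i \<circ> Some)"
    have g: "g (i (Some x)) = x" if "x \<in> S" for x
      unfolding g_def using inv_into_f_f[OF inj that] by simp
    have "\<exists>h. surj h \<and> (\<forall>x y. dist (h x) (h y) = dist x y) \<and> (\<forall>x\<in>(i \<circ> Some) ` S. h x = g x)"
      by (rule urysohn_ultrahomogeneous) (use fin i g in \<open>auto simp: X_def D\<close>)
    then obtain h where h: "\<forall>x y. dist (h x) (h y) = dist x y"
      "\<forall>x\<in>(i \<circ> Some) ` S. h x = g x" by blast
    show ?thesis
    proof
      show "dist (h (i None)) x = \<rho> x" if "x \<in> S" for x
        using h(1)[rule_format, of "i None" "i (Some x)"] h(2) g[OF that] i[of None "Some x"] that nn[OF that]
        by (simp add: X_def D)
    qed
  qed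
qed

text \<open>The Kuratowski--Ryll-Nardzewski selection theorem. Stage \<open>n\<close> takes the
  first centre \<open>c k\<close> whose ball of radius \<open>(1/2) ^ n\<close> meets
  \<open>F w\<close>, among those close to the centre of the stage before; the centres converge to a
  point of \<open>F w\<close>, and least indices keep every stage measurable.\<close>

lemma measurable_selection:
  fixes F :: "'w \<Rightarrow> 'a::polish_space set"
  assumes cl: "\<And>w. w \<in> space M \<Longrightarrow> closed (F w)"
    and ne: "\<And>w. w \<in> space M \<Longrightarrow> F w \<noteq> {}"
    and meas: "\<And>q \<rho>. {w \<in> space M. F w \<inter> ball q \<rho> \<noteq> {}} \<in> sets M"
  obtains s where "s \<in> borel_measurable M" "\<And>w. w \<in> space M \<Longrightarrow> s w \<in> F w"
proof -
  obtain c :: "nat \<Rightarrow> 'a" where c: "\<And>x e. 0 < e \<Longrightarrow> \<exists>k. dist (c k) x < e"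
    using dense_sequence by blast
  define \<epsilon> :: "nat \<Rightarrow> real" where "\<epsilon> n = (1/2) ^ n" for n
  have \<epsilon>: "0 < \<epsilon> n" for n by (simp add: \<epsilon>_def)
  define hit where "hit n k w \<longleftrightarrow> F w \<inter> ball (c k) (\<epsilon> n) \<noteq> {}" for n k w
  have hit_meas[measurable]: "Measurable.pred M (hit n k)" for n k
    unfolding hit_def pred_def by (rule meas)
  define \<kappa> where "\<kappa> = rec_nat (\<lambda>w. LEAST k. hit 0 k w)
    (\<lambda>n \<kappa> w. LEAST k. hit (Suc n) k w \<and> dist (c k) (c (\<kappa> w)) < \<epsilon> n + \<epsilon> (Suc n))"
  have \<kappa>0: "\<kappa> 0 = (\<lambda>w. LEAST k. hit 0 k w)"
    and \<kappa>S: "\<kappa> (Suc n) = (\<lambda>w. LEAST k. hit (Suc n) k w \<and> dist (c k) (c (\<kappa> n w)) < \<epsilon> n + \<epsilon> (Suc n))"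
    for n by (simp_all add: \<kappa>_def)
  have \<kappa>_meas: "\<kappa> n \<in> M \<rightarrow>\<^sub>M count_space UNIV" for n
  proof (induction n)
    case 0
    show ?case unfolding \<kappa>0 by measurable
  next
    case (Suc n)
    note [measurable] = Suc
    have [measurable]: "Measurable.pred M (\<lambda>w. dist (c k) (c (\<kappa> n w)) < \<epsilon> n + \<epsilon> (Suc n))" for k
      by (rule measurable_compose[OF Suc]) simp
    show ?case unfolding \<kappa>S by measurable
  qed
  have next_hit: "hit (Suc n) (\<kappa> (Suc n) w) w \<and> dist (c (\<kappa> (Suc n) w)) (c (\<kappa> n w)) < \<epsilon> n + \<epsilon> (Suc n)"
    if "hit n (\<kappa> n w) w" for n w
  proof -
    obtain y where y: "y \<in> F w" "dist (c (\<kappa> n w)) y < \<epsilon> n" using \<open>hit n (\<kappa> n w) w\<close> by (auto simp: hit_def)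
    obtain k where k: "dist (c k) y < \<epsilon> (Suc n)" using c[OF \<epsilon>] by blast
    have "dist (c k) (c (\<kappa> n w)) < \<epsilon> n + \<epsilon> (Suc n)"
      using dist_triangle2[of "c k" "c (\<kappa> n w)" y] y k by linarith
    with y k have "hit (Suc n) k w \<and> dist (c k) (c (\<kappa> n w)) < \<epsilon> n + \<epsilon> (Suc n)"
      by (auto simp: hit_def)
    then show ?thesis unfolding \<kappa>S by (rule LeastI)
  qed
  have hits: "hit n (\<kappa> n w) w" if w: "w \<in> space M" for n w
  proof (induction n)
    case 0
    obtain y where "y \<in> F w" using ne[OF w] by blast
    moreover obtain k where "dist (c k) y < \<epsilon> 0" using c[OF \<epsilon>] by blast
    ultimately have "hit 0 k w" by (auto simp: hit_def)
    then show ?case unfolding \<kappa>0 by (rule LeastI)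
  qed (use next_hit in blast)
  have steps: "dist (c (\<kappa> (Suc n) w)) (c (\<kappa> n w)) < \<epsilon> n + \<epsilon> (Suc n)" if w: "w \<in> space M" for n w
    using next_hit[OF hits[OF w]] by blast
  have conv: "\<exists>y. (\<lambda>n. c (\<kappa> n w)) \<longlonglongrightarrow> y" if w: "w \<in> space M" for w
  proof -
    \<comment> \<open>One step costs less than \<open>\<epsilon> j + \<epsilon> (Suc j)\<close>,
      which is 3/2 times \<open>\<epsilon> j\<close>; this is just what the subtracted term
      \<open>3 * \<epsilon> (m + n)\<close> gives back when \<open>n\<close> grows by one.\<close>
    have bound: "dist (c (\<kappa> (m + n) w)) (c (\<kappa> m w)) \<le> 4 * \<epsilon> m - 3 * \<epsilon> (m + n)" for m n
    proof (induction n)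
      case (Suc n)
      have "dist (c (\<kappa> (m + Suc n) w)) (c (\<kappa> m w))
          \<le> dist (c (\<kappa> (Suc (m + n)) w)) (c (\<kappa> (m + n) w)) + dist (c (\<kappa> (m + n) w)) (c (\<kappa> m w))"
        using dist_triangle by simp
      with Suc steps[OF w, of "m + n"] show ?case by (simp add: \<epsilon>_def)
    qed (use \<epsilon>[of m] in simp)
    have "Cauchy (\<lambda>n. c (\<kappa> n w))"
    proof (rule metric_CauchyI)
      fix e :: real assume "0 < e"
      then obtain m where m: "\<epsilon> m < e / 8"
        unfolding \<epsilon>_def using real_arch_pow_inv[of "e / 8" "1/2"] by auto
      have close: "dist (c (\<kappa> p w)) (c (\<kappa> m w)) < e / 2" if "m \<le> p" for p
        using bound[of m "p - m"] that m \<epsilon>[of p] by simp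
      show "\<exists>N. \<forall>p\<ge>N. \<forall>q\<ge>N. dist (c (\<kappa> p w)) (c (\<kappa> q w)) < e"
        using close dist_triangle_half_l by blast
    qed
    then show ?thesis using Cauchy_convergent convergent_def by blast
  qed
  define s where "s w = lim (\<lambda>n. c (\<kappa> n w))" for w
  have s_lim: "(\<lambda>n. c (\<kappa> n w)) \<longlonglongrightarrow> s w" if "w \<in> space M" for w
    using conv[OF that] unfolding s_def by (metis limI)
  show ?thesis
  proof
    have "(\<lambda>w. c (\<kappa> n w)) \<in> borel_measurable M" for n
      by (rule measurable_compose[OF \<kappa>_meas]) simp
    then show "s \<in> borel_measurable M"
      using s_lim by (rule borel_measurable_LIMSEQ_metric)
    fix w assume w: "w \<in> space M"
    have "\<forall>n. \<exists>y. y \<in> F w \<and> dist (c (\<kappa> n w)) y < \<epsilon> n"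
      using hits[OF w] by (simp add: hit_def disjoint_iff)
    then obtain y where y: "\<And>n. y n \<in> F w" "\<And>n. dist (c (\<kappa> n w)) (y n) < \<epsilon> n" by metis
    have "\<epsilon> \<longlonglongrightarrow> 0" unfolding \<epsilon>_def by (rule LIMSEQ_realpow_zero) auto
    then have "(\<lambda>n. dist (c (\<kappa> n w)) (y n)) \<longlonglongrightarrow> 0"
      by (rule tendsto_sandwich[OF _ _ tendsto_const, rotated 2])
        (auto intro!: always_eventually less_imp_le[OF y(2)])
    then have "(\<lambda>n. dist (c (\<kappa> n w)) (y n) + dist (c (\<kappa> n w)) (s w)) \<longlonglongrightarrow> 0"
      using s_lim[OF w, unfolded tendsto_dist_iff[of _ "s w"]] by (rule tendsto_add_zero)
    then have "(\<lambda>n. dist (y n) (s w)) \<longlonglongrightarrow> 0"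
      by (rule tendsto_sandwich[OF _ _ tendsto_const, rotated 2])
        (auto intro!: always_eventually dist_triangle3)
    then have "y \<longlonglongrightarrow> s w" by (simp add: tendsto_dist_iff[of _ "s w"])
    then show "s w \<in> F w"
      using closed_sequentially[OF cl[OF w]] y(1) by blast
  qed
qed

section \<open>The Effros Borel structure and measurable realization of pseudometrics\<close>

lemma effros_hit:
  assumes "open W"
  shows "{U \<in> space effros. U \<inter> W \<noteq> {}} \<in> sets effros"
proof -
  have "{U \<in> space effros. U \<inter> W \<noteq> {}} = {F. closed F \<and> F \<noteq> {} \<and> F \<inter> W \<noteq> {}}"
    by (auto simp: space_effros)
  with assms show ?thesis unfolding sets_effros by (auto intro!: sigma_sets.Basic)
qed

lemma measurable_effrosI:
  fixes \<Phi> :: "'w \<Rightarrow> 'a::topological_space set"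
  assumes "\<And>w. w \<in> space M \<Longrightarrow> closed (\<Phi> w)" "\<And>w. w \<in> space M \<Longrightarrow> \<Phi> w \<noteq> {}"
    and hit: "\<And>W. open W \<Longrightarrow> {w \<in> space M. \<Phi> w \<inter> W \<noteq> {}} \<in> sets M"
  shows "\<Phi> \<in> M \<rightarrow>\<^sub>M effros"
  unfolding effros_def
proof (rule measurable_measure_of)
  show "\<Phi> \<in> space M \<rightarrow> {F. closed F \<and> F \<noteq> {}}" using assms by auto
  fix Y :: "'a set set" assume "Y \<in> {{F. closed F \<and> F \<noteq> {} \<and> F \<inter> W \<noteq> {}} | W. open W}"
  then obtain W where W: "open W" "Y = {F. closed F \<and> F \<noteq> {} \<and> F \<inter> W \<noteq> {}}" by blast
  have "\<Phi> -` Y \<inter> space M = {w \<in> space M. \<Phi> w \<inter> W \<noteq> {}}" using assms(1,2) W(2) by auto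
  then show "\<Phi> -` Y \<inter> space M \<in> sets M" using hit[OF W(1)] by simp
qed auto

text \<open>A Castaing representation of the identity on closed sets. Index \<open>n\<close> names a
  ball of a countable base, and the selection theorem is applied to
  \<open>closure (U \<inter> B n)\<close>, or to \<open>U\<close> when the ball misses it, so that
  the values are never empty.\<close>

lemma effros_dense_selectors:
  obtains \<sigma> :: "nat \<Rightarrow> 'a::polish_space set \<Rightarrow> 'a"
  where "\<And>n. \<sigma> n \<in> borel_measurable effros"
    and "\<And>n U. U \<in> space effros \<Longrightarrow> \<sigma> n U \<in> U"
    and "\<And>U x e. U \<in> space effros \<Longrightarrow> x \<in> U \<Longrightarrow> 0 < e \<Longrightarrow> \<exists>n. dist (\<sigma> n U) x < e"
proof -
  obtain c :: "nat \<Rightarrow> 'a" where c: "\<And>x e. 0 < e \<Longrightarrow> \<exists>k. dist (c k) x < e"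
    using dense_sequence by blast
  define B where "B n = (case prod_decode n of (p, k) \<Rightarrow> ball (c p) (1 / real (Suc k)))" for n
  define F where "F n U = (if U \<inter> B n = {} then U else closure (U \<inter> B n))" for n U
  have openB: "open (B n)" for n by (simp add: B_def split: prod.split)
  have "\<exists>s. s \<in> borel_measurable effros \<and> (\<forall>U\<in>space effros. s U \<in> F n U)" for n
  proof -
    have "{U \<in> space effros. F n U \<inter> ball q \<rho> \<noteq> {}} \<in> sets effros" for q \<rho>
    proof -
      \<comment> \<open>An open ball meets \<open>closure (U \<inter> B n)\<close> only if it meets
        \<open>U \<inter> B n\<close>, so hitting reduces to generators of the Effros
        structure.\<close>
      have "F n U \<inter> ball q \<rho> \<noteq> {} \<longleftrightarrow>
          U \<inter> (B n \<inter> ball q \<rho>) \<noteq> {} \<or> U \<inter> ball q \<rho> \<noteq> {} \<and> U \<inter> B n = {}" for U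
        using open_Int_closure_eq_empty[OF open_ball[of q \<rho>], of "U \<inter> B n"]
        unfolding F_def by (simp add: Int_commute Int_left_commute) blast
      then have "{U \<in> space effros. F n U \<inter> ball q \<rho> \<noteq> {}} =
          {U \<in> space effros. U \<inter> (B n \<inter> ball q \<rho>) \<noteq> {}} \<union>
          ({U \<in> space effros. U \<inter> ball q \<rho> \<noteq> {}} - {U \<in> space effros. U \<inter> B n \<noteq> {}})"
        by auto
      also have "\<dots> \<in> sets effros" using openB by (intro sets.Un sets.Diff effros_hit open_Int) auto
      finally show ?thesis .
    qed
    moreover have "closed (F n U)" "F n U \<noteq> {}" if "U \<in> space effros" for U
      using that by (auto simp: F_def space_effros)
    ultimately obtain s where "s \<in> borel_measurable effros" "\<And>U. U \<in> space effros \<Longrightarrow> s U \<in> F n U"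
      using measurable_selection[of effros "F n"] by blast
    then show ?thesis by blast
  qed
  then obtain \<sigma> where \<sigma>: "\<And>n. \<sigma> n \<in> borel_measurable effros"
    "\<And>n U. U \<in> space effros \<Longrightarrow> \<sigma> n U \<in> F n U" by metis
  have FU: "F n U \<subseteq> U" if "U \<in> space effros" for n U
    using that closure_minimal[of "U \<inter> B n" U] by (simp add: F_def space_effros)
  show ?thesis
  proof
    fix U :: "'a set" and x and e :: real assume U: "U \<in> space effros" "x \<in> U" and "0 < e"
    then obtain k where k: "1 / real (Suc k) < e / 2"
      using reals_Archimedean[of "e / 2"] by (auto simp: inverse_eq_divide)
    obtain p where p: "dist (c p) x < 1 / real (Suc k)" using c[of "1 / real (Suc k)" x] by auto
    define n where "n = prod_encode (p, k)"
    have B: "B n = ball (c p) (1 / real (Suc k))" by (simp add: B_def n_def)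
    then have "x \<in> U \<inter> B n" using p U by simp
    then have "\<sigma> n U \<in> closure (U \<inter> B n)" using \<sigma>(2)[OF U(1), of n] by (auto simp: F_def split: if_splits)
    then have "\<sigma> n U \<in> closure (B n)" using closure_mono[of "U \<inter> B n" "B n"] by auto
    also have "\<dots> \<subseteq> cball (c p) (1 / real (Suc k))" unfolding B by (rule closure_minimal) auto
    finally have "dist (c p) (\<sigma> n U) \<le> 1 / real (Suc k)" by simp
    then have "dist (\<sigma> n U) x < e" using p k dist_triangle3[of "\<sigma> n U" x "c p"] by linarith
    then show "\<exists>n. dist (\<sigma> n U) x < e" ..
  next
    show "\<sigma> n U \<in> U" if "U \<in> space effros" for n U using \<sigma>(2)[OF that] FU[OF that] by blast
  qed (rule \<sigma>(1))
qed

text \<open>Pseudometrics are to be realized, so points may repeat in the family \<open>x\<close>;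
  the Lipschitz condition makes \<rho> agree on indices of equal points and thus descend to the set
  of points.\<close>

lemma urysohn_extension_indexed:
  fixes x :: "'i \<Rightarrow> 'u::urysohn_space"
  assumes "finite I"
    and lip: "\<And>i j. i \<in> I \<Longrightarrow> j \<in> I \<Longrightarrow> \<rho> i \<le> \<rho> j + dist (x i) (x j)"
    and tri: "\<And>i j. i \<in> I \<Longrightarrow> j \<in> I \<Longrightarrow> dist (x i) (x j) \<le> \<rho> i + \<rho> j"
  obtains y where "\<And>i. i \<in> I \<Longrightarrow> dist y (x i) = \<rho> i"
proof -
  define r where "r = inv_into I x"
  have r: "r z \<in> I" "x (r z) = z" if "z \<in> x ` I" for z
    using that by (auto simp: r_def inv_into_into f_inv_into_f)
  obtain y where y: "\<And>z. z \<in> x ` I \<Longrightarrow> dist y z = \<rho> (r z)"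
  proof (rule urysohn_extension[of "x ` I" "\<lambda>z. \<rho> (r z)"])
    show "finite (x ` I)" using \<open>finite I\<close> by simp
    show "\<rho> (r z) \<le> \<rho> (r z') + dist z z'" if "z \<in> x ` I" "z' \<in> x ` I" for z z'
      using lip[OF r(1)[OF that(1)] r(1)[OF that(2)]] r(2) that by simp
    show "dist z z' \<le> \<rho> (r z) + \<rho> (r z')" if "z \<in> x ` I" "z' \<in> x ` I" for z z'
      using tri[OF r(1)[OF that(1)] r(1)[OF that(2)]] r(2) that by simp
  qed (rule that, blast)
  show ?thesis
  proof
    fix i assume i: "i \<in> I"
    with r[of "x i"] have ri: "r (x i) \<in> I" "x (r (x i)) = x i" by auto
    have "\<rho> (r (x i)) = \<rho> i" using lip[OF i ri(1)] lip[OF ri(1) i] ri(2) by simp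
    then show "dist y (x i) = \<rho> i" using y i by simp
  qed
qed

text \<open>The points are chosen one after another. The candidates for the next one form a closed
  set, nonempty by one-point extension, and the selection theorem applies because meeting a ball is
  expressed by finitely many strict inequalities between measurable functions.\<close>

lemma measurable_pseudometric_realization:
  fixes D :: "nat \<Rightarrow> nat \<Rightarrow> 'w \<Rightarrow> real"
  assumes meas: "\<And>n m. D n m \<in> borel_measurable M"
    and zero: "\<And>w n. w \<in> space M \<Longrightarrow> D n n w = 0"
    and sym: "\<And>w n m. w \<in> space M \<Longrightarrow> D n m w = D m n w"
    and tri: "\<And>w n m k. w \<in> space M \<Longrightarrow> D n k w \<le> D n m w + D m k w"
  obtains e :: "nat \<Rightarrow> 'w \<Rightarrow> 'u::urysohn_space"
  where "\<And>n. e n \<in> borel_measurable M" "\<And>w n m. w \<in> space M \<Longrightarrow> dist (e n w) (e m w) = D n m w"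
proof -
  define P :: "(nat \<Rightarrow> 'w \<Rightarrow> 'u) \<Rightarrow> nat \<Rightarrow> ('w \<Rightarrow> 'u) \<Rightarrow> bool" where
    "P f n r \<longleftrightarrow> r \<in> borel_measurable M \<and> (\<forall>i<n. \<forall>w\<in>space M. dist (r w) (f i w) = D n i w)" for f n r
  have "\<exists>e. \<forall>n. P e n (e n)"
  proof (rule dependent_wellorder_choice)
    show "P f n r = P g n r" if "\<And>y. y < n \<Longrightarrow> f y = g y" for f g n r
      using that by (simp add: P_def)
    fix n f assume IH: "\<And>y. y < n \<Longrightarrow> P f y (f y)"
    have f_meas[measurable]: "f i \<in> borel_measurable M" if "i < n" for i using IH[OF that] by (simp add: P_def)
    have f_dist: "dist (f i w) (f j w) = D i j w" if "i < n" "j < n" "w \<in> space M" for i j w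
      using IH[OF that(1)] IH[OF that(2)] that zero sym
      by (cases i j rule: linorder_cases) (auto simp: P_def dist_commute)
    have nn: "0 \<le> D i j w" if "w \<in> space M" for i j w
      using tri[OF that, of i i j] zero[OF that] sym[OF that, of i j] by simp
    define F where "F w = {y. \<forall>i<n. dist y (f i w) = D n i w}" for w
    have hit: "F w \<inter> ball q r \<noteq> {} \<longleftrightarrow> 0 < r \<and> (\<forall>i<n. \<bar>D n i w - dist (f i w) q\<bar> < r)" (is "?L \<longleftrightarrow> ?R")
      if w: "w \<in> space M" for w q r
    proof
      assume ?L
      then obtain y where "y \<in> F w" "y \<in> ball q r" by blast
      then have y: "\<And>i. i < n \<Longrightarrow> dist y (f i w) = D n i w" "dist q y < r" by (simp_all add: F_def)
      have "\<bar>D n i w - dist (f i w) q\<bar> < r" if "i < n" for i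
        using y(1)[OF that] y(2) dist_triangle[of y "f i w" q] dist_triangle[of q "f i w" y]
        by (auto simp: dist_commute abs_less_iff)
      moreover have "0 < r" using y(2) zero_le_dist[of q y] by linarith
      ultimately show ?R by blast
    next
      assume R: ?R
      define G where "G = insert 0 ((\<lambda>i. \<bar>D n i w - dist (f i w) q\<bar>) ` {..<n})"
      \<comment> \<open>The smallest distance from \<open>q\<close> that the triangle inequality
        permits for the new point; the candidates then meet \<open>ball q r\<close> as soon as
        \<open>t < r\<close>.\<close>
      define t where "t = Max G"
      have G: "finite G" "G \<noteq> {}" by (auto simp: G_def)
      have t0: "0 \<le> t" unfolding t_def using G by (intro Max_ge) (auto simp: G_def)
      have ti: "\<bar>D n i w - dist (f i w) q\<bar> \<le> t" if "i < n" for i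
        unfolding t_def using G that by (intro Max_ge) (auto simp: G_def)
      have tG: "t \<in> G" unfolding t_def using G by (rule Max_in)
      then have tr: "t < r" using R by (auto simp: G_def)
      \<comment> \<open>The extension has the prescribed distances to the old points and distance
        \<open>t\<close> to \<open>q\<close>; among its triangle inequalities this is the one that
        uses that \<open>t\<close> is attained.\<close>
      have tle: "t \<le> D n j w + dist (f j w) q" if j: "j < n" for j
        using tG unfolding G_def
      proof
        assume "t \<in> (\<lambda>i. \<bar>D n i w - dist (f i w) q\<bar>) ` {..<n}"
        then obtain i where i: "i < n" "t = \<bar>D n i w - dist (f i w) q\<bar>" by auto
        have "D n i w \<le> D n j w + D j i w" "D j i w \<le> D j n w + D n i w" "D j n w = D n j w"
          using tri[OF w, of n i j] tri[OF w, of j i n] sym[OF w, of n j] by auto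
        moreover have "dist (f j w) (f i w) = D j i w" using f_dist i j w by simp
        moreover have "dist (f i w) q \<le> dist (f j w) (f i w) + dist (f j w) q"
          "dist (f j w) (f i w) \<le> dist (f j w) q + dist (f i w) q"
          by (rule dist_triangle3) (rule dist_triangle2)
        ultimately show ?thesis unfolding i(2) by (simp add: abs_le_iff)
      qed (use nn[OF w] in auto)
      define x where "x i = (if i < n then f i w else q)" for i
      define \<rho> where "\<rho> i = (if i < n then D n i w else t)" for i
      obtain y where y: "\<And>i. i \<in> {..n} \<Longrightarrow> dist y (x i) = \<rho> i"
      proof (rule urysohn_extension_indexed[of "{..n}" \<rho> x])
        fix i j assume "i \<in> {..n}" "j \<in> {..n}"
        show "\<rho> i \<le> \<rho> j + dist (x i) (x j)"
          using tri[OF w, of n i j] sym[OF w, of i j] f_dist[of i j w] w ti[of i] tle[of j]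
          by (auto simp: \<rho>_def x_def dist_commute)
        show "dist (x i) (x j) \<le> \<rho> i + \<rho> j"
          using tri[OF w, of i j n] sym[OF w, of i n] f_dist[of i j w] w ti[of i] ti[of j] t0
          by (auto simp: \<rho>_def x_def dist_commute)
      qed auto
      have "dist y (f i w) = D n i w" if "i < n" for i
        using y[of i] that by (simp add: \<rho>_def x_def)
      then have "y \<in> F w" by (simp add: F_def)
      moreover have "y \<in> ball q r" using y[of n] tr by (simp add: x_def \<rho>_def dist_commute)
      ultimately show ?L by blast
    qed
    obtain s where "s \<in> borel_measurable M" "\<And>w. w \<in> space M \<Longrightarrow> s w \<in> F w"
    proof (rule measurable_selection[of M F])
      fix w assume w: "w \<in> space M"
      have "F w = (\<Inter>i\<in>{..<n}. {y. dist y (f i w) = D n i w})" by (auto simp: F_def)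
      then show "closed (F w)"
        by (auto intro!: closed_INT closed_Collect_eq continuous_intros)
      \<comment> \<open>Any point will do as centre: with a radius above all the defects the
        criterion \<open>hit\<close> applies and shows that candidates exist.\<close>
      obtain q :: 'u where True by blast
      define r where "r = 1 + (\<Sum>i<n. \<bar>D n i w - dist (f i w) q\<bar>)"
      have "\<bar>D n i w - dist (f i w) q\<bar> < r" if "i < n" for i
        using member_le_sum[of i "{..<n}" "\<lambda>i. \<bar>D n i w - dist (f i w) q\<bar>"] that by (simp add: r_def)
      moreover have "0 < r" unfolding r_def by (simp add: add_pos_nonneg sum_nonneg)
      ultimately show "F w \<noteq> {}" using hit[OF w, of q r] by auto
    next
      fix q r
      have "{w \<in> space M. F w \<inter> ball q r \<noteq> {}} =
          {w \<in> space M. 0 < r \<and> (\<forall>i\<in>{..<n}. \<bar>D n i w - dist (f i w) q\<bar> < r)}"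
        by (intro Collect_cong conj_cong refl) (simp add: hit Ball_def)
      also have "\<dots> \<in> sets M"
      proof -
        have [measurable]: "Measurable.pred M (\<lambda>w. \<bar>D n i w - dist (f i w) q\<bar> < r)" if "i \<in> {..<n}" for i
        proof -
          have [measurable]: "f i \<in> borel_measurable M" "D n i \<in> borel_measurable M"
            using that f_meas meas by auto
          show ?thesis by measurable
        qed
        show ?thesis by measurable
      qed
      finally show "{w \<in> space M. F w \<inter> ball q r \<noteq> {}} \<in> sets M" .
    qed auto
    then show "\<exists>r. P f n r" by (auto simp: P_def F_def)
  qed
  then obtain e where e: "\<And>n. P e n (e n)" by blast
  show ?thesis
  proof
    show "e n \<in> borel_measurable M" for n using e by (simp add: P_def)
    show "dist (e n w) (e m w) = D n m w" if "w \<in> space M" for w n m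
      using e[of n] e[of m] that zero sym
      by (cases n m rule: linorder_cases) (auto simp: P_def dist_commute)
  qed
qed

lemma measurable_closure_range:
  fixes e :: "nat \<Rightarrow> 'w \<Rightarrow> 'a::metric_space"
  assumes e: "\<And>n. e n \<in> borel_measurable M"
  shows "(\<lambda>w. closure (range (\<lambda>n. e n w))) \<in> M \<rightarrow>\<^sub>M effros"
proof (rule measurable_effrosI)
  fix W :: "'a set" assume W: "open W"
  have "{w \<in> space M. closure (range (\<lambda>n. e n w)) \<inter> W \<noteq> {}} = (\<Union>n. e n -` W \<inter> space M)"
    using open_Int_closure_eq_empty[OF W] by (auto simp: Int_commute)
  also have "\<dots> \<in> sets M" using measurable_sets[OF e borel_open[OF W]] by (intro sets.countable_UN) auto
  finally show "{w \<in> space M. closure (range (\<lambda>n. e n w)) \<inter> W \<noteq> {}} \<in> sets M" .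
qed auto

section \<open>Reductions between isometry relations\<close>

lemma isometric_sets_image:
  assumes "\<And>x y. x \<in> U \<Longrightarrow> y \<in> U \<Longrightarrow> dist (f x) (f y) = dist x y"
  shows "isometric_sets U (f ` U)"
  using assms unfolding isometric_sets_def by blast

lemma isometric_setsE:
  assumes "isometric_sets U V"
  obtains f where "f ` U = V" "\<And>x y. x \<in> U \<Longrightarrow> y \<in> U \<Longrightarrow> dist (f x) (f y) = dist x y"
  using assms unfolding isometric_sets_def by blast

lemma isometric_sets_sym:
  assumes "isometric_sets U V"
  shows "isometric_sets V U"
proof -
  obtain f where f: "f ` U = V" "\<And>x y. x \<in> U \<Longrightarrow> y \<in> U \<Longrightarrow> dist (f x) (f y) = dist x y"
    using assms by (rule isometric_setsE) (rule that, assumption, blast)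
  have "inj_on f U"
    by (rule inj_onI) (metis f(2) dist_eq_0_iff)
  then show ?thesis
    unfolding isometric_sets_def
    by (intro exI[of _ "inv_into U f"]) (auto simp: f(2) inv_into_f_f simp flip: f(1))
qed

lemma isometric_sets_trans:
  assumes "isometric_sets U V" "isometric_sets V W"
  shows "isometric_sets U W"
proof -
  obtain f where f: "f ` U = V" "\<And>x y. x \<in> U \<Longrightarrow> y \<in> U \<Longrightarrow> dist (f x) (f y) = dist x y"
    using assms(1) by (rule isometric_setsE) (rule that, assumption, blast)
  obtain g where g: "g ` V = W" "\<And>x y. x \<in> V \<Longrightarrow> y \<in> V \<Longrightarrow> dist (g x) (g y) = dist x y"
    using assms(2) by (rule isometric_setsE) (rule that, assumption, blast)
  show ?thesis
    unfolding isometric_sets_def using f g by (intro exI[of _ "g \<circ> f"]) (auto simp: image_comp[symmetric])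
qed

lemma borel_reducible_trans:
  assumes "borel_reducible L E M F" "borel_reducible M F N G"
  shows "borel_reducible L E N G"
proof -
  obtain f where f: "f \<in> L \<rightarrow>\<^sub>M M" "\<And>x y. x \<in> space L \<Longrightarrow> y \<in> space L \<Longrightarrow> E x y \<longleftrightarrow> F (f x) (f y)"
    using assms(1) unfolding borel_reducible_def by blast
  obtain g where g: "g \<in> M \<rightarrow>\<^sub>M N" "\<And>x y. x \<in> space M \<Longrightarrow> y \<in> space M \<Longrightarrow> F x y \<longleftrightarrow> G (g x) (g y)"
    using assms(2) unfolding borel_reducible_def by blast
  show ?thesis
    unfolding borel_reducible_def
  proof (intro bexI[of _ "\<lambda>x. g (f x)"] ballI)
    fix x y assume xy: "x \<in> space L" "y \<in> space L"
    then have "f x \<in> space M" "f y \<in> space M" using measurable_space[OF f(1)] by auto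
    then show "E x y \<longleftrightarrow> G (g (f x)) (g (f y))" using f(2)[OF xy] g(2) by simp
  qed (use measurable_compose[OF f(1) g(1)] in simp)
qed

abbreviation isometry_reducible ::
    "'u::metric_space set set \<Rightarrow> 'v::metric_space set set \<Rightarrow> bool" where
  "isometry_reducible S T \<equiv>
     borel_reducible (restrict_space effros S) isometric_sets (restrict_space effros T) isometric_sets"

lemma isometry_reducibleI:
  assumes "S \<subseteq> space effros" "\<Phi> \<in> restrict_space effros S \<rightarrow>\<^sub>M effros"
    and "\<And>U. U \<in> S \<Longrightarrow> \<Phi> U \<in> T"
    and "\<And>U V. U \<in> S \<Longrightarrow> V \<in> S \<Longrightarrow> isometric_sets U V \<longleftrightarrow> isometric_sets (\<Phi> U) (\<Phi> V)"
  shows "isometry_reducible S T"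
proof -
  have "space (restrict_space effros S) = S" using assms(1) by (auto simp: space_restrict_space)
  then show ?thesis
    unfolding borel_reducible_def using assms
    by (intro bexI[of _ \<Phi>] measurable_restrict_space2) auto
qed

lemma isometry_reducible_mono:
  assumes "S \<subseteq> T" "S \<subseteq> space effros"
  shows "isometry_reducible S T"
  by (rule isometry_reducibleI[where \<Phi> = "\<lambda>U. U"]) (use assms in \<open>auto intro: measurable_restrict_space1\<close>)

lemma V_sub_subset_space: "V_sub A \<subseteq> space effros"
  by (auto simp: V_sub_def space_effros)

lemma V_star_subset_V_sub: "V_star A \<subseteq> V_sub A"
  by (auto simp: V_star_def V_sub_def)

lemma V_sub_mono: "A \<subseteq> B \<Longrightarrow> V_sub A \<subseteq> V_sub B"
  by (auto simp: V_sub_def)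

lemma distancesI: "x \<in> U \<Longrightarrow> y \<in> U \<Longrightarrow> dist x y \<in> distances U"
  by (auto simp: distances_def)

lemma V_sub_iff:
  "U \<in> V_sub A \<longleftrightarrow> closed U \<and> U \<noteq> {} \<and> (\<forall>x\<in>U. \<forall>y\<in>U. dist x y \<in> A)"
  by (auto simp: V_sub_def distances_def)

lemma V_star_iff:
  "U \<in> V_star A \<longleftrightarrow> U \<in> V_sub A \<and> (\<forall>a\<in>A. \<exists>x\<in>U. \<exists>y\<in>U. dist x y = a)"
  by (fastforce simp: V_star_def V_sub_def distances_def)

text \<open>The value meets an open \<open>W\<close> exactly if \<open>K\<close> does, which does
  not depend on \<open>U\<close>, or if \<open>U\<close> meets the union of the preimages of
  \<open>W\<close>, which is open. Hence the index set \<open>S\<close> may be uncountable; for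
  products it is a whole closed set.\<close>

lemma measurable_union_images:
  fixes i :: "'s \<Rightarrow> 'u::topological_space \<Rightarrow> 'v::topological_space"
  assumes cont: "\<And>s. s \<in> S \<Longrightarrow> continuous_on UNIV (i s)"
    and cl: "\<And>U. U \<in> T \<Longrightarrow> closed ((\<Union>s\<in>S. i s ` U) \<union> K)"
    and ne: "S \<noteq> {}" and T: "T \<subseteq> space effros"
  shows "(\<lambda>U. (\<Union>s\<in>S. i s ` U) \<union> K) \<in> restrict_space effros T \<rightarrow>\<^sub>M effros"
proof (rule measurable_effrosI)
  have sp: "space (restrict_space effros T) = T" using T by (auto simp: space_restrict_space)
  fix U :: "'u set" assume "U \<in> space (restrict_space effros T)"
  then have "U \<in> T" by (simp add: sp)
  then have "U \<noteq> {}" using T by (auto simp: space_effros)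
  then show "closed ((\<Union>s\<in>S. i s ` U) \<union> K)" "(\<Union>s\<in>S. i s ` U) \<union> K \<noteq> {}"
    using cl[OF \<open>U \<in> T\<close>] ne by auto
next
  have sp: "space (restrict_space effros T) = T" using T by (auto simp: space_restrict_space)
  fix W :: "'v set" assume W: "open W"
  let ?V = "\<Union>s\<in>S. i s -` W"
  have V: "open ?V" using cont W by (auto intro!: open_UN open_vimage)
  show "{U \<in> space (restrict_space effros T). ((\<Union>s\<in>S. i s ` U) \<union> K) \<inter> W \<noteq> {}}
      \<in> sets (restrict_space effros T)"
  proof (cases "K \<inter> W = {}")
    case True
    then have "{U \<in> space (restrict_space effros T). ((\<Union>s\<in>S. i s ` U) \<union> K) \<inter> W \<noteq> {}} =
        T \<inter> {U \<in> space effros. U \<inter> ?V \<noteq> {}}"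
      unfolding sp using T by blast
    then show ?thesis using effros_hit[OF V] by (auto simp: sets_restrict_space)
  next
    case False
    then have "{U \<in> space (restrict_space effros T). ((\<Union>s\<in>S. i s ` U) \<union> K) \<inter> W \<noteq> {}} =
        space (restrict_space effros T)" by blast
    then show ?thesis by simp
  qed
qed

text \<open>The last hypothesis says that the inverse of \<open>g\<close> is uniformly continuous,
  so a convergent sequence in the image comes from a Cauchy sequence in \<open>U\<close>.\<close>

lemma closed_uniform_embedding_image:
  fixes g :: "'a::complete_space \<Rightarrow> 'b::metric_space"
  assumes U: "closed U" and g: "continuous_on U g"
    and exp: "\<And>e. 0 < e \<Longrightarrow> \<exists>d>0. \<forall>x\<in>U. \<forall>y\<in>U. dist (g x) (g y) < d \<longrightarrow> dist x y < e"
  shows "closed (g ` U)"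
  unfolding closed_sequential_limits
proof (intro allI impI, elim conjE)
  fix y l assume "\<forall>n. y n \<in> g ` U" and l: "y \<longlonglongrightarrow> l"
  then have "\<forall>n. \<exists>x. x \<in> U \<and> y n = g x" by blast
  then obtain x where x: "\<And>n. x n \<in> U" "\<And>n. y n = g (x n)" by metis
  have "Cauchy x"
  proof (rule metric_CauchyI)
    fix e :: real assume "0 < e"
    then obtain d where d: "0 < d" "\<forall>x\<in>U. \<forall>y\<in>U. dist (g x) (g y) < d \<longrightarrow> dist x y < e"
      using exp by blast
    obtain N where "\<forall>m\<ge>N. \<forall>n\<ge>N. dist (y m) (y n) < d"
      using metric_CauchyD[OF LIMSEQ_imp_Cauchy[OF l] d(1)] by blast
    with d(2) x show "\<exists>N. \<forall>m\<ge>N. \<forall>n\<ge>N. dist (x m) (x n) < e" by metis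
  qed
  then obtain x0 where x0: "x \<longlonglongrightarrow> x0" using Cauchy_convergent convergent_def by blast
  then have "x0 \<in> U" using closed_sequentially[OF U] x(1) by blast
  then have "(\<lambda>n. g (x n)) \<longlonglongrightarrow> g x0"
    using g x0 x(1) unfolding continuous_on_sequentially comp_def by blast
  then have "l = g x0" using l x(2) LIMSEQ_unique by (metis (no_types, lifting) ext)
  with \<open>x0 \<in> U\<close> show "l \<in> g ` U" by blast
qed

lemma closed_isometric_image:
  fixes g :: "'a::complete_space \<Rightarrow> 'b::metric_space"
  assumes "closed U" and g: "\<And>x y. x \<in> U \<Longrightarrow> y \<in> U \<Longrightarrow> dist (g x) (g y) = dist x y"
  shows "closed (g ` U)"
  by (rule closed_uniform_embedding_image) (use assms in \<open>auto simp: continuous_on_iff\<close>)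

section \<open>Products with the maximum metric\<close>

lemma urysohn_max_product:
  obtains \<mu> :: "'u::urysohn_space \<times> 'u \<Rightarrow> 'u"
  where "\<And>x y x' y'. dist (\<mu> (x, y)) (\<mu> (x', y')) = max (dist x x') (dist y y')"
proof -
  obtain c :: "nat \<Rightarrow> 'u" where c: "\<And>x e. 0 < e \<Longrightarrow> \<exists>k. dist (c k) x < e"
    using dense_sequence by blast
  define D where "D s t = max (dist (fst s) (fst t)) (dist (snd s) (snd t))" for s t :: "'u \<times> 'u"
  have met: "Metric_space UNIV D"
  proof
    fix s t u
    show "0 \<le> D s t" "D s t = D t s" by (auto simp: D_def dist_commute le_max_iff_disj)
    have "dist (fst s) (fst u) \<le> D s t + D t u" "dist (snd s) (snd u) \<le> D s t + D t u"
      using dist_triangle[of "fst s" "fst u" "fst t"] dist_triangle[of "snd s" "snd u" "snd t"]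
      unfolding D_def by linarith+
    then show "D s u \<le> D s t + D t u" by (simp add: D_def)
    have "0 \<le> dist (fst s) (fst t)" "0 \<le> dist (snd s) (snd t)" by auto
    then show "D s t = 0 \<longleftrightarrow> s = t"
      unfolding D_def prod_eq_iff by (metis dist_eq_0_iff max.absorb1 max.absorb2 max_def order_antisym)
  qed
  obtain \<mu> :: "'u \<times> 'u \<Rightarrow> 'u" where \<mu>: "\<And>s t. s \<in> UNIV \<Longrightarrow> t \<in> UNIV \<Longrightarrow> dist (\<mu> s) (\<mu> t) = D s t"
  proof (rule urysohn_embedding[OF met, of "range c \<times> range c"])
    fix s and e :: real assume "0 < e"
    then obtain j k where "dist (c j) (fst s) < e" "dist (c k) (snd s) < e" using c by blast
    then show "\<exists>t\<in>range c \<times> range c. D s t < e"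
      by (intro bexI[of _ "(c j, c k)"]) (auto simp: D_def dist_commute)
  qed auto
  show ?thesis
    by (rule that[of \<mu>]) (simp add: \<mu> D_def)
qed

lemma max_product_continuous:
  assumes \<mu>: "\<And>x y x' y'. dist (\<mu> (x, y)) (\<mu> (x', y')) = max (dist x x') (dist y y')"
  shows "continuous_on UNIV (\<lambda>u. \<mu> (u, z))"
  by (auto simp: continuous_on_iff \<mu>)

lemma max_product_closed:
  fixes \<mu> :: "'u::complete_space \<times> 'u \<Rightarrow> 'u"
  assumes \<mu>: "\<And>x y x' y'. dist (\<mu> (x, y)) (\<mu> (x', y')) = max (dist x x') (dist y y')"
    and "closed U" "closed Z"
  shows "closed (\<mu> ` (U \<times> Z))"
proof (rule closed_uniform_embedding_image)
  have le: "dist (\<mu> s) (\<mu> t) \<le> dist s t" for s t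
    using dist_fst_le[of s t] dist_snd_le[of s t] by (cases s; cases t) (simp add: \<mu>)
  then show "continuous_on (U \<times> Z) \<mu>"
    unfolding continuous_on_iff by (meson le_less_trans)
  have ge: "dist s t \<le> 2 * dist (\<mu> s) (\<mu> t)" for s t
  proof -
    obtain x y x' y' where st: "s = (x, y)" "t = (x', y')" by fastforce
    have "dist s t \<le> \<bar>dist x x'\<bar> + \<bar>dist y y'\<bar>"
      unfolding st dist_Pair_Pair by (rule sqrt_sum_squares_le_sum_abs)
    then show ?thesis by (simp add: st \<mu>)
  qed
  show "\<exists>d>0. \<forall>x\<in>U \<times> Z. \<forall>y\<in>U \<times> Z. dist (\<mu> x) (\<mu> y) < d \<longrightarrow> dist x y < e" if "0 < e" for e
    using that ge by (intro exI[of _ "e / 2"]) (smt (verit) field_sum_of_halves half_gt_zero)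
qed (use assms in \<open>auto intro: closed_Times\<close>)

text \<open>Product points over \<open>z\<^sub>0\<close> will be recognised as those having no neighbour at distance \<open>a\<close>.\<close>
lemma V_star_marked:
  assumes "V_star A \<noteq> ({} :: 'u::urysohn_space set set)" and a: "a \<in> A" "0 < a" and b: "b \<in> A" "a < b"
  obtains Z :: "'u::urysohn_space set" and z0 where "Z \<in> V_star A" "z0 \<in> Z"
    "\<And>z. z \<in> Z \<Longrightarrow> dist z0 z \<noteq> a" "\<And>z. z \<in> Z \<Longrightarrow> z \<noteq> z0 \<Longrightarrow> \<exists>z'\<in>Z. dist z z' = a"
proof -
  obtain Y :: "'u set" where Y: "Y \<in> V_star A" using assms(1) by blast
  then have "closed Y" and Yd: "\<And>x y. x \<in> Y \<Longrightarrow> y \<in> Y \<Longrightarrow> dist x y \<in> A"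
    and Ys: "\<And>c. c \<in> A \<Longrightarrow> \<exists>x\<in>Y. \<exists>y\<in>Y. dist x y = c" by (auto simp: V_star_iff V_sub_iff)
  obtain y0 where y0: "y0 \<in> Y" using Y by (auto simp: V_star_iff V_sub_iff)
  obtain \<mu> :: "'u \<times> 'u \<Rightarrow> 'u"
    where \<mu>: "\<And>x y x' y'. dist (\<mu> (x, y)) (\<mu> (x', y')) = max (dist x x') (dist y y')"
    using urysohn_max_product by blast
  obtain p0 :: 'u where True by blast
  obtain p1 where p1: "dist p1 p0 = a"
    using urysohn_extension[of "{p0}" "\<lambda>_. a"] a by auto
  obtain p2 where p2: "dist p2 p0 = b" "dist p2 p1 = b"
  proof (rule urysohn_extension[of "{p0, p1}" "\<lambda>_. b"])
    show "dist x y \<le> b + b" if "x \<in> {p0, p1}" "y \<in> {p0, p1}" for x y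
    proof -
      have "dist x y \<le> a" using that p1 a(2) by (auto simp: dist_commute)
      with a b show ?thesis by simp
    qed
  qed (use that in auto)
  note p = p1 p2 p1[unfolded dist_commute[of p1]] p2[unfolded dist_commute[of p2]]
  \<comment> \<open>Points \<open>\<mu> (y, p0)\<close> and \<open>\<mu> (y, p1)\<close> are
    partners at distance exactly \<open>a\<close>. The added point lies over \<open>p2\<close>,
    hence at distance at least \<open>b > a\<close> from every other point.\<close>
  define Z where "Z = \<mu> ` (Y \<times> {p0, p1}) \<union> {\<mu> (y0, p2)}"
  have maxA: "max s t \<in> A" if "s \<in> A" "t \<in> A" for s t using that by (simp add: max_def)
  have zero: "0 \<in> A" using Yd[OF y0 y0] by simp
  show ?thesis
  proof
    have "closed Z" unfolding Z_def using max_product_closed[OF \<mu> \<open>closed Y\<close>, of "{p0, p1}"] by auto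
    moreover have "dist x y \<in> A" if xy: "x \<in> Z" "y \<in> Z" for x y
      using xy Yd y0 a b zero
      by (auto simp: Z_def \<mu> p intro!: maxA)
    moreover have "\<exists>x\<in>Z. \<exists>y\<in>Z. dist x y = c" if c: "c \<in> A" for c
    proof -
      obtain x y where "x \<in> Y" "y \<in> Y" "dist x y = c" using Ys[OF c] by blast
      then show ?thesis
        by (intro bexI[of _ "\<mu> (x, p0)"] bexI[of _ "\<mu> (y, p0)"]) (auto simp: \<mu> Z_def)
    qed
    ultimately show "Z \<in> V_star A" by (auto simp: V_star_iff V_sub_iff Z_def)
    show "\<mu> (y0, p2) \<in> Z" by (simp add: Z_def)
    show "dist (\<mu> (y0, p2)) z \<noteq> a" if "z \<in> Z" for z
      using that a b by (auto simp: Z_def \<mu> p)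
    show "\<exists>z'\<in>Z. dist z z' = a" if z: "z \<in> Z" "z \<noteq> \<mu> (y0, p2)" for z
    proof -
      from z obtain y p where yp: "y \<in> Y" "p = p0 \<or> p = p1" "z = \<mu> (y, p)" by (auto simp: Z_def)
      then show ?thesis using a
        by (intro bexI[of _ "\<mu> (y, if p = p0 then p1 else p0)"]) (auto simp: Z_def \<mu> p)
    qed
  qed
qed

text \<open>A maximum equals \<open>a\<close> only if one of the two terms does. \<open>U\<close>
  never contributes \<open>a\<close>, so \<open>\<mu> (u, z)\<close> has a point at distance
  \<open>a\<close> exactly when \<open>z\<close> has one in \<open>Z\<close>, that is, when
  \<open>z \<noteq> z0\<close>. Hence \<open>far\<close> is defined from the metric alone and cuts
  out a copy of \<open>U\<close>, while \<open>Z\<close> already realizes every distance of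
  \<open>A\<close>.\<close>

lemma avoiding_reducible_V_star:
  assumes "V_star A \<noteq> ({} :: 'u::urysohn_space set set)" and a: "a \<in> A" "0 < a" and b: "b \<in> A" "a < b"
  shows "isometry_reducible (V_sub (A - {a}) :: 'u set set) (V_star A :: 'u set set)"
proof -
  obtain Z :: "'u set" and z0 where Z: "Z \<in> V_star A" "z0 \<in> Z"
    "\<And>z. z \<in> Z \<Longrightarrow> dist z0 z \<noteq> a" "\<And>z. z \<in> Z \<Longrightarrow> z \<noteq> z0 \<Longrightarrow> \<exists>z'\<in>Z. dist z z' = a"
    using V_star_marked[OF assms] by blast
  obtain \<mu> :: "'u \<times> 'u \<Rightarrow> 'u"
    where \<mu>: "\<And>x y x' y'. dist (\<mu> (x, y)) (\<mu> (x', y')) = max (dist x x') (dist y y')"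
    using urysohn_max_product by blast
  have inj: "inj \<mu>"
  proof (rule injI)
    fix s t assume "\<mu> s = \<mu> t"
    then have "dist (\<mu> s) (\<mu> t) = 0" by simp
    then show "s = t" by (cases s; cases t) (auto simp: \<mu> max_def split: if_splits)
  qed
  have closedZ: "closed Z" and Zd: "\<And>x y. x \<in> Z \<Longrightarrow> y \<in> Z \<Longrightarrow> dist x y \<in> A"
    and Zs: "\<And>c. c \<in> A \<Longrightarrow> \<exists>x\<in>Z. \<exists>y\<in>Z. dist x y = c"
    using Z(1) by (auto simp: V_star_iff V_sub_iff)
  define far where "far Y = {y \<in> Y. \<forall>y'\<in>Y. dist y y' \<noteq> a}" for Y :: "'u set"
  have far: "far (\<mu> ` (U \<times> Z)) = (\<lambda>u. \<mu> (u, z0)) ` U" if U: "U \<in> V_sub (A - {a})" for U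
  proof (intro equalityI subsetI)
    fix y assume y: "y \<in> far (\<mu> ` (U \<times> Z))"
    then obtain u z where uz: "u \<in> U" "z \<in> Z" "y = \<mu> (u, z)" by (auto simp: far_def)
    have "z = z0"
    proof (rule ccontr)
      assume "z \<noteq> z0"
      then obtain z' where "z' \<in> Z" "dist z z' = a" using Z(4) uz(2) by blast
      then have "dist y (\<mu> (u, z')) = a" "\<mu> (u, z') \<in> \<mu> ` (U \<times> Z)" using uz a by (auto simp: \<mu>)
      moreover have "\<forall>y'\<in>\<mu> ` (U \<times> Z). dist y y' \<noteq> a" using y by (simp add: far_def)
      ultimately show False by metis
    qed
    with uz show "y \<in> (\<lambda>u. \<mu> (u, z0)) ` U" by blast
  next
    fix y assume "y \<in> (\<lambda>u. \<mu> (u, z0)) ` U"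
    then obtain u where u: "u \<in> U" "y = \<mu> (u, z0)" by blast
    have "dist y (\<mu> (u', z)) \<noteq> a" if "u' \<in> U" "z \<in> Z" for u' z
      using Z(3)[OF that(2)] U u that by (auto simp: \<mu> V_sub_iff max_def split: if_splits)
    with u Z(2) show "y \<in> far (\<mu> ` (U \<times> Z))" by (auto simp: far_def)
  qed
  have far_iso: "isometric_sets (far Y) (far Y')" if iso: "isometric_sets Y Y'" for Y Y'
  proof -
    obtain h where h: "h ` Y = Y'" "\<And>x y. x \<in> Y \<Longrightarrow> y \<in> Y \<Longrightarrow> dist (h x) (h y) = dist x y"
      using iso by (rule isometric_setsE) (rule that, assumption, blast)
    have "h ` far Y = far Y'"
      unfolding far_def h(1)[symmetric] using h(2) by (auto simp: image_iff)
    moreover have "isometric_sets (far Y) (h ` far Y)"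
      by (rule isometric_sets_image) (use h in \<open>auto simp: far_def\<close>)
    ultimately show ?thesis by simp
  qed
  have slice: "isometric_sets U ((\<lambda>u. \<mu> (u, z0)) ` U)" for U
    by (rule isometric_sets_image) (simp add: \<mu>)
  show ?thesis
  proof (rule isometry_reducibleI[where \<Phi> = "\<lambda>U. \<mu> ` (U \<times> Z)"])
    have eq: "\<mu> ` (U \<times> Z) = (\<Union>z\<in>Z. (\<lambda>u. \<mu> (u, z)) ` U) \<union> {}" for U by auto
    show "(\<lambda>U. \<mu> ` (U \<times> Z)) \<in> restrict_space effros (V_sub (A - {a})) \<rightarrow>\<^sub>M effros"
      unfolding eq
    proof (rule measurable_union_images)
      show "closed ((\<Union>z\<in>Z. (\<lambda>u. \<mu> (u, z)) ` U) \<union> {})" if "U \<in> V_sub (A - {a})" for U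
        unfolding eq[symmetric] using that closedZ by (intro max_product_closed[OF \<mu>]) (auto simp: V_sub_iff)
    qed (use Z V_sub_subset_space max_product_continuous[OF \<mu>] in auto)
    fix U :: "'u set" assume U: "U \<in> V_sub (A - {a})"
    then obtain u where u: "u \<in> U" by (auto simp: V_sub_iff)
    have "closed (\<mu> ` (U \<times> Z))" using U closedZ by (intro max_product_closed[OF \<mu>]) (auto simp: V_sub_iff)
    moreover have "\<exists>x\<in>\<mu> ` (U \<times> Z). \<exists>y\<in>\<mu> ` (U \<times> Z). dist x y = c" if c: "c \<in> A" for c
    proof -
      obtain x y where "x \<in> Z" "y \<in> Z" "dist x y = c" using Zs[OF c] by blast
      with u show ?thesis
        by (intro bexI[of _ "\<mu> (u, x)"] bexI[of _ "\<mu> (u, y)"]) (auto simp: \<mu>)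
    qed
    ultimately show "\<mu> ` (U \<times> Z) \<in> V_star A"
      using U Zd Z(2) by (auto simp: V_star_iff V_sub_iff \<mu> max_def)
    fix V :: "'u set" assume V: "V \<in> V_sub (A - {a})"
    show "isometric_sets U V \<longleftrightarrow> isometric_sets (\<mu> ` (U \<times> Z)) (\<mu> ` (V \<times> Z))"
    proof
      assume "isometric_sets U V"
      then obtain h where h: "h ` U = V" "\<And>x y. x \<in> U \<Longrightarrow> y \<in> U \<Longrightarrow> dist (h x) (h y) = dist x y"
        by (rule isometric_setsE) (rule that, assumption, blast)
      define g where "g = \<mu> \<circ> map_prod h id \<circ> inv \<mu>"
      have g: "g (\<mu> (x, y)) = \<mu> (h x, y)" for x y by (simp add: g_def inv_f_f[OF inj])
      have "\<mu> ` (V \<times> Z) = g ` \<mu> ` (U \<times> Z)"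
        unfolding h(1)[symmetric] by (force simp: g image_iff)
      moreover have "isometric_sets (\<mu> ` (U \<times> Z)) (g ` \<mu> ` (U \<times> Z))"
        by (rule isometric_sets_image) (use h(2) in \<open>auto simp: g \<mu>\<close>)
      ultimately show "isometric_sets (\<mu> ` (U \<times> Z)) (\<mu> ` (V \<times> Z))" by simp
    next
      assume "isometric_sets (\<mu> ` (U \<times> Z)) (\<mu> ` (V \<times> Z))"
      from far_iso[OF this] show "isometric_sets U V"
        unfolding far[OF U] far[OF V]
        using slice[of U] isometric_sets_sym[OF slice[of V]] isometric_sets_trans by blast
    qed
  qed (rule V_sub_subset_space)
qed

section \<open>Distance sets containing an interval or having a maximum\<close>

text \<open>Two copies of \<open>U\<close>: inside a copy distances are truncated at \<open>r\<close>, while the distances between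
  the copies lie in the interval, stay above \<open>r\<close>, and encode the original metric faithfully.\<close>
lemma interval_reducible:
  fixes A :: "real set"
  assumes A: "A \<subseteq> {0..}" and I: "\<alpha> < \<beta>" "{\<alpha><..<\<beta>} \<subseteq> A"
  obtains a b where "a \<in> A" "0 < a" "b \<in> A" "a < b"
    "isometry_reducible (V_sub A :: 'u::urysohn_space set set) (V_sub (A - {a}) :: 'u set set)"
proof -
  have \<alpha>: "0 \<le> \<alpha>"
  proof (rule ccontr)
    assume "\<not> 0 \<le> \<alpha>"
    then have "max (\<alpha> / 2) ((\<alpha> + \<beta>) / 2) \<in> {\<alpha><..<\<beta>} \<or> \<beta> \<le> 0" "(\<alpha> + \<beta>) / 2 \<in> {\<alpha><..<\<beta>}"
      "\<beta> \<le> 0 \<Longrightarrow> (\<alpha> + \<beta>) / 2 < 0" "min (\<alpha> / 2) ((\<alpha> + \<beta>) / 2) \<in> {\<alpha><..<\<beta>}" "min (\<alpha> / 2) ((\<alpha> + \<beta>) / 2) < 0"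
      using I(1) by (auto simp: max_def min_def)
    then show False using A I(2) by fastforce
  qed
  \<comment> \<open>Six equal pieces leave room for pairwise separated values: the truncation level
    \<open>r\<close>, the range of the cross distances from \<open>p\<close> to
    \<open>p + L\<close>, the missed value \<open>a\<close>, and \<open>b\<close> above it.\<close>
  define L where "L = (\<beta> - \<alpha>) / 6"
  have L: "0 < L" "\<beta> = \<alpha> + 6 * L" using I(1) by (auto simp: L_def field_simps)
  define r p a b where "r = \<alpha> + L" and "p = \<alpha> + 2 * L" and "a = \<alpha> + 4 * L" and "b = \<alpha> + 5 * L"
  \<comment> \<open>\<open>\<eta> \<le> 1\<close> keeps \<phi> from varying faster than the
    distance, \<open>\<eta> \<le> r\<close> from varying by more than the truncation level, and
    \<open>\<eta> \<le> L\<close> keeps its values below \<open>p + L\<close>. The first two give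
    \<open>\<phi>lip\<close>, the triangle inequality for two cross distances and one distance
    inside a copy.\<close>
  define \<eta> where "\<eta> = min 1 L"
  have \<eta>: "0 < \<eta>" "\<eta> \<le> 1" "\<eta> \<le> L" "\<eta> \<le> r" using L \<alpha> by (auto simp: \<eta>_def r_def)
  \<comment> \<open>\<open>g x\<close> is \<open>x / (1 + x)\<close>: bounded by 1, injective and
    1-Lipschitz on nonnegative arguments.\<close>
  define g :: "real \<Rightarrow> real" where "g x = 1 - 1 / (1 + x)" for x
  have g01: "0 \<le> g x" "g x < 1" if "0 \<le> x" for x using that by (auto simp: g_def field_simps)
  have glip: "g x \<le> g y + z" if "0 \<le> x" "0 \<le> y" "0 \<le> z" "x \<le> y + z" for x y z
  proof -
    have "g x \<le> g (y + z)" unfolding g_def using that by (auto intro!: divide_left_mono)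
    also have "g (y + z) - g y = z / ((1 + y) * (1 + y + z))"
      using that by (simp add: g_def divide_simps) (simp add: algebra_simps)
    then have "g (y + z) \<le> g y + z"
      using that mult_mono[of 1 "1 + y" 1 "1 + y + z"]
      by (smt (verit) divide_le_eq_1 divide_right_mono mult_cancel_left1 frac_le div_by_1)
    finally show ?thesis by simp
  qed
  have ginj: "x = y" if "0 \<le> x" "0 \<le> y" "g x = g y" for x y
    using that by (auto simp: g_def divide_simps distrib_left mult.commute split: if_splits)
  define \<phi> where "\<phi> x = p + \<eta> * g x" for x
  have \<phi>range: "p \<le> \<phi> x" "\<phi> x < p + L" if "0 \<le> x" for x
  proof -
    show "p \<le> \<phi> x" using g01[OF that] \<eta> by (simp add: \<phi>_def)
    have "\<eta> * g x < \<eta> * 1" using g01[OF that] \<eta>(1) by (intro mult_strict_left_mono)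
    then show "\<phi> x < p + L" using \<eta>(3) by (simp add: \<phi>_def)
  qed
  have \<phi>lip: "\<phi> x \<le> \<phi> y + min z r" if xyz: "0 \<le> x" "0 \<le> y" "0 \<le> z" "x \<le> y + z" for x y z
  proof -
    have "\<eta> * g x \<le> \<eta> * (g y + z)" "\<eta> * g x \<le> \<eta> * (g y + 1)"
      using glip[OF xyz] g01[OF xyz(1)] g01[OF xyz(2)] \<eta>(1) by (auto intro!: mult_left_mono)
    moreover have "\<eta> * z \<le> z" using \<eta> xyz(3) by (simp add: mult_left_le_one_le)
    ultimately show ?thesis using \<eta>(4) by (simp add: \<phi>_def algebra_simps)
  qed
  have \<phi>inj: "x = y" if "0 \<le> x" "0 \<le> y" "\<phi> x = \<phi> y" for x y
    using that \<eta>(1) ginj by (simp add: \<phi>_def)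
  have rp: "0 < r" "r < p" "p + L < a" "a < b" "0 < a" using L \<alpha> by (auto simp: r_def p_def a_def b_def)
  have inA: "r \<in> A" "a \<in> A" "b \<in> A" using I(2) L \<alpha> by (auto simp: r_def a_def b_def)
  have \<phi>A: "\<phi> x \<in> A - {a}" if "0 \<le> x" for x
    using \<phi>range[OF that] rp I(2) L by (auto simp: p_def a_def)
  have minA: "min x r \<in> A - {a}" if "x \<in> A" for x
    using that inA(1) rp L by (auto simp: min_def)
  define D where "D s t = (if snd s = snd t then min (dist (fst s) (fst t)) r else \<phi> (dist (fst s) (fst t)))"
    for s t :: "'u \<times> bool"
  have D: "D (u, s) (v, t) = (if s = t then min (dist u v) r else \<phi> (dist u v))" for u v s t
    by (simp add: D_def)
  have D_le: "D (u, s) (v, t) \<le> r \<longleftrightarrow> s = t" for u v s t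
    using \<phi>range(1)[OF zero_le_dist[of u v]] rp by (auto simp: D)
  have met: "Metric_space UNIV D"
  proof
    fix s t w :: "'u \<times> bool"
    obtain u v x and a b c where stw: "s = (u, a)" "t = (v, b)" "w = (x, c)" by (metis surj_pair)
    show "0 \<le> D s t" using \<phi>range(1)[OF zero_le_dist[of u v]] rp by (auto simp: stw D)
    show "D s t = D t s" by (auto simp: stw D dist_commute)
    show "D s t = 0 \<longleftrightarrow> s = t"
      using \<phi>range(1)[OF zero_le_dist[of u v]] rp by (auto simp: stw D min_def)
    have tri: "dist u x \<le> dist u v + dist v x" "dist u x \<le> dist v x + dist u v" "0 \<le> dist u v" "0 \<le> dist v x"
      using dist_triangle[of u x v] by auto
    show "D s w \<le> D s t + D t w"
      using \<phi>range(1)[OF zero_le_dist[of u v]] \<phi>range(1)[OF zero_le_dist[of v x]] rp tri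
        \<phi>lip[OF _ _ _ tri(1)] \<phi>lip[OF _ _ _ tri(2)]
      by (cases a; cases b; cases c) (auto simp: stw D min_def add.commute intro: add_increasing2)
  qed
  obtain c :: "nat \<Rightarrow> 'u" where c: "\<And>x e. 0 < e \<Longrightarrow> \<exists>k. dist (c k) x < e"
    using dense_sequence by blast
  obtain i :: "'u \<times> bool \<Rightarrow> 'u" where i: "\<And>s t. s \<in> UNIV \<Longrightarrow> t \<in> UNIV \<Longrightarrow> dist (i s) (i t) = D s t"
  proof (rule urysohn_embedding[OF met, of "range c \<times> UNIV"])
    fix s :: "'u \<times> bool" and e :: real assume "0 < e"
    then obtain k where "dist (c k) (fst s) < e" using c by blast
    then show "\<exists>t\<in>range c \<times> UNIV. D s t < e"
      by (intro bexI[of _ "(c k, snd s)"]) (auto simp: D_def dist_commute)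
  qed (use that in auto)
  have inj: "inj i"
    by (rule injI) (metis Metric_space.mdist_zero Metric_space.zero UNIV_I dist_self i met)
  have slice: "dist (i (u, s)) (i (v, s)) = min (dist u v) r" for u v s by (simp add: i D)
  have closed: "closed (i ` (U \<times> UNIV))" if U: "closed U" for U
  proof -
    have "closed ((\<lambda>u. i (u, s)) ` U)" for s
    proof (rule closed_uniform_embedding_image[OF U])
      show "continuous_on U (\<lambda>u. i (u, s))" by (auto simp: continuous_on_iff slice min_less_iff_disj)
      show "\<exists>d>0. \<forall>x\<in>U. \<forall>y\<in>U. dist (i (x, s)) (i (y, s)) < d \<longrightarrow> dist x y < e" if "0 < e" for e
        using that rp by (intro exI[of _ "min e r"]) (auto simp: slice)
    qed
    moreover have "i ` (U \<times> UNIV) = (\<lambda>u. i (u, True)) ` U \<union> (\<lambda>u. i (u, False)) ` U"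
      by (auto simp: UNIV_bool)
    ultimately show ?thesis by auto
  qed
  have "isometry_reducible (V_sub A :: 'u set set) (V_sub (A - {a}) :: 'u set set)"
  proof (rule isometry_reducibleI[where \<Phi> = "\<lambda>U. i ` (U \<times> UNIV)"])
    have eq: "i ` (U \<times> UNIV) = (\<Union>s\<in>UNIV. (\<lambda>u. i (u, s)) ` U) \<union> {}" for U by auto
    show "(\<lambda>U. i ` (U \<times> UNIV)) \<in> restrict_space effros (V_sub A) \<rightarrow>\<^sub>M effros"
      unfolding eq
    proof (rule measurable_union_images)
      show "closed ((\<Union>s\<in>UNIV. (\<lambda>u. i (u, s)) ` U) \<union> {})" if "U \<in> V_sub A" for U
        unfolding eq[symmetric] using that by (intro closed) (auto simp: V_sub_iff)
      show "continuous_on UNIV (\<lambda>u. i (u, s))" for s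
        by (auto simp: continuous_on_iff slice min_less_iff_disj)
    qed (use V_sub_subset_space in auto)
    fix U :: "'u set" assume U: "U \<in> V_sub A"
    then show "i ` (U \<times> UNIV) \<in> V_sub (A - {a})"
      using closed[of U] minA \<phi>A by (auto simp: V_sub_iff i D)
    fix V :: "'u set" assume V: "V \<in> V_sub A"
    show "isometric_sets U V \<longleftrightarrow> isometric_sets (i ` (U \<times> UNIV)) (i ` (V \<times> UNIV))"
    proof
      assume "isometric_sets U V"
      then obtain h where h: "h ` U = V" "\<And>x y. x \<in> U \<Longrightarrow> y \<in> U \<Longrightarrow> dist (h x) (h y) = dist x y"
        by (rule isometric_setsE) (rule that, assumption, blast)
      define f where "f = i \<circ> map_prod h id \<circ> inv i"
      have f: "f (i (x, y)) = i (h x, y)" for x y by (simp add: f_def inv_f_f[OF inj])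
      have "i ` (V \<times> UNIV) = f ` i ` (U \<times> UNIV)"
        unfolding h(1)[symmetric] by (force simp: f image_iff)
      moreover have "isometric_sets (i ` (U \<times> UNIV)) (f ` i ` (U \<times> UNIV))"
        by (rule isometric_sets_image) (use h(2) in \<open>auto simp: f i D\<close>)
      ultimately show "isometric_sets (i ` (U \<times> UNIV)) (i ` (V \<times> UNIV))" by simp
    next
      assume "isometric_sets (i ` (U \<times> UNIV)) (i ` (V \<times> UNIV))"
      then obtain h where h: "h ` i ` (U \<times> UNIV) = i ` (V \<times> UNIV)"
        "\<And>x y. x \<in> i ` (U \<times> UNIV) \<Longrightarrow> y \<in> i ` (U \<times> UNIV) \<Longrightarrow> dist (h x) (h y) = dist x y"
        by (rule isometric_setsE) (rule that, assumption, blast)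
      define k where "k u s = fst (inv i (h (i (u, s))))" for u s
      define t where "t u s = snd (inv i (h (i (u, s))))" for u s
      have kt: "h (i (u, s)) = i (k u s, t u s)" "k u s \<in> V" if "u \<in> U" for u s
      proof -
        have "h (i (u, s)) \<in> i ` (V \<times> UNIV)" using h(1) that by blast
        then obtain v w where "v \<in> V" "h (i (u, s)) = i (v, w)" by auto
        then show "h (i (u, s)) = i (k u s, t u s)" "k u s \<in> V"
          by (auto simp: k_def t_def inv_f_f[OF inj])
      qed
      have hD: "D (k u s, t u s) (k v w, t v w) = D (u, s) (v, w)" if "u \<in> U" "v \<in> U" for u v s w
        using h(2)[of "i (u, s)" "i (v, w)"] that kt(1) by (simp add: i)
      \<comment> \<open>Distances at most \<open>r\<close> occur only within a copy, so the isometry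
        sends each copy into one copy and the two into different ones.\<close>
      have t: "t u s = t v w \<longleftrightarrow> s = w" if "u \<in> U" "v \<in> U" for u v s w
        using D_le[of "k u s" "t u s" "k v w" "t v w"] D_le[of u s v w] hD[OF that, of s w] by simp
      have \<phi>eq: "dist (k u True) (k v False) = dist u v" if "u \<in> U" "v \<in> U" for u v
        using hD[OF that, of True False] t[OF that, of True False] by (auto simp: D intro: \<phi>inj)
      \<comment> \<open>\<open>\<phi> 0\<close> is the distance between the two copies of one point,
        so the two copies of \<open>u\<close> go to the two copies of one point.\<close>
      have k: "k u False = k u True" if "u \<in> U" for u
        using \<phi>eq[OF that that] by simp
      have "(\<lambda>u. k u True) ` U = V"
      proof (intro equalityI subsetI)
        fix v assume "v \<in> V"
        then have "i (v, True) \<in> h ` i ` (U \<times> UNIV)" unfolding h(1) by blast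
        then obtain u s where u: "u \<in> U" "i (v, True) = h (i (u, s))" by auto
        then have "v = k u s" using kt(1) by (auto dest: injD[OF inj])
        then have "v = k u True" using k[OF u(1)] by (cases s) auto
        with u show "v \<in> (\<lambda>u. k u True) ` U" by blast
      qed (use kt(2) in auto)
      moreover have "dist (k u True) (k v True) = dist u v" if "u \<in> U" "v \<in> U" for u v
        using \<phi>eq[OF that] k[OF that(2)] by simp
      ultimately show "isometric_sets U V" unfolding isometric_sets_def by blast
    qed
  qed (rule V_sub_subset_space)
  with inA rp show ?thesis by (intro that)
qed

text \<open>The relation generated by \<open>dist x y < m\<close> on \<open>K\<close> has at most
  one class. Quantifying over invariant predicates instead of naming the chains turns the definition
  directly into an induction rule.\<close>

definition step_connected :: "real \<Rightarrow> 'a::metric_space set \<Rightarrow> bool" where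
  "step_connected m K \<longleftrightarrow> (\<forall>P. (\<exists>x\<in>K. P x) \<longrightarrow> (\<forall>x\<in>K. \<forall>y\<in>K. P x \<longrightarrow> dist x y < m \<longrightarrow> P y) \<longrightarrow> (\<forall>x\<in>K. P x))"

lemma step_connectedD:
  assumes "step_connected m K" "x \<in> K" "P x" "y \<in> K"
    and "\<And>x y. x \<in> K \<Longrightarrow> y \<in> K \<Longrightarrow> P x \<Longrightarrow> dist x y < m \<Longrightarrow> P y"
  shows "P y"
proof -
  have "(\<exists>x\<in>K. P x) \<longrightarrow> (\<forall>x\<in>K. \<forall>y\<in>K. P x \<longrightarrow> dist x y < m \<longrightarrow> P y) \<longrightarrow> (\<forall>x\<in>K. P x)"
    using assms(1) unfolding step_connected_def by (rule spec)
  then show ?thesis using assms(2-5) by blast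
qed

text \<open>The isometry \<open>h\<close> either preserves \<open>J\<close> or moves it off itself; in the latter case its
  first-return map to the complement of \<open>J\<close> is the isometry wanted.\<close>
lemma cancel_step_connected:
  assumes h: "h ` (P \<union> J) = Q \<union> J" "\<And>x y. x \<in> P \<union> J \<Longrightarrow> y \<in> P \<union> J \<Longrightarrow> dist (h x) (h y) = dist x y"
    and P: "\<And>x y. x \<in> P \<Longrightarrow> y \<in> J \<Longrightarrow> dist x y = m" and Q: "\<And>x y. x \<in> Q \<Longrightarrow> y \<in> J \<Longrightarrow> dist x y = m"
    and m: "0 < m" and J: "step_connected m J"
  shows "isometric_sets P Q"
proof -
  have disj: "x \<notin> J" if "x \<in> P \<or> x \<in> Q" for x using that P[of x x] Q[of x x] m by auto
  have hin: "h x \<in> Q \<or> h x \<in> J" if "x \<in> P \<or> x \<in> J" for x using h(1) that by blast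
  have hinj: "x = y" if "x \<in> P \<union> J" "y \<in> P \<union> J" "h x = h y" for x y
    using h(2)[OF that(1,2)] that(3) by simp
  have pre: "\<exists>w. (w \<in> P \<or> w \<in> J) \<and> h w = y" if "y \<in> Q \<or> y \<in> J" for y
  proof -
    have "y \<in> h ` (P \<union> J)" unfolding h(1) using that by blast
    then show ?thesis by auto
  qed
  show ?thesis
  proof (cases "\<exists>z\<in>J. h z \<in> J")
    case True
    then obtain z where z: "z \<in> J" "h z \<in> J" by blast
    \<comment> \<open>If \<open>h x\<close> lies in \<open>J\<close> and \<open>h y\<close> in
      \<open>Q\<close>, then \<open>x\<close> and \<open>y\<close> are \<open>m\<close> apart; so
      along steps shorter than \<open>m\<close> the images stay in \<open>J\<close>.\<close>
    have into: "h y \<in> J" if "y \<in> J" for y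
    proof (rule step_connectedD[OF J, where P = "\<lambda>y. h y \<in> J", OF z that])
      fix x y assume xy: "x \<in> J" "y \<in> J" "h x \<in> J" "dist x y < m"
      then show "h y \<in> J" using hin[of y] Q[of "h y" "h x"] h(2)[of y x] by (auto simp: dist_commute)
    qed
    have onto: "\<exists>w\<in>J. h w = y" if "y \<in> J" for y
    proof (rule step_connectedD[OF J, where P = "\<lambda>y. \<exists>w\<in>J. h w = y", OF z(2) _ that])
      show "\<exists>w\<in>J. h w = h z" using z by blast
      fix x y assume xy: "x \<in> J" "y \<in> J" "\<exists>w\<in>J. h w = x" "dist x y < m"
      then obtain w v where w: "w \<in> J" "h w = x" and v: "v \<in> P \<or> v \<in> J" "h v = y" using pre by blast
      then show "\<exists>w\<in>J. h w = y" using P[of v w] h(2)[of v w] xy(4) by (auto simp: dist_commute)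
    qed
    have "h ` P = Q"
    proof (intro equalityI subsetI)
      fix y assume "y \<in> h ` P"
      then obtain x where x: "x \<in> P" "y = h x" by blast
      have "h x \<notin> J"
      proof
        assume "h x \<in> J"
        then obtain w where "w \<in> J" "h w = h x" using onto by blast
        then show False using hinj[of w x] x disj by auto
      qed
      with hin x show "y \<in> Q" by blast
    next
      fix y assume y: "y \<in> Q"
      then obtain w where "w \<in> P \<or> w \<in> J" "h w = y" using pre by blast
      with into disj y show "y \<in> h ` P" by blast
    qed
    moreover have "isometric_sets P (h ` P)" by (rule isometric_sets_image) (use h(2) in auto)
    ultimately show ?thesis by simp
  next
    case False
    then have hJ: "h z \<in> Q" if "z \<in> J" for z using hin that by blast
    have preJ: "\<exists>w\<in>P. h w = y" if "y \<in> J" for y using pre[of y] that False by blast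
    \<comment> \<open>Two applications suffice, since here \<open>h\<close> maps all of
      \<open>J\<close> into \<open>Q\<close>.\<close>
    define g where "g u = (if h u \<in> Q then h u else h (h u))" for u
    have "g ` P = Q"
    proof (intro equalityI subsetI)
      fix y assume "y \<in> g ` P"
      then show "y \<in> Q" using hJ hin by (auto simp: g_def)
    next
      fix y assume y: "y \<in> Q"
      then obtain w where w: "w \<in> P \<or> w \<in> J" "h w = y" using pre by blast
      show "y \<in> g ` P"
      proof (cases "w \<in> P")
        case True
        with w y show ?thesis by (auto simp: g_def intro!: image_eqI[of _ _ w])
      next
        case False
        with w obtain v where "v \<in> P" "h v = w" "w \<in> J" using preJ by blast
        with w disj show ?thesis by (auto simp: g_def intro!: image_eqI[of _ _ v])
      qed
    qed
    moreover have "dist (g x) (g y) = dist x y" if xy: "x \<in> P" "y \<in> P" for x y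
    proof -
      \<comment> \<open>Both distances are \<open>m\<close>: the left one because \<open>u\<close>
        lies in \<open>P\<close> and \<open>h v\<close> in \<open>J\<close>, the right one because
        \<open>h u\<close> lies in \<open>Q\<close> and \<open>h v\<close> in
        \<open>J\<close>.\<close>
      have two: "dist (h u) (h (h v)) = dist u v" if "u \<in> P" "v \<in> P" "h u \<in> Q" "h v \<in> J" for u v
        using h(2)[of u "h v"] h(2)[of u v] P[of u "h v"] Q[of "h u" "h v"] that by simp
      show ?thesis
      proof -
        have yx: "dist (g x) (g y) = dist (g y) (g x)" "dist x y = dist y x" by (rule dist_commute)+
        consider "h x \<in> Q" "h y \<in> Q" | "h x \<in> Q" "h y \<in> J" | "h x \<in> J" "h y \<in> Q" | "h x \<in> J" "h y \<in> J"
          using hin[of x] hin[of y] xy by blast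
        then show ?thesis
        proof cases
          case 1
          then show ?thesis using h(2)[of x y] xy by (simp add: g_def)
        next
          case 2
          then show ?thesis using two[of x y] xy disj[of "h y"] by (auto simp: g_def)
        next
          case 3
          then show ?thesis unfolding yx using two[of y x] xy disj[of "h x"] by (auto simp: g_def)
        next
          case 4
          then show ?thesis using h(2)[of x y] h(2)[of "h x" "h y"] xy disj[of "h x"] disj[of "h y"]
            by (auto simp: g_def)
        qed
      qed
    qed
    ultimately show ?thesis unfolding isometric_sets_def by blast
  qed
qed

text \<open>If nothing of \<open>A\<close> lies strictly between 0 and \<open>m\<close>, a point will do; otherwise glue the classes
  of the relation generated by \<open>dist x y < m\<close> along base points that are \<open>r < m\<close> apart.\<close>
lemma step_connected_realization:
  assumes "V_star A \<noteq> ({} :: 'u::urysohn_space set set)" and A: "A \<subseteq> {0..}"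
    and m: "0 < m" "\<And>a. a \<in> A \<Longrightarrow> a \<le> m"
  obtains K :: "'u::urysohn_space set" where "K \<in> V_sub A" "step_connected m K"
    "\<And>c. c \<in> A \<Longrightarrow> c \<noteq> m \<Longrightarrow> \<exists>x\<in>K. \<exists>y\<in>K. dist x y = c"
proof -
  obtain Z :: "'u set" where Z: "Z \<in> V_star A" using assms(1) by blast
  then have "closed Z" and Zd: "\<And>x y. x \<in> Z \<Longrightarrow> y \<in> Z \<Longrightarrow> dist x y \<in> A"
    and Zs: "\<And>c. c \<in> A \<Longrightarrow> \<exists>x\<in>Z. \<exists>y\<in>Z. dist x y = c" by (auto simp: V_star_iff V_sub_iff)
  obtain z0 where z0: "z0 \<in> Z" using Z by (auto simp: V_star_iff V_sub_iff)
  have zero: "0 \<in> A" using Zd[OF z0 z0] by simp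
  have maxA: "max s t \<in> A" if "s \<in> A" "t \<in> A" for s t using that by (simp add: max_def)
  show ?thesis
  proof (cases "\<exists>r\<in>A. 0 < r \<and> r < m")
    case False
    show ?thesis
    proof (rule that[of "{z0}"])
      show "{z0} \<in> V_sub A" using zero by (auto simp: V_sub_iff)
      show "step_connected m {z0}" by (auto simp: step_connected_def)
      show "\<exists>x\<in>{z0}. \<exists>y\<in>{z0}. dist x y = c" if "c \<in> A" "c \<noteq> m" for c
      proof -
        have "\<not> 0 < c" "0 \<le> c" using that False m(2)[of c] A by fastforce+
        then show ?thesis by simp
      qed
    qed
  next
    case True
    then obtain r where r: "r \<in> A" "0 < r" "r < m" by blast
    have Zspace: "Z \<in> space effros" using Z V_star_subset_V_sub V_sub_subset_space by blast
    obtain q :: "nat \<Rightarrow> 'u" where q: "\<And>n. q n \<in> Z" "\<And>x e. x \<in> Z \<Longrightarrow> 0 < e \<Longrightarrow> \<exists>n. dist (q n) x < e"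
    proof -
      obtain \<sigma> :: "nat \<Rightarrow> 'u set \<Rightarrow> 'u" where "\<And>n. \<sigma> n \<in> borel_measurable effros"
        "\<And>n U. U \<in> space effros \<Longrightarrow> \<sigma> n U \<in> U"
        "\<And>U x e. U \<in> space effros \<Longrightarrow> x \<in> U \<Longrightarrow> 0 < e \<Longrightarrow> \<exists>n. dist (\<sigma> n U) x < e"
        by (rule effros_dense_selectors[where 'a = 'u], rule that)
      with Zspace show ?thesis by (intro that[of "\<lambda>n. \<sigma> n Z"])
    qed
    define R where "R x y \<longleftrightarrow> x \<in> Z \<and> y \<in> Z \<and> dist x y < m" for x y
    define C where "C n = {z. R\<^sup>*\<^sup>* (q n) z}" for n :: nat
    have CZ: "C n \<subseteq> Z" for n
    proof
      fix z assume "z \<in> C n"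
      then have "R\<^sup>*\<^sup>* (q n) z" by (simp add: C_def)
      then show "z \<in> Z" by (induction rule: rtranclp_induct) (auto simp: R_def q)
    qed
    have qC: "q n \<in> C n" for n by (simp add: C_def)
    have C_step: "w \<in> C n" if "z \<in> C n" "w \<in> Z" "dist z w < m" for z w n
      using that CZ[of n] rtranclp.rtrancl_into_rtrancl[of R "q n" z w] by (auto simp: C_def R_def)
    have closedC: "closed (C n)" for n
      unfolding closed_sequential_limits
    proof (intro allI impI, elim conjE)
      fix z l assume z: "\<forall>j. z j \<in> C n" and l: "z \<longlonglongrightarrow> l"
      then have "l \<in> Z" using closed_sequentially[OF \<open>closed Z\<close>] CZ by blast
      moreover obtain j where "dist (z j) l < m" using metric_LIMSEQ_D[OF l m(1)] by blast
      ultimately show "l \<in> C n" using C_step z by blast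
    qed
    define X where "X = {(n, z). z \<in> C n}"
    \<comment> \<open>Between copies the distance is the maximum of the distances to the base points
      and \<open>r\<close>. A maximum stays in \<open>A\<close>, and two base points are
      \<open>r < m\<close> apart, which makes the glued space step-connected. A class named by
      several indices just occurs several times.\<close>
    define D where "D s t = (if fst s = fst t then dist (snd s) (snd t) else
      max (max (dist (snd s) (q (fst s))) (dist (snd t) (q (fst t)))) r)" for s t :: "nat \<times> 'u"
    have D: "D (n, z) (k, w) = (if n = k then dist z w else max (max (dist z (q n)) (dist w (q k))) r)"
      for n z k w by (simp add: D_def)
    have met: "Metric_space X D"
    proof
      fix s t u :: "nat \<times> 'u"
      obtain n z k w l v where stu: "s = (n, z)" "t = (k, w)" "u = (l, v)" by (metis surj_pair)
      show "0 \<le> D s t" "D s t = D t s" using r(2)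
        by (auto simp: stu D dist_commute max.commute)
      show "D s t = 0 \<longleftrightarrow> s = t" using r(2) by (auto simp: stu D)
      have "dist z v \<le> dist z w + dist w v" "dist z (q n) \<le> dist z w + dist w (q n)"
        "dist v (q l) \<le> dist w v + dist w (q l)" "dist z v \<le> dist z (q n) + dist v (q n)"
        "0 \<le> dist z w" "0 \<le> dist w v" "0 \<le> dist z (q n)" "0 \<le> dist v (q l)" "0 \<le> dist w (q k)"
        by (auto intro: dist_triangle dist_triangle2 dist_triangle3)
      then show "D s u \<le> D s t + D t u" using r(2)
        by (cases "n = k"; cases "k = l"; cases "n = l")
          (auto simp: stu D intro: add_increasing add_increasing2)
    qed
    obtain i :: "nat \<times> 'u \<Rightarrow> 'u" where i: "\<And>s t. s \<in> X \<Longrightarrow> t \<in> X \<Longrightarrow> dist (i s) (i t) = D s t"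
    proof (rule urysohn_embedding[OF met, of "X \<inter> UNIV \<times> range q"])
      show "countable (X \<inter> UNIV \<times> range q)" by (intro countable_Int2 countable_SIGMA) auto
      fix s and e :: real assume s: "s \<in> X" and e: "0 < e"
      obtain n z where nz: "s = (n, z)" "z \<in> C n" using s by (auto simp: X_def)
      then obtain k where "dist (q k) z < min e m" using q(2)[of z "min e m"] CZ e m by auto
      then show "\<exists>t\<in>X \<inter> UNIV \<times> range q. D s t < e"
        using nz C_step[OF nz(2) q(1), of k]
        by (intro bexI[of _ "(n, q k)"]) (auto simp: X_def D dist_commute)
    qed (use that in auto)
    define K where "K = i ` X"
    have iX: "dist (i (n, z)) (i (k, w)) = D (n, z) (k, w)" if "z \<in> C n" "w \<in> C k" for n z k w
      using i that by (auto simp: X_def)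
    show ?thesis
    proof
      have slice: "closed ((\<lambda>z. i (n, z)) ` C n)" for n
        by (rule closed_isometric_image[OF closedC]) (simp add: iX D)
      \<comment> \<open>Different copies are at least \<open>r\<close> apart, so a convergent
        sequence eventually stays in one copy.\<close>
      have "closed K"
        unfolding closed_sequential_limits
      proof (intro allI impI, elim conjE)
        fix y l assume "\<forall>j. y j \<in> K" and l: "y \<longlonglongrightarrow> l"
        then have "\<forall>j. \<exists>n z. z \<in> C n \<and> y j = i (n, z)" by (auto simp: K_def X_def image_iff)
        then obtain n z where nz: "\<And>j. z j \<in> C (n j)" "\<And>j. y j = i (n j, z j)" by metis
        obtain N where N: "\<forall>j\<ge>N. \<forall>k\<ge>N. dist (y j) (y k) < r"
          using metric_CauchyD[OF LIMSEQ_imp_Cauchy[OF l] r(2)] by blast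
        have "n (j + N) = n N" for j
        proof (rule ccontr)
          assume "n (j + N) \<noteq> n N"
          then have "r \<le> dist (y (j + N)) (y N)" using nz by (simp add: iX D)
          with N show False by (meson le_add2 not_less order_refl)
        qed
        then have "y (j + N) \<in> (\<lambda>z. i (n N, z)) ` C (n N)" for j using nz[of "j + N"] by auto
        moreover have "(\<lambda>j. y (j + N)) \<longlonglongrightarrow> l" using l by (rule LIMSEQ_ignore_initial_segment)
        ultimately have "l \<in> (\<lambda>z. i (n N, z)) ` C (n N)" by (rule closed_sequentially[OF slice])
        then show "l \<in> K" by (auto simp: K_def X_def)
      qed
      moreover have "dist x y \<in> A" if "x \<in> K" "y \<in> K" for x y
      proof -
        obtain n z k w where "z \<in> C n" "w \<in> C k" "x = i (n, z)" "y = i (k, w)"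
          using \<open>x \<in> K\<close> \<open>y \<in> K\<close> by (auto simp: K_def X_def)
        moreover from this have "z \<in> Z" "w \<in> Z" using CZ by auto
        ultimately show ?thesis using Zd q(1) r(1) by (auto simp: iX D intro!: maxA)
      qed
      moreover have "i (0, q 0) \<in> K" using qC by (auto simp: K_def X_def)
      ultimately show "K \<in> V_sub A" by (auto simp: V_sub_iff)
      show "\<exists>x\<in>K. \<exists>y\<in>K. dist x y = c" if c: "c \<in> A" "c \<noteq> m" for c
      proof -
        obtain x y where xy: "x \<in> Z" "y \<in> Z" "dist x y = c" using Zs[OF c(1)] by blast
        obtain n where n: "dist (q n) x < m" using q(2)[OF xy(1) m(1)] by blast
        have "x \<in> C n" using C_step[OF qC xy(1) n] .
        \<comment> \<open>Points less than \<open>m\<close> apart share a class, so the pair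
          survives in one copy; a pair at distance \<open>m\<close> might be torn apart, hence the
          exception \<open>c \<noteq> m\<close>.\<close>
        moreover from this have "y \<in> C n" using C_step[OF _ xy(2)] xy(3) c(2) m(2)[OF c(1)] by simp
        ultimately show ?thesis using xy(3)
          by (intro bexI[of _ "i (n, x)"] bexI[of _ "i (n, y)"]) (auto simp: iX D K_def X_def)
      qed
      show "step_connected m K"
        unfolding step_connected_def
      proof (intro allI impI ballI)
        fix P y assume "\<exists>x\<in>K. P x" and y: "y \<in> K"
          and spread: "\<forall>x\<in>K. \<forall>y\<in>K. P x \<longrightarrow> dist x y < m \<longrightarrow> P y"
        have iK: "i (n, z) \<in> K" if "z \<in> C n" for n z using that by (auto simp: K_def X_def)
        have up: "P (i (n, z)) \<longleftrightarrow> P (i (n, q n))" if "z \<in> C n" for n z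
        proof -
          have "R\<^sup>*\<^sup>* (q n) z" using that by (simp add: C_def)
          then show ?thesis
          proof (induction rule: rtranclp_induct)
            case (step z w)
            then have "z \<in> C n" "w \<in> Z" "dist z w < m" by (auto simp: C_def R_def)
            moreover from this have "w \<in> C n" using C_step by blast
            ultimately show ?case
              using spread[rule_format, of "i (n, z)" "i (n, w)"]
                spread[rule_format, of "i (n, w)" "i (n, z)"] step.IH iK
              by (auto simp: iX D dist_commute)
          qed simp
        qed
        have base: "P (i (k, q k))" if "P (i (n, q n))" for n k
        proof (cases "n = k")
          case False
          then have "dist (i (n, q n)) (i (k, q k)) < m" using r qC by (simp add: iX D)
          then show ?thesis using spread iK qC that by blast
        qed (use that in simp)
        obtain x where "x \<in> K" "P x" using \<open>\<exists>x\<in>K. P x\<close> by blast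
        then obtain n z where "z \<in> C n" "P (i (n, z))" by (auto simp: K_def X_def)
        moreover obtain k w where "w \<in> C k" "y = i (k, w)" using y by (auto simp: K_def X_def)
        ultimately show "P y" using up base by blast
      qed
    qed
  qed
qed

text \<open>Truncating at \<open>m\<close> changes no distance in \<open>U\<close> or
  \<open>K\<close>, as \<open>m\<close> is the maximum of \<open>A\<close>. It serves to put one
  metric on two full copies of the Urysohn space at mutual distance \<open>m\<close>, so that the
  embedding does not depend on \<open>U\<close>. \<open>K\<close> supplies the values other than
  \<open>m\<close>, the distances across supply \<open>m\<close>, and
  \<open>cancel_step_connected\<close> recovers \<open>U\<close>.\<close>

lemma max_reducible:
  assumes ne: "V_star A \<noteq> ({} :: 'u::urysohn_space set set)" and A: "A \<subseteq> {0..}"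
    and m: "m \<in> A" "\<And>a. a \<in> A \<Longrightarrow> a \<le> m"
  shows "isometry_reducible (V_sub A :: 'u set set) (V_star A :: 'u set set)"
proof (cases "m = 0")
  case True
  then have "A \<subseteq> {0}" using A m(2) by fastforce
  then have "(V_sub A :: 'u set set) \<subseteq> V_star A"
    by (auto simp: V_star_iff V_sub_iff) (metis dist_self ex_in_conv singletonD subsetD)
  then show ?thesis using V_sub_subset_space by (rule isometry_reducible_mono)
next
  case False
  then have m0: "0 < m" using A m(1) by fastforce
  obtain K :: "'u set" where K: "K \<in> V_sub A" "step_connected m K"
    "\<And>c. c \<in> A \<Longrightarrow> c \<noteq> m \<Longrightarrow> \<exists>x\<in>K. \<exists>y\<in>K. dist x y = c"
    using step_connected_realization[OF ne A m0 m(2)] by blast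
  have trunc: "min (dist x y) m = dist x y" if "U \<in> V_sub A" "x \<in> U" "y \<in> U" for U and x y :: 'u
    using that m(2) by (auto simp: V_sub_iff intro!: min_absorb1)
  define D where "D s t = (case (s, t) of (Inl x, Inl y) \<Rightarrow> min (dist x y) m
    | (Inr x, Inr y) \<Rightarrow> min (dist x y) m | _ \<Rightarrow> m)" for s t :: "'u + 'u"
  have D: "D (Inl x) (Inl y) = min (dist x y) m" "D (Inr x) (Inr y) = min (dist x y) m"
    "D (Inl x) (Inr y) = m" "D (Inr x) (Inl y) = m" for x y by (auto simp: D_def)
  have met: "Metric_space UNIV D"
  proof
    fix s t u
    show "0 \<le> D s t" "D s t = D t s" "D s t = 0 \<longleftrightarrow> s = t" using m0
      by (cases s; cases t; auto simp: D dist_commute min_def)+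
    have "dist x z \<le> dist x y + dist y z" "dist x z \<le> m \<Longrightarrow> dist x z \<le> m + dist y z"
      "m \<le> dist x z \<Longrightarrow> m \<le> dist x y + dist y z" for x y z :: 'u
      using dist_triangle[of x z y] zero_le_dist[of y z] by linarith+
    then show "D s u \<le> D s t + D t u" using m0
      by (cases s; cases t; cases u) (auto simp: D min_def intro: order_trans)
  qed
  obtain c :: "nat \<Rightarrow> 'u" where c: "\<And>x e. 0 < e \<Longrightarrow> \<exists>k. dist (c k) x < e"
    using dense_sequence by blast
  obtain i :: "'u + 'u \<Rightarrow> 'u" where i: "\<And>s t. s \<in> UNIV \<Longrightarrow> t \<in> UNIV \<Longrightarrow> dist (i s) (i t) = D s t"
  proof (rule urysohn_embedding[OF met, of "range c <+> range c"])
    fix s and e :: real assume e: "0 < e"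
    show "\<exists>t\<in>range c <+> range c. D s t < e"
    proof (cases s)
      case (Inl x)
      obtain k where "dist (c k) x < e" using c[OF e] by blast
      with Inl show ?thesis by (intro bexI[of _ "Inl (c k)"]) (auto simp: D dist_commute)
    next
      case (Inr x)
      obtain k where "dist (c k) x < e" using c[OF e] by blast
      with Inr show ?thesis by (intro bexI[of _ "Inr (c k)"]) (auto simp: D dist_commute)
    qed
  qed (use that in auto)
  have i': "dist (i s) (i t) = D s t" for s t by (simp add: i)
  have inj: "inj i"
    by (rule injI) (metis Metric_space.mdist_zero Metric_space.zero UNIV_I dist_self i met)
  define J where "J = i ` Inr ` K"
  define \<Phi> where "\<Phi> U = i ` Inl ` U \<union> J" for U
  have isoL: "dist (i (Inl x)) (i (Inl y)) = dist x y" if "U \<in> V_sub A" "x \<in> U" "y \<in> U" for U x y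
    using trunc[OF that] by (simp add: i' D)
  have isoR: "dist (i (Inr x)) (i (Inr y)) = dist x y" if "x \<in> K" "y \<in> K" for x y
    using trunc[OF K(1) that] by (simp add: i' D)
  have cross: "dist x y = m" if "x \<in> i ` Inl ` U" "y \<in> J" for x y U
    using that by (auto simp: J_def i' D)
  have closedL: "closed (i ` Inl ` U)" if "U \<in> V_sub A" for U
    using closed_isometric_image[of U "\<lambda>x. i (Inl x)"] that isoL[OF that]
    by (simp add: V_sub_iff image_image)
  have closedJ: "closed J"
    using closed_isometric_image[of K "\<lambda>x. i (Inr x)"] K(1) isoR
    by (simp add: V_sub_iff image_image J_def)
  have J: "step_connected m J"
    unfolding step_connected_def
  proof (intro allI impI ballI)
    fix P y assume ex: "\<exists>x\<in>J. P x" and step: "\<forall>x\<in>J. \<forall>y\<in>J. P x \<longrightarrow> dist x y < m \<longrightarrow> P y" and "y \<in> J"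
    obtain x where x: "x \<in> K" "P (i (Inr x))" using ex by (auto simp: J_def)
    obtain z where z: "z \<in> K" "y = i (Inr z)" using \<open>y \<in> J\<close> by (auto simp: J_def)
    show "P y" unfolding z(2)
    proof (rule step_connectedD[OF K(2), where P = "\<lambda>z. P (i (Inr z))", OF x z(1)])
      fix x y assume xy: "x \<in> K" "y \<in> K" "P (i (Inr x))" "dist x y < m"
      from xy(1,2) have "i (Inr x) \<in> J" "i (Inr y) \<in> J" by (simp_all add: J_def)
      then show "P (i (Inr y))" using step[rule_format, OF _ _ xy(3)] isoR[OF xy(1,2)] xy(4) by simp
    qed
  qed
  show ?thesis
  proof (rule isometry_reducibleI[where \<Phi> = \<Phi>])
    have eq: "\<Phi> U = (\<Union>s\<in>{()}. (\<lambda>u. i (Inl u)) ` U) \<union> J" for U by (auto simp: \<Phi>_def)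
    have closed\<Phi>: "closed (\<Phi> U)" if "U \<in> V_sub A" for U
      unfolding \<Phi>_def using closedL[OF that] closedJ by auto
    show "\<Phi> \<in> restrict_space effros (V_sub A) \<rightarrow>\<^sub>M effros"
      unfolding eq[abs_def]
    proof (rule measurable_union_images)
      show "continuous_on UNIV (\<lambda>u. i (Inl u))"
        by (auto simp: continuous_on_iff i' D min_less_iff_disj)
      show "closed ((\<Union>s\<in>{()}. (\<lambda>u. i (Inl u)) ` U) \<union> J)" if "U \<in> V_sub A" for U
        unfolding eq[symmetric] using closed\<Phi>[OF that] .
    qed (use V_sub_subset_space in auto)
    fix U :: "'u set" assume U: "U \<in> V_sub A"
    have "dist x y \<in> A" if "x \<in> \<Phi> U" "y \<in> \<Phi> U" for x y
      using that U K(1) m(1) isoL[OF U] isoR by (auto simp: \<Phi>_def J_def i' D V_sub_iff)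
    moreover have "\<exists>x\<in>\<Phi> U. \<exists>y\<in>\<Phi> U. dist x y = c" if c: "c \<in> A" for c
    proof (cases "c = m")
      case True
      obtain x z where "x \<in> U" "z \<in> K" using U K(1) by (auto simp: V_sub_iff)
      then show ?thesis using True
        by (intro bexI[of _ "i (Inl x)"] bexI[of _ "i (Inr z)"]) (auto simp: \<Phi>_def J_def i' D)
    next
      case False
      then obtain x y where "x \<in> K" "y \<in> K" "dist x y = c" using K(3) c by blast
      then show ?thesis using isoR
        by (intro bexI[of _ "i (Inr x)"] bexI[of _ "i (Inr y)"]) (auto simp: \<Phi>_def J_def)
    qed
    ultimately show "\<Phi> U \<in> V_star A"
      using closed\<Phi>[OF U] U by (auto simp: V_star_iff V_sub_iff \<Phi>_def)
    fix V :: "'u set" assume V: "V \<in> V_sub A"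
    show "isometric_sets U V \<longleftrightarrow> isometric_sets (\<Phi> U) (\<Phi> V)"
    proof
      assume "isometric_sets U V"
      then obtain h where h: "h ` U = V" "\<And>x y. x \<in> U \<Longrightarrow> y \<in> U \<Longrightarrow> dist (h x) (h y) = dist x y"
        by (rule isometric_setsE) (rule that, assumption, blast)
      define f where "f = i \<circ> map_sum h id \<circ> inv i"
      have f: "f (i (Inl x)) = i (Inl (h x))" "f (i (Inr x)) = i (Inr x)" for x
        by (simp_all add: f_def inv_f_f[OF inj])
      have "\<Phi> V = f ` \<Phi> U"
        unfolding \<Phi>_def J_def h(1)[symmetric] by (simp add: image_Un image_image f)
      moreover have "isometric_sets (\<Phi> U) (f ` \<Phi> U)"
        by (rule isometric_sets_image) (use h(2) in \<open>auto simp: f i' D \<Phi>_def J_def\<close>)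
      ultimately show "isometric_sets (\<Phi> U) (\<Phi> V)" by simp
    next
      assume "isometric_sets (\<Phi> U) (\<Phi> V)"
      then obtain h where h: "h ` \<Phi> U = \<Phi> V" "\<And>x y. x \<in> \<Phi> U \<Longrightarrow> y \<in> \<Phi> U \<Longrightarrow> dist (h x) (h y) = dist x y"
        by (rule isometric_setsE) (rule that, assumption, blast)
      have "isometric_sets (i ` Inl ` U) (i ` Inl ` V)"
        by (rule cancel_step_connected[OF h[unfolded \<Phi>_def] cross cross m0 J])
      moreover have "isometric_sets U (i ` Inl ` U)" "isometric_sets V (i ` Inl ` V)"
        using isometric_sets_image[of U "\<lambda>x. i (Inl x)"] isometric_sets_image[of V "\<lambda>x. i (Inl x)"]
          isoL[OF U] isoL[OF V] by (simp_all add: image_image)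
      ultimately show "isometric_sets U V"
        using isometric_sets_trans isometric_sets_sym by blast
    qed
  qed (rule V_sub_subset_space)
qed

section \<open>Metric preserving functions\<close>

lemma closure_range_transfer:
  fixes c :: "nat \<Rightarrow> 'p::metric_space" and d :: "nat \<Rightarrow> 'q::complete_space"
  assumes x: "x \<in> closure (range c)" and cd: "\<And>n m. dist (c n) (c m) = dist (d n) (d m)"
  shows "\<exists>y\<in>closure (range d). \<exists>s :: nat \<Rightarrow> nat. (\<lambda>j. c (s j)) \<longlonglongrightarrow> x \<and> (\<lambda>j. d (s j)) \<longlonglongrightarrow> y"
proof -
  obtain f where f: "\<And>j. f j \<in> range c" "f \<longlonglongrightarrow> x"
    using x unfolding closure_sequential by blast
  then have "\<forall>j. \<exists>n. f j = c n" by blast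
  then obtain s where s: "\<And>j. f j = c (s j)" by metis
  have "Cauchy (\<lambda>j. d (s j))"
    using LIMSEQ_imp_Cauchy[OF f(2)] unfolding Cauchy_def s cd .
  then obtain y where y: "(\<lambda>j. d (s j)) \<longlonglongrightarrow> y" using Cauchy_convergent convergent_def by blast
  then have "y \<in> closure (range d)"
    unfolding closure_sequential by (intro exI[of _ "\<lambda>j. d (s j)"]) auto
  moreover have "f = (\<lambda>j. c (s j))" using s by (rule ext)
  ultimately show ?thesis using y f(2) by blast
qed

text \<open>Limits are matched along a common sequence of indices: equal distances make one sequence
  of points Cauchy when the other is, and limits so matched inherit the distances.\<close>

lemma isometric_closure_range:
  fixes a :: "nat \<Rightarrow> 'a::complete_space" and b :: "nat \<Rightarrow> 'b::complete_space"
  assumes ab: "\<And>n m. dist (a n) (a m) = dist (b n) (b m)"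
  shows "isometric_sets (closure (range a)) (closure (range b))"
proof -
  define T where "T x y \<longleftrightarrow> (\<exists>s :: nat \<Rightarrow> nat. (\<lambda>j. a (s j)) \<longlonglongrightarrow> x \<and> (\<lambda>j. b (s j)) \<longlonglongrightarrow> y)" for x y
  have T_dist: "dist x x' = dist y y'" if T: "T x y" "T x' y'" for x y x' y'
  proof -
    obtain s s' where "(\<lambda>j. a (s j)) \<longlonglongrightarrow> x" "(\<lambda>j. b (s j)) \<longlonglongrightarrow> y"
      "(\<lambda>j. a (s' j)) \<longlonglongrightarrow> x'" "(\<lambda>j. b (s' j)) \<longlonglongrightarrow> y'"
      using T unfolding T_def by blast
    then have "(\<lambda>j. dist (a (s j)) (a (s' j))) \<longlonglongrightarrow> dist x x'"
      "(\<lambda>j. dist (a (s j)) (a (s' j))) \<longlonglongrightarrow> dist y y'"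
      unfolding ab by (auto intro: tendsto_dist) (simp add: ab[symmetric] tendsto_dist)
    then show ?thesis by (rule LIMSEQ_unique)
  qed
  have "\<forall>x\<in>closure (range a). \<exists>y\<in>closure (range b). T x y"
    using closure_range_transfer[of _ a b] ab by (simp add: T_def)
  then obtain h where h: "\<And>x. x \<in> closure (range a) \<Longrightarrow> h x \<in> closure (range b) \<and> T x (h x)" by metis
  have "h ` closure (range a) = closure (range b)"
  proof (intro equalityI subsetI)
    fix y assume "y \<in> closure (range b)"
    then obtain x where x: "x \<in> closure (range a)" "T x y"
      using closure_range_transfer[of y b a] ab unfolding T_def by metis
    then have "dist (h x) y = dist x x" using T_dist[of x "h x" x y] h by simp
    with x show "y \<in> h ` closure (range a)" by auto
  qed (use h in auto)
  moreover have "dist (h x) (h y) = dist x y" if "x \<in> closure (range a)" "y \<in> closure (range a)" for x y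
    using T_dist[of x "h x" y "h y"] h that by simp
  ultimately show ?thesis unfolding isometric_sets_def by blast
qed

lemma isometric_sets_distances_subset:
  assumes "isometric_sets U V"
  shows "distances U \<subseteq> distances V"
proof
  obtain f where f: "f ` U = V" "\<And>x y. x \<in> U \<Longrightarrow> y \<in> U \<Longrightarrow> dist (f x) (f y) = dist x y"
    using assms by (rule isometric_setsE) (rule that, assumption, blast)
  fix c assume "c \<in> distances U"
  then obtain x y where "x \<in> U" "y \<in> U" "c = dist x y" by (auto simp: distances_def)
  then have "f x \<in> V" "f y \<in> V" "c = dist (f x) (f y)" using f by auto
  then show "c \<in> distances V" by (simp add: distancesI)
qed

lemma isometric_sets_distances:
  "isometric_sets U V \<Longrightarrow> distances U = distances V"
  by (rule equalityI[OF isometric_sets_distances_subset isometric_sets_distances_subset[OF isometric_sets_sym]])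

lemma V_sub_isometric:
  assumes "isometric_sets U V" "U \<in> V_sub A" "closed V"
  shows "V \<in> V_sub A"
  using assms isometric_sets_distances[OF assms(1)] by (auto simp: V_sub_def isometric_sets_def)

lemma metric_space_dist: "Metric_space U dist"
  by standard (auto simp: dist_commute dist_triangle)

lemma metric_preserving_zero:
  assumes "metric_preserving A f" "0 \<in> A"
  shows "f 0 = 0"
proof -
  have "\<forall>x\<in>{0::real}. \<forall>y\<in>{0}. dist x y \<in> A" using assms(2) by simp
  from metric_preserving_arbitrary_carrier[OF assms(1) metric_space_dist this]
  interpret N: Metric_space "{0::real}" "\<lambda>x y. if x \<in> {0} \<and> y \<in> {0} then f (dist x y) else 0" .
  show ?thesis using N.zero[of 0 0] by simp
qed

text \<open>Three positive numbers satisfying the triangle inequalities are the distances of a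
  three-point space.\<close>

lemma metric_preserving_triangle:
  assumes f: "metric_preserving A f" and A: "0 \<in> A" "a \<in> A" "b \<in> A" "c \<in> A"
    and pos: "0 < a" "0 < b" "0 < c" and tri: "a \<le> b + c" "b \<le> a + c" "c \<le> a + b"
  shows "f a \<le> f b + f c"
proof -
  \<comment> \<open>On \<open>{0, 1, 2}\<close> a pair of distinct points is named by its sum 1, 2
    or 3.\<close>
  define d :: "real \<Rightarrow> real \<Rightarrow> real" where
    "d x y = (if x = y then 0 else if x + y = 1 then b else if x + y = 2 then a else c)" for x y
  have "Metric_space {0, 1, 2} d"
    by standard (use pos tri in \<open>auto simp: d_def add.commute\<close>)
  moreover have "\<forall>x\<in>{0, 1, 2}. \<forall>y\<in>{0, 1, 2}. d x y \<in> A" using A by (auto simp: d_def)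
  ultimately interpret N: Metric_space "{0, 1, 2}"
      "\<lambda>x y. if x \<in> {0, 1, 2} \<and> y \<in> {0, 1, 2} then f (d x y) else 0"
    by (rule metric_preserving_arbitrary_carrier[OF f])
  show ?thesis using N.triangle[of 0 1 2] by (simp add: d_def)
qed

text \<open>Away from 0, continuity comes from \<open>\<bar>f a - f b\<bar> \<le> f c\<close> for every \<open>c \<in> A\<close> with
  \<open>\<bar>a - b\<bar> \<le> c < a\<close>, provided such \<open>c\<close> can be taken small.\<close>
lemma metric_preserving_continuous_on:
  assumes f: "metric_preserving A f" "continuous (at 0 within A) f"
    and A: "A \<subseteq> {0..}" "0 \<in> A" and lim: "\<And>e. 0 < e \<Longrightarrow> \<exists>c\<in>A. 0 < c \<and> c < e"
  shows "continuous_on A f"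
proof -
  have f0: "f 0 = 0" using f(1) A(2) by (rule metric_preserving_zero)
  show ?thesis
    unfolding continuous_on_eq_continuous_within
  proof
    fix a assume a: "a \<in> A"
    show "continuous (at a within A) f"
    proof (cases "a = 0")
      case False
      then have a0: "0 < a" using a A by fastforce
      show ?thesis
        unfolding continuous_within_eps_delta
      proof (intro allI impI)
        fix e :: real assume "0 < e"
        then obtain d where d: "0 < d" "\<And>c. c \<in> A \<Longrightarrow> dist c 0 < d \<Longrightarrow> dist (f c) (f 0) < e"
          using f(2) unfolding continuous_within_eps_delta by blast
        obtain c where c: "c \<in> A" "0 < c" "c < min d a" using lim[of "min d a"] d(1) a0 by auto
        have fc: "f c < e" using d(2)[OF c(1)] c f0 by (auto simp: dist_real_def)
        have "dist (f b) (f a) < e" if b: "b \<in> A" "dist b a < c" for b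
        proof -
          have "0 < b" "a \<le> b + c" "b \<le> a + c" "c \<le> a + b"
            using b(2) c by (auto simp: dist_real_def abs_less_iff)
          then show ?thesis
            using metric_preserving_triangle[OF f(1) A(2) a b(1) c(1)]
              metric_preserving_triangle[OF f(1) A(2) b(1) a c(1)] a0 c(2) fc
            by (simp add: dist_real_def abs_less_iff add.commute)
        qed
        then show "\<exists>d>0. \<forall>b\<in>A. dist b a < d \<longrightarrow> dist (f b) (f a) < e" using c(2) by blast
      qed
    qed (use f(2) in simp)
  qed
qed

text \<open>Positive distances bounded below make a separable space discrete, so the dense sequence
  already exhausts \<open>U\<close>.\<close>

lemma V_star_countable:
  assumes U: "U \<in> (V_star A :: 'u::polish_space set set)" and e: "0 < e" "\<And>c. c \<in> A \<Longrightarrow> 0 < c \<Longrightarrow> e \<le> c"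
  shows "countable A"
proof -
  obtain \<sigma> :: "nat \<Rightarrow> 'u set \<Rightarrow> 'u" where \<sigma>: "\<And>n. \<sigma> n \<in> borel_measurable effros"
    "\<And>n U. U \<in> space effros \<Longrightarrow> \<sigma> n U \<in> U"
    "\<And>U x e. U \<in> space effros \<Longrightarrow> x \<in> U \<Longrightarrow> 0 < e \<Longrightarrow> \<exists>n. dist (\<sigma> n U) x < e"
    by (rule effros_dense_selectors[where 'a = 'u], rule that)
  have Usp: "U \<in> space effros" using U V_star_subset_V_sub V_sub_subset_space by blast
  have enum: "\<exists>n. x = \<sigma> n U" if x: "x \<in> U" for x
  proof -
    obtain n where n: "dist (\<sigma> n U) x < e" using \<sigma>(3)[OF Usp x e(1)] by blast
    have "dist (\<sigma> n U) x \<in> A" using U x \<sigma>(2)[OF Usp] by (auto simp: V_star_iff V_sub_iff)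
    then have "\<not> 0 < dist (\<sigma> n U) x" using e(2) n by force
    then show ?thesis by auto
  qed
  have "A \<subseteq> (\<lambda>(n, m). dist (\<sigma> n U) (\<sigma> m U)) ` UNIV"
  proof
    fix c assume "c \<in> A"
    then obtain x y where "x \<in> U" "y \<in> U" "dist x y = c" using U by (auto simp: V_star_iff)
    then show "c \<in> (\<lambda>(n, m). dist (\<sigma> n U) (\<sigma> m U)) ` UNIV" using enum[of x] enum[of y] by auto
  qed
  then show ?thesis by (rule countable_subset) simp
qed

text \<open>If \<open>A\<close> accumulates at 0, then \<open>f\<close> is continuous on
  \<open>A\<close>. Otherwise \<open>A\<close> is countable, being the distance set of a separable
  discrete space, and every function on it is Borel.\<close>

lemma polish_metric_preserving_measurable:
  assumes ne: "V_star A \<noteq> ({} :: 'u::urysohn_space set set)" and A: "A \<subseteq> {0..}"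
    and f: "polish_metric_preserving A f"
  shows "f \<in> borel_measurable (restrict_space borel A)"
proof -
  obtain U :: "'u set" where U: "U \<in> V_star A" using ne by blast
  then obtain x where "x \<in> U" by (auto simp: V_star_iff V_sub_iff)
  then have zero: "0 \<in> A" using U by (auto simp: V_star_iff V_sub_iff dest!: bspec)
  show ?thesis
  proof (cases "\<forall>e>0. \<exists>c\<in>A. 0 < c \<and> c < e")
    case True
    have "continuous_on A f"
      by (rule metric_preserving_continuous_on)
        (use f A zero True in \<open>auto simp: polish_metric_preserving_def\<close>)
    then show ?thesis by (rule borel_measurable_continuous_on_restrict)
  next
    case False
    then obtain e where e: "0 < e" "\<forall>c\<in>A. \<not> (0 < c \<and> c < e)" by auto
    have cA: "countable A" by (rule V_star_countable[OF U e(1)]) (use e(2) in force)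
    have cs: "B \<in> sets (restrict_space borel A)" if "B \<subseteq> A" for B
    proof -
      have "countable B" using that cA by (rule countable_subset)
      then have "B \<in> sets borel" by (rule sets.countable[rotated]) simp
      moreover have "B = A \<inter> B" using that by blast
      ultimately show ?thesis unfolding sets_restrict_space by (rule rev_image_eqI)
    qed
    show ?thesis
    proof (rule measurableI)
      show "f -` B \<inter> space (restrict_space borel A) \<in> sets (restrict_space borel A)" for B
        by (rule cs) (simp add: space_restrict_space)
    qed simp
  qed
qed

text \<open>As \<open>f\<close> says nothing sensible about distances outside \<open>A\<close>, the
  metric \<open>f \<circ> d\<close> lives on each \<open>U\<close> separately. \<open>j U\<close>
  embeds the new space without regard to Borel dependence; the Borel image \<open>\<Phi> U\<close>
  is the closure of a realization of a dense sequence. Both are completions of the same sequence,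
  hence isometric.\<close>

lemma polish_metric_preserving_reducible:
  assumes ne: "V_star A \<noteq> ({} :: 'u::urysohn_space set set)" and A: "A \<subseteq> {0..}"
    and f: "polish_metric_preserving A f" and inj: "inj_on f A"
  shows "isometry_reducible (V_sub A :: 'u set set) (V_sub (f ` A) :: 'u set set)"
proof -
  define M where "M = restrict_space effros (V_sub A :: 'u set set)"
  have spM: "space M = V_sub A" using V_sub_subset_space by (auto simp: M_def space_restrict_space)
  obtain \<sigma> :: "nat \<Rightarrow> 'u set \<Rightarrow> 'u" where \<sigma>0: "\<And>n. \<sigma> n \<in> borel_measurable effros"
    "\<And>n U. U \<in> space effros \<Longrightarrow> \<sigma> n U \<in> U"
    "\<And>U x e. U \<in> space effros \<Longrightarrow> x \<in> U \<Longrightarrow> 0 < e \<Longrightarrow> \<exists>n. dist (\<sigma> n U) x < e"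
    by (rule effros_dense_selectors[where 'a = 'u], rule that)
  have \<sigma>_meas[measurable]: "\<sigma> n \<in> borel_measurable M" for n
    unfolding M_def by (rule measurable_restrict_space1) (rule \<sigma>0)
  have \<sigma>: "\<sigma> n U \<in> U" "\<And>x e. x \<in> U \<Longrightarrow> 0 < e \<Longrightarrow> \<exists>n. dist (\<sigma> n U) x < e" if "U \<in> V_sub A" for n U
    using \<sigma>0(2,3) that V_sub_subset_space by blast+
  define D where "D n m U = f (dist (\<sigma> n U) (\<sigma> m U))" for n m U
  define fd where "fd U x y = (if x \<in> U \<and> y \<in> U then f (dist x y) else 0)" for U and x y :: 'u
  have met: "Metric_space U (fd U)" if "U \<in> V_sub A" for U
    unfolding fd_def
    by (rule metric_preserving_arbitrary_carrier[OF _ metric_space_dist])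
      (use f that in \<open>auto simp: polish_metric_preserving_def V_sub_iff\<close>)
  have fd: "fd U x y = f (dist x y)" if "x \<in> U" "y \<in> U" for U x y using that by (simp add: fd_def)
  have D: "D n m U = fd U (\<sigma> n U) (\<sigma> m U)" if "U \<in> V_sub A" for n m U
    using \<sigma>(1)[OF that] by (simp add: fd D_def)
  \<comment> \<open>Continuity of \<open>f\<close> at 0, with a bound that does not depend on
    \<open>U\<close>: dense sequences for \<open>d\<close> stay dense for
    \<open>f \<circ> d\<close>.\<close>
  have small: "\<exists>d>0. \<forall>U\<in>(V_sub A :: 'u set set). \<forall>x\<in>U. \<forall>y\<in>U. dist x y < d \<longrightarrow> f (dist x y) < e" if e: "0 < e" for e
  proof (cases "0 \<in> A")
    case True
    obtain d where d: "0 < d" "\<And>c. c \<in> A \<Longrightarrow> dist c 0 < d \<Longrightarrow> dist (f c) (f 0) < e"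
      using f e unfolding polish_metric_preserving_def continuous_within_eps_delta by blast
    have "f (dist x y) < e" if "U \<in> V_sub A" "x \<in> U" "y \<in> U" "dist x y < d" for U and x y :: 'u
    proof -
      have "f 0 = 0" using f True by (auto simp: polish_metric_preserving_def intro: metric_preserving_zero)
      moreover have "dist x y \<in> A" using that by (simp add: V_sub_iff)
      ultimately show ?thesis using d(2)[of "dist x y"] that(4) by (simp add: dist_real_def)
    qed
    with d(1) show ?thesis by (intro exI[of _ d]) simp
  next
    case False
    then have "(V_sub A :: 'u set set) = {}" by (auto simp: V_sub_iff) (metis dist_self)
    then show ?thesis by (intro exI[of _ 1]) auto
  qed
  have "\<exists>j :: 'u \<Rightarrow> 'u. \<forall>x\<in>U. \<forall>y\<in>U. dist (j x) (j y) = f (dist x y)" if U: "U \<in> V_sub A" for U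
  proof -
    interpret N: Metric_space U "fd U" using met[OF U] .
    have "range (\<lambda>n. \<sigma> n U) \<subseteq> U" using \<sigma>(1)[OF U] by blast
    moreover have "\<exists>c\<in>range (\<lambda>n. \<sigma> n U). fd U x c < e" if x: "x \<in> U" and e: "0 < e" for x e
    proof -
      obtain d where d: "0 < d" "\<forall>U\<in>(V_sub A :: 'u set set). \<forall>x\<in>U. \<forall>y\<in>U. dist x y < d \<longrightarrow> f (dist x y) < e"
        using small[OF e] by blast
      obtain n where "dist (\<sigma> n U) x < d" using \<sigma>(2)[OF U x d(1)] by blast
      then have "fd U x (\<sigma> n U) < e" using d(2) U x \<sigma>(1)[OF U] by (simp add: fd dist_commute)
      then show ?thesis by blast
    qed
    ultimately obtain j :: "'u \<Rightarrow> 'u" where "\<And>x y. x \<in> U \<Longrightarrow> y \<in> U \<Longrightarrow> dist (j x) (j y) = fd U x y"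
      using urysohn_embedding[OF N.Metric_space_axioms, of "range (\<lambda>n. \<sigma> n U)"] by (metis countable_image countableI_type)
    then show ?thesis by (auto simp: fd)
  qed
  then obtain j :: "'u set \<Rightarrow> 'u \<Rightarrow> 'u"
    where j: "\<And>U x y. U \<in> V_sub A \<Longrightarrow> x \<in> U \<Longrightarrow> y \<in> U \<Longrightarrow> dist (j U x) (j U y) = f (dist x y)" by metis
  \<comment> \<open>Continuity of the inverse of \<open>f\<close> at 0 enters here: Cauchy sequences
    for \<open>f \<circ> d\<close> are Cauchy for \<open>d\<close>, so the copy is complete.\<close>
  have closed_j: "closed (j U ` U)" if U: "U \<in> V_sub A" for U
  proof (rule closed_uniform_embedding_image)
    show "closed U" using U by (simp add: V_sub_iff)
    show "continuous_on U (j U)"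
      unfolding continuous_on_iff
    proof (intro ballI allI impI)
      fix x and \<epsilon> :: real assume x: "x \<in> U" and "0 < \<epsilon>"
      then obtain d where "0 < d" "\<forall>U\<in>(V_sub A :: 'u set set). \<forall>x\<in>U. \<forall>y\<in>U. dist x y < d \<longrightarrow> f (dist x y) < \<epsilon>"
        using small by blast
      then show "\<exists>d>0. \<forall>x'\<in>U. dist x' x < d \<longrightarrow> dist (j U x') (j U x) < \<epsilon>"
        using j[OF U] U x by (intro exI[of _ d]) simp
    qed
    fix e :: real assume "0 < e"
    then obtain d where "0 < d" "\<forall>a\<in>A. f a < d \<longrightarrow> a < e"
      using f unfolding polish_metric_preserving_def by blast
    then show "\<exists>d>0. \<forall>x\<in>U. \<forall>y\<in>U. dist (j U x) (j U y) < d \<longrightarrow> dist x y < e"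
      using j[OF U] U by (intro exI[of _ d]) (auto simp: V_sub_iff)
  qed
  obtain e :: "nat \<Rightarrow> 'u set \<Rightarrow> 'u" where e: "\<And>n. e n \<in> borel_measurable M"
    "\<And>U n m. U \<in> space M \<Longrightarrow> dist (e n U) (e m U) = D n m U"
  proof (rule measurable_pseudometric_realization[where 'u = 'u, of D M])
    show "D n m \<in> borel_measurable M" for n m
    proof -
      have "(\<lambda>U. dist (\<sigma> n U) (\<sigma> m U)) \<in> M \<rightarrow>\<^sub>M restrict_space borel A"
      proof (rule measurable_restrict_space2)
        show "(\<lambda>U. dist (\<sigma> n U) (\<sigma> m U)) \<in> space M \<rightarrow> A"
        proof
          fix U assume "U \<in> space M"
          then have U: "U \<in> V_sub A" by (simp add: spM)
          with \<sigma>(1)[OF U] show "dist (\<sigma> n U) (\<sigma> m U) \<in> A" by (simp add: V_sub_iff)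
        qed
      qed measurable
      then show ?thesis
        unfolding D_def using polish_metric_preserving_measurable[OF ne A f] by (rule measurable_compose)
    qed
    fix U n m k assume U: "U \<in> space M"
    then interpret N: Metric_space U "fd U" using met spM by blast
    from U show "D n n U = 0" "D n m U = D m n U" "D n k U \<le> D n m U + D m k U"
      unfolding spM using \<sigma>(1)[of U] N.triangle[of "\<sigma> n U" "\<sigma> m U" "\<sigma> k U"]
        N.commute[of "\<sigma> n U" "\<sigma> m U"] by (auto simp: D)
  qed (rule that)
  define \<Phi> where "\<Phi> U = closure (range (\<lambda>n. e n U))" for U
  have \<Phi>iso: "isometric_sets (j U ` U) (\<Phi> U)" if U: "U \<in> V_sub A" for U
  proof -
    have "closure (range (\<lambda>n. j U (\<sigma> n U))) = j U ` U"
    proof (rule antisym)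
      show "closure (range (\<lambda>n. j U (\<sigma> n U))) \<subseteq> j U ` U"
        by (rule closure_minimal) (use \<sigma>(1)[OF U] closed_j[OF U] in auto)
      show "j U ` U \<subseteq> closure (range (\<lambda>n. j U (\<sigma> n U)))"
      proof
        fix y assume "y \<in> j U ` U"
        then obtain x where x: "x \<in> U" "y = j U x" by blast
        show "y \<in> closure (range (\<lambda>n. j U (\<sigma> n U)))"
          unfolding closure_approachable
        proof (intro allI impI)
          fix \<epsilon> :: real assume "0 < \<epsilon>"
          then obtain d where d: "0 < d" "\<forall>U\<in>(V_sub A :: 'u set set). \<forall>x\<in>U. \<forall>y\<in>U. dist x y < d \<longrightarrow> f (dist x y) < \<epsilon>"
            using small by blast
          obtain n where "dist (\<sigma> n U) x < d" using \<sigma>(2)[OF U x(1) d(1)] by blast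
          then have "dist (j U (\<sigma> n U)) y < \<epsilon>" using d(2) U x \<sigma>(1)[OF U] j[OF U] by simp
          then show "\<exists>y'\<in>range (\<lambda>n. j U (\<sigma> n U)). dist y' y < \<epsilon>" by blast
        qed
      qed
    qed
    moreover have "isometric_sets (closure (range (\<lambda>n. j U (\<sigma> n U)))) (\<Phi> U)"
      unfolding \<Phi>_def
      by (rule isometric_closure_range) (use U e(2) j[OF U] \<sigma>(1)[OF U] in \<open>simp add: spM D_def\<close>)
    ultimately show ?thesis by simp
  qed
  have j_iso: "isometric_sets U V \<longleftrightarrow> isometric_sets (j U ` U) (j V ` V)"
    if U: "U \<in> V_sub A" and V: "V \<in> V_sub A" for U V
  proof -
    have jinj: "x = y" if W: "W \<in> V_sub A" and xy: "x \<in> W" "y \<in> W" "j W x = j W y" for W x y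
    proof -
      interpret N: Metric_space W "fd W" using met[OF W] .
      have "fd W x y = 0" using j[OF W xy(1,2)] fd[OF xy(1,2)] xy(3) by simp
      then show ?thesis using N.zero[OF xy(1,2)] by simp
    qed
    define r where "r W = inv_into W (j W)" for W
    have r: "r W (j W x) = x" if "W \<in> V_sub A" "x \<in> W" for W x
      unfolding r_def using jinj that by (intro inv_into_f_f inj_onI) auto
    show ?thesis
    proof
      assume "isometric_sets U V"
      then obtain h where h: "h ` U = V" "\<And>x y. x \<in> U \<Longrightarrow> y \<in> U \<Longrightarrow> dist (h x) (h y) = dist x y"
        by (rule isometric_setsE) (rule that, assumption, blast)
      have "isometric_sets (j U ` U) ((\<lambda>y. j V (h (r U y))) ` j U ` U)"
        by (rule isometric_sets_image) (use h j U V r in auto)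
      moreover have "(\<lambda>y. j V (h (r U y))) ` j U ` U = j V ` V"
        unfolding h(1)[symmetric] image_image using r[OF U] by (auto intro!: image_cong)
      ultimately show "isometric_sets (j U ` U) (j V ` V)" by simp
    next
      assume "isometric_sets (j U ` U) (j V ` V)"
      then obtain h where h: "h ` j U ` U = j V ` V"
        "\<And>x y. x \<in> j U ` U \<Longrightarrow> y \<in> j U ` U \<Longrightarrow> dist (h x) (h y) = dist x y"
        by (rule isometric_setsE) (rule that, assumption, blast)
      define g where "g x = r V (h (j U x))" for x
      have g: "g x \<in> V" "j V (g x) = h (j U x)" if "x \<in> U" for x
      proof -
        have "h (j U x) \<in> j V ` V" using h(1) that by blast
        then obtain y where "y \<in> V" "h (j U x) = j V y" by blast
        then show "g x \<in> V" "j V (g x) = h (j U x)" using r[OF V] by (auto simp: g_def)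
      qed
      have "dist (g x) (g y) = dist x y" if xy: "x \<in> U" "y \<in> U" for x y
      proof -
        \<comment> \<open>An isometry for the new metrics preserves \<open>f \<circ> d\<close>, and
          injectivity of \<open>f\<close> on \<open>A\<close> turns this into preservation of
          \<open>d\<close>.\<close>
        have "f (dist (g x) (g y)) = f (dist x y)"
          using h(2)[of "j U x" "j U y"] xy g j[OF U xy] j[OF V g(1)[OF xy(1)] g(1)[OF xy(2)]] by simp
        then show ?thesis
          using inj_onD[OF inj] U V xy g(1) by (simp add: V_sub_iff)
      qed
      moreover have "g ` U = V"
      proof (intro equalityI subsetI)
        fix y assume y: "y \<in> V"
        then have "j V y \<in> h ` j U ` U" unfolding h(1) by blast
        then obtain x where x: "x \<in> U" "j V y = h (j U x)" by auto
        then have "y = g x" using r[OF V y] by (simp add: g_def)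
        with x show "y \<in> g ` U" by blast
      qed (use g in auto)
      ultimately show "isometric_sets U V" unfolding isometric_sets_def by blast
    qed
  qed
  show ?thesis
  proof (rule isometry_reducibleI[where \<Phi> = \<Phi>])
    show "\<Phi> \<in> restrict_space effros (V_sub A) \<rightarrow>\<^sub>M effros"
      unfolding \<Phi>_def M_def[symmetric] by (rule measurable_closure_range) (rule e)
    fix U :: "'u set" assume U: "U \<in> V_sub A"
    have "j U ` U \<in> V_sub (f ` A)" using closed_j[OF U] U j[OF U] by (auto simp: V_sub_iff)
    then show "\<Phi> U \<in> V_sub (f ` A)"
      by (rule V_sub_isometric[OF \<Phi>iso[OF U]]) (simp add: \<Phi>_def)
    fix V :: "'u set" assume V: "V \<in> V_sub A"
    show "isometric_sets U V \<longleftrightarrow> isometric_sets (\<Phi> U) (\<Phi> V)"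
      unfolding j_iso[OF U V]
      using \<Phi>iso[OF U] \<Phi>iso[OF V] isometric_sets_sym isometric_sets_trans by metis
  qed (rule V_sub_subset_space)
qed

section \<open>Coding relations by graphs\<close>

text \<open>A countable family of symmetric relations \<open>R _ _ j\<close> on a set \<open>N\<close> is coded by one graph: every
  pair \<open>c\<close>, \<open>d\<close> and index \<open>j\<close> get a vertex \<open>Link c d j\<close>, joined to \<open>c\<close> and \<open>d\<close> just in case
  \<open>R c d j\<close>, and labelled with \<open>j\<close> by a clique of size \<open>j + 2\<close>. Precisely the vertices \<open>Node c\<close>
  lie in no triangle.\<close>
datatype 'n vert = Node 'n | Link 'n 'n nat | Tag 'n 'n nat nat

instance vert :: (countable) countable
  by countable_datatype

fun adj :: "('n \<Rightarrow> 'n \<Rightarrow> nat \<Rightarrow> bool) \<Rightarrow> 'n vert \<Rightarrow> 'n vert \<Rightarrow> bool" where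
  "adj R (Node c) (Link d e j) \<longleftrightarrow> R d e j \<and> (c = d \<or> c = e)"
| "adj R (Link d e j) (Node c) \<longleftrightarrow> R d e j \<and> (c = d \<or> c = e)"
| "adj R (Link d e j) (Tag d' e' j' i) \<longleftrightarrow> d = d' \<and> e = e' \<and> j = j'"
| "adj R (Tag d' e' j' i) (Link d e j) \<longleftrightarrow> d = d' \<and> e = e' \<and> j = j'"
| "adj R (Tag d e j i) (Tag d' e' j' i') \<longleftrightarrow> d = d' \<and> e = e' \<and> j = j' \<and> i \<noteq> i'"
| "adj R (Node c) (Node d) \<longleftrightarrow> False"
| "adj R (Node c) (Tag d e j i) \<longleftrightarrow> False"
| "adj R (Tag d e j i) (Node c) \<longleftrightarrow> False"
| "adj R (Link d e j) (Link d' e' j') \<longleftrightarrow> False"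

text \<open>A vertex \<open>Link d e j\<close> is there whether or not \<open>R d e j\<close> holds,
  so the vertex set depends on \<open>N\<close> only; \<open>R\<close> affects just the edges
  between links and nodes. The bound on \<open>i\<close> makes the number of tags tell
  \<open>j\<close>.\<close>

definition verts :: "'n set \<Rightarrow> 'n vert set" where
  "verts N = {v. set_vert v \<subseteq> N \<and> (\<forall>d e j i. v = Tag d e j i \<longrightarrow> i < j + 2)}"

lemma verts_simps [simp]:
  "Node c \<in> verts N \<longleftrightarrow> c \<in> N"
  "Link d e j \<in> verts N \<longleftrightarrow> d \<in> N \<and> e \<in> N"
  "Tag d e j i \<in> verts N \<longleftrightarrow> d \<in> N \<and> e \<in> N \<and> i < j + 2"
  by (auto simp: verts_def)

lemma adj_sym: "adj R v w \<longleftrightarrow> adj R w v"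
  by (cases v; cases w) auto

lemma adj_irrefl: "\<not> adj R v v"
  by (cases v) auto

text \<open>Neighbours of a node are links, and links are never adjacent to each other. A link forms
  a triangle with two of its tags, a tag with its link and another tag; there are at least two tags
  for each link.\<close>

lemma in_triangle_iff:
  assumes "v \<in> verts N"
  shows "(\<exists>w\<in>verts N. \<exists>w'\<in>verts N. adj R v w \<and> adj R v w' \<and> adj R w w') \<longleftrightarrow> (\<forall>c. v \<noteq> Node c)"
proof (cases v)
  case (Node c)
  have "\<not> (adj R (Node c) w \<and> adj R (Node c) w' \<and> adj R w w')" for w w'
    by (cases w; cases w') auto
  with Node show ?thesis by blast
next
  case (Link d e j)
  have "adj R v (Tag d e j 0) \<and> adj R v (Tag d e j 1) \<and> adj R (Tag d e j 0) (Tag d e j 1)"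
    "Tag d e j 0 \<in> verts N" "Tag d e j 1 \<in> verts N" using Link assms by auto
  then show ?thesis using Link by blast
next
  case (Tag d e j i)
  define i' where "i' = (if i = 0 then 1 else 0 :: nat)"
  have "adj R v (Tag d e j i') \<and> adj R v (Link d e j) \<and> adj R (Tag d e j i') (Link d e j)"
    "Tag d e j i' \<in> verts N" "Link d e j \<in> verts N" using Tag assms by (auto simp: i'_def)
  then show ?thesis using Tag by blast
qed

lemma graph_iso_Node:
  assumes h: "bij_betw h (verts N) (verts N')"
    and adj: "\<And>v w. v \<in> verts N \<Longrightarrow> w \<in> verts N \<Longrightarrow> adj R (h v) (h w) \<longleftrightarrow> adj R v w"
    and v: "v \<in> verts N"
  shows "(\<exists>c. h v = Node c) \<longleftrightarrow> (\<exists>c. v = Node c)"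
proof -
  have im: "verts N' = h ` verts N" using h by (simp add: bij_betw_def)
  have hv: "h v \<in> verts N'" using im v by blast
  have "(\<exists>w\<in>verts N'. \<exists>w'\<in>verts N'. adj R (h v) w \<and> adj R (h v) w' \<and> adj R w w') \<longleftrightarrow>
      (\<exists>w\<in>verts N. \<exists>w'\<in>verts N. adj R v w \<and> adj R v w' \<and> adj R w w')"
    unfolding im by (simp add: adj v cong: bex_cong)
  then show ?thesis unfolding in_triangle_iff[OF hv] in_triangle_iff[OF v] by blast
qed

text \<open>The link between \<open>c\<close> and \<open>d\<close> is mapped to a vertex adjacent to
  a node, hence to a link, whose nodes are \<open>c'\<close> and \<open>d'\<close> and whose index
  shows in its number of tags. Only one implication is proved; the inverse isomorphism gives the
  other.\<close>

lemma graph_iso_relation: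
  assumes sym: "\<And>c d j. R c d j \<longleftrightarrow> R d c j"
    and h: "bij_betw h (verts N) (verts N')"
    and adj: "\<And>v w. v \<in> verts N \<Longrightarrow> w \<in> verts N \<Longrightarrow> adj R (h v) (h w) \<longleftrightarrow> adj R v w"
    and cd: "c \<in> N" "d \<in> N" "h (Node c) = Node c'" "h (Node d) = Node d'" and R: "R c d j"
  shows "R c' d' j"
proof -
  have im: "verts N' = h ` verts N" and inj: "inj_on h (verts N)" using h by (simp_all add: bij_betw_def)
  have node: "(\<exists>c. h v = Node c) \<longleftrightarrow> (\<exists>c. v = Node c)" if "v \<in> verts N" for v
    by (rule graph_iso_Node[OF h adj that])
  let ?l = "Link c d j"
  have l: "?l \<in> verts N" using cd by simp
  have "adj R (Node c') (h ?l)" "adj R (Node d') (h ?l)"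
    using adj[of "Node c" ?l] adj[of "Node d" ?l] cd R l by auto
  then obtain e f j' where ef: "h ?l = Link e f j'" "R e f j'" "c' = e \<or> c' = f" "d' = e \<or> d' = f"
    by (cases "h ?l") auto
  have hl: "h ?l \<in> verts N'" using im l by blast
  \<comment> \<open>Adjacency only places \<open>c'\<close> and \<open>d'\<close> among the ends of
    the new link. If they coincide, the other end is still open; it has to come from a node adjacent
    to the old link.\<close>
  have "b = c' \<or> b = d'" if b: "b = e \<or> b = f" for b
  proof -
    have "Node b \<in> verts N'" using hl ef(1) b by auto
    then obtain v where v: "v \<in> verts N" "Node b = h v" using im by auto
    then obtain a where a: "v = Node a" using node by metis
    have "adj R (h v) (h ?l)" using v(2) ef b by (auto simp flip: v(2))
    then have "a = c \<or> a = d" using adj[OF v(1) l] a by auto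
    then show ?thesis using a v(2) cd by auto
  qed
  then have "e = c' \<or> e = d'" "f = c' \<or> f = d'" by auto
  with ef have R': "R c' d' j'" using sym by metis
  \<comment> \<open>Neighbours other than nodes; for a link these are exactly its tags, so counting
    them gives the index.\<close>
  define nb where "nb M v = {w \<in> verts M. adj R v w \<and> (\<forall>c. w \<noteq> Node c)}" for M v
  have nb_Link: "card (nb M (Link a b i)) = i + 2" if "a \<in> M" "b \<in> M" for M a b i
  proof -
    have "w \<in> nb M (Link a b i) \<longleftrightarrow> w \<in> Tag a b i ` {..<i + 2}" for w
      using that by (cases w) (auto simp: nb_def)
    then have "nb M (Link a b i) = Tag a b i ` {..<i + 2}" by blast
    then show ?thesis by (simp add: card_image inj_on_def)
  qed
  have "w \<in> nb N' (h ?l) \<longleftrightarrow> w \<in> h ` nb N ?l" for w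
  proof -
    define P where "P v \<longleftrightarrow> adj R ?l v \<and> (\<forall>c. v \<noteq> Node c)" for v
    define P' where "P' v \<longleftrightarrow> adj R (h ?l) v \<and> (\<forall>c. v \<noteq> Node c)" for v
    have "P' (h v) \<longleftrightarrow> P v" if "v \<in> verts N" for v
      unfolding P_def P'_def using node[OF that] adj[OF l that] by blast
    then have "w \<in> h ` verts N \<and> P' w \<longleftrightarrow> w \<in> h ` {v \<in> verts N. P v}" by blast
    then show ?thesis unfolding nb_def im P_def P'_def by simp
  qed
  then have "nb N' (h ?l) = h ` nb N ?l" by blast
  moreover have "card (h ` nb N ?l) = card (nb N ?l)"
    by (rule card_image) (rule inj_on_subset[OF inj], auto simp: nb_def)
  ultimately have "j' = j" using nb_Link[of c N d j] nb_Link[of e N' f j'] cd hl ef(1) by auto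
  with R' show ?thesis by simp
qed

lemma graph_iso_recover:
  assumes sym: "\<And>c d j. R c d j \<longleftrightarrow> R d c j"
    and h: "bij_betw h (verts N) (verts N')"
    and adj: "\<And>v w. v \<in> verts N \<Longrightarrow> w \<in> verts N \<Longrightarrow> adj R (h v) (h w) \<longleftrightarrow> adj R v w"
  obtains g where "bij_betw g N N'" "\<And>c d j. c \<in> N \<Longrightarrow> d \<in> N \<Longrightarrow> R (g c) (g d) j \<longleftrightarrow> R c d j"
proof -
  define k where "k = inv_into (verts N) h"
  have k: "bij_betw k (verts N') (verts N)" unfolding k_def using h by (rule bij_betw_inv_into)
  have hk: "h (k w) = w" "k w \<in> verts N" if "w \<in> verts N'" for w
    using that h k by (auto simp: k_def bij_betw_inv_into_right dest: bij_betwE)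
  have kh: "k (h v) = v" "h v \<in> verts N'" if "v \<in> verts N" for v
    using that h by (auto simp: k_def bij_betw_inv_into_left dest: bij_betwE)
  have kadj: "adj R (k v) (k w) \<longleftrightarrow> adj R v w" if "v \<in> verts N'" "w \<in> verts N'" for v w
    using adj[of "k v" "k w"] hk that by simp
  define g where "g c = (THE c'. h (Node c) = Node c')" for c
  have g: "h (Node c) = Node (g c)" if c: "c \<in> N" for c
  proof -
    obtain c' where "h (Node c) = Node c'" using graph_iso_Node[OF h adj, of "Node c"] c by auto
    then show ?thesis unfolding g_def by simp
  qed
  have gN: "g c \<in> N'" if "c \<in> N" for c using kh(2)[of "Node c"] that g by simp
  show ?thesis
  proof
    show "bij_betw g N N'"
      unfolding bij_betw_def
    proof
      show "inj_on g N"
      proof (rule inj_onI)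
        fix c d assume cd: "c \<in> N" "d \<in> N" "g c = g d"
        then have "k (h (Node c)) = k (h (Node d))" using g by simp
        then show "c = d" using kh cd by simp
      qed
      show "g ` N = N'"
      proof (intro equalityI subsetI)
        fix c' assume c': "c' \<in> N'"
        then obtain c where c: "k (Node c') = Node c"
          using graph_iso_Node[OF k kadj, of "Node c'"] by auto
        then have "c \<in> N" "h (Node c) = Node c'" using hk[of "Node c'"] c' by auto
        then show "c' \<in> g ` N" using g by auto
      qed (use gN in auto)
    qed
    fix c d j assume cd: "c \<in> N" "d \<in> N"
    show "R (g c) (g d) j \<longleftrightarrow> R c d j"
    proof
      assume "R c d j"
      then show "R (g c) (g d) j" using graph_iso_relation[OF sym h adj cd g[OF cd(1)] g[OF cd(2)]] by blast
    next
      assume *: "R (g c) (g d) j"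
      have "k (Node (g c)) = Node c" "k (Node (g d)) = Node d"
        using kh(1)[of "Node c"] kh(1)[of "Node d"] cd g by auto
      then show "R c d j"
        using graph_iso_relation[OF sym k kadj gN[OF cd(1)] gN[OF cd(2)] _ _ *] by blast
    qed
  qed
qed

lemma adj_map_vert:
  assumes g: "inj_on g N" and R: "\<And>c d j. c \<in> N \<Longrightarrow> d \<in> N \<Longrightarrow> R (g c) (g d) j \<longleftrightarrow> R c d j"
    and "v \<in> verts N" "w \<in> verts N"
  shows "adj R (map_vert g v) (map_vert g w) \<longleftrightarrow> adj R v w"
  using assms by (cases v; cases w) (auto simp: inj_on_eq_iff)

lemma map_vert_verts: "map_vert g ` verts N = verts (g ` N)"
proof (intro equalityI subsetI)
  fix v assume "v \<in> verts (g ` N)"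
  then show "v \<in> map_vert g ` verts N"
  proof (cases v)
    case (Node c)
    with \<open>v \<in> _\<close> obtain a where "a \<in> N" "c = g a" by auto
    with Node show ?thesis by (intro image_eqI[of _ _ "Node a"]) auto
  next
    case (Link c d j)
    with \<open>v \<in> _\<close> obtain a b where "a \<in> N" "c = g a" "b \<in> N" "d = g b" by auto
    with Link show ?thesis by (intro image_eqI[of _ _ "Link a b j"]) auto
  next
    case (Tag c d j i)
    with \<open>v \<in> _\<close> obtain a b where "a \<in> N" "c = g a" "b \<in> N" "d = g b" "i < j + 2" by auto
    with Tag show ?thesis by (intro image_eqI[of _ _ "Tag a b j i"]) auto
  qed
next
  fix v assume "v \<in> map_vert g ` verts N"
  then obtain w where "w \<in> verts N" "v = map_vert g w" by blast
  then show "v \<in> verts (g ` N)" by (cases w) auto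
qed

lemma inj_on_map_vert:
  assumes "inj_on g N"
  shows "inj_on (map_vert g) (verts N)"
proof (rule inj_onI)
  fix v w assume "v \<in> verts N" "w \<in> verts N" "map_vert g v = map_vert g w"
  then show "v = w" using assms by (cases v; cases w) (auto simp: inj_on_eq_iff)
qed

definition gdist :: "real \<Rightarrow> real \<Rightarrow> ('n \<Rightarrow> 'n \<Rightarrow> nat \<Rightarrow> bool) \<Rightarrow> 'n vert \<Rightarrow> 'n vert \<Rightarrow> real" where
  "gdist p q R v w = (if v = w then 0 else if adj R v w then q else p)"

text \<open>Any symmetric assignment of two values \<open>p < q \<le> 2 * p\<close> to pairs of
  distinct points is a metric, and the graph is recovered from it as the relation of being at
  distance \<open>q\<close>.\<close>

lemma gdist_metric:
  assumes "0 < p" "p < q" "q \<le> 2 * p"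
  shows "gdist p q R v v = 0" "gdist p q R v w = gdist p q R w v"
    "gdist p q R v u \<le> gdist p q R v w + gdist p q R w u"
    "gdist p q R v w = 0 \<longleftrightarrow> v = w" "gdist p q R v w = q \<longleftrightarrow> adj R v w"
  using assms adj_irrefl[of R] adj_sym[of R v w] by (auto simp: gdist_def)

section \<open>Distance sets with gaps near 0\<close>

lemma isometric_images_iff:
  fixes j :: "'s \<Rightarrow> 'a::metric_space" and k :: "'t \<Rightarrow> 'b::metric_space"
  assumes j: "\<And>v w. v \<in> S \<Longrightarrow> w \<in> S \<Longrightarrow> dist (j v) (j w) = dS v w"
    and k: "\<And>v w. v \<in> T \<Longrightarrow> w \<in> T \<Longrightarrow> dist (k v) (k w) = dT v w"
    and S: "\<And>v w. dS v w = 0 \<longleftrightarrow> v = w" and T: "\<And>v w. dT v w = 0 \<longleftrightarrow> v = w"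
  shows "isometric_sets (j ` S) (k ` T) \<longleftrightarrow>
    (\<exists>h. bij_betw h S T \<and> (\<forall>v\<in>S. \<forall>w\<in>S. dT (h v) (h w) = dS v w))"
proof
  define r where "r = inv_into S j"
  have "inj_on j S" by (rule inj_onI) (metis j S dist_self)
  then have r: "r (j v) = v" if "v \<in> S" for v unfolding r_def using that by (rule inv_into_f_f)
  define t where "t = inv_into T k"
  have "inj_on k T" by (rule inj_onI) (metis k T dist_self)
  then have t: "t (k v) = v" if "v \<in> T" for v unfolding t_def using that by (rule inv_into_f_f)
  {
    assume "isometric_sets (j ` S) (k ` T)"
    then obtain f where f: "f ` j ` S = k ` T"
      "\<And>x y. x \<in> j ` S \<Longrightarrow> y \<in> j ` S \<Longrightarrow> dist (f x) (f y) = dist x y"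
      by (rule isometric_setsE) (rule that, assumption, blast)
    define h where "h v = t (f (j v))" for v
    have h: "h v \<in> T" "k (h v) = f (j v)" if "v \<in> S" for v
    proof -
      have "f (j v) \<in> k ` T" using f(1) that by blast
      then obtain w where "w \<in> T" "f (j v) = k w" by blast
      then show "h v \<in> T" "k (h v) = f (j v)" using t by (auto simp: h_def)
    qed
    have pres: "dT (h v) (h w) = dS v w" if vw: "v \<in> S" "w \<in> S" for v w
      using f(2)[of "j v" "j w"] vw h k[OF h(1)[OF vw(1)] h(1)[OF vw(2)]] j[OF vw] by simp
    have "inj_on h S" by (rule inj_onI) (metis pres S T)
    moreover have "h ` S = T"
    proof (intro equalityI subsetI)
      fix w assume w: "w \<in> T"
      then have "k w \<in> f ` j ` S" unfolding f(1) by blast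
      then obtain v where v: "v \<in> S" "k w = f (j v)" by auto
      then have "w = h v" using t[OF w] by (simp add: h_def)
      with v show "w \<in> h ` S" by blast
    qed (use h in auto)
    ultimately show "\<exists>h. bij_betw h S T \<and> (\<forall>v\<in>S. \<forall>w\<in>S. dT (h v) (h w) = dS v w)"
      using pres unfolding bij_betw_def by blast
  next
    assume "\<exists>h. bij_betw h S T \<and> (\<forall>v\<in>S. \<forall>w\<in>S. dT (h v) (h w) = dS v w)"
    then obtain h where h: "h ` S = T" "\<forall>v\<in>S. \<forall>w\<in>S. dT (h v) (h w) = dS v w"
      unfolding bij_betw_def by blast
    have hT: "h v \<in> T" if "v \<in> S" for v using h(1) that by blast
    have "isometric_sets (j ` S) ((\<lambda>x. k (h (r x))) ` j ` S)"
      by (rule isometric_sets_image) (use h(2) hT j k r in auto)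
    moreover have "(\<lambda>x. k (h (r x))) ` j ` S = k ` T"
      unfolding h(1)[symmetric] image_image using r by (auto intro!: image_cong)
    ultimately show "isometric_sets (j ` S) (k ` T)" by simp
  }
qed

section \<open>Chain classes and the countable structure of a space\<close>

definition chain :: "'a::metric_space set \<Rightarrow> real \<Rightarrow> 'a \<Rightarrow> 'a \<Rightarrow> bool" where
  "chain U d = (\<lambda>x y. x \<in> U \<and> y \<in> U \<and> dist x y < d)\<^sup>*\<^sup>*"

lemma chain_refl: "chain U d x x"
  by (simp add: chain_def)

lemma chain_trans: "chain U d x y \<Longrightarrow> chain U d y z \<Longrightarrow> chain U d x z"
  unfolding chain_def by (rule rtranclp_trans)

lemma chain_sym: "chain U d x y \<Longrightarrow> chain U d y x"
  unfolding chain_def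
  by (rule sympD[OF symp_rtranclp]) (auto intro!: sympI simp: dist_commute)

lemma chain_step: "x \<in> U \<Longrightarrow> y \<in> U \<Longrightarrow> dist x y < d \<Longrightarrow> chain U d x y"
  unfolding chain_def by (rule r_into_rtranclp) simp

lemma chain_in: "chain U d x y \<Longrightarrow> x \<in> U \<Longrightarrow> y \<in> U"
  unfolding chain_def by (induction rule: rtranclp_induct) auto

lemma chain_class_eq: "Collect (chain U d x) = Collect (chain U d y) \<longleftrightarrow> chain U d x y"
  using chain_refl chain_sym chain_trans by blast

lemma chain_isometry:
  assumes "chain U d x y" "x \<in> U" and f: "f ` U = V" "\<And>x y. x \<in> U \<Longrightarrow> y \<in> U \<Longrightarrow> dist (f x) (f y) = dist x y"
  shows "chain V d (f x) (f y)"
  using assms(1) unfolding chain_def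
proof (induction rule: rtranclp_induct)
  case (step y z)
  then have "f y \<in> V" "f z \<in> V" "dist (f y) (f z) < d" using f(1) f(2)[of y z] by auto
  then show ?case using step.IH by (simp add: rtranclp.rtrancl_into_rtrancl)
qed simp

text \<open>Steps shorter than the length of a gap of \<open>A\<close> cannot carry a chain across the gap.\<close>
lemma chain_dist_le:
  assumes U: "U \<in> V_sub A" and p: "0 \<le> p" and gap: "\<And>c. c \<in> A \<Longrightarrow> c < p + d \<Longrightarrow> c \<le> p"
    and "chain U d x y" "x \<in> U"
  shows "dist x y \<le> p"
  using assms(4)[unfolded chain_def]
proof (induction rule: rtranclp_induct)
  case (step y z)
  have "dist x z \<le> dist x y + dist y z" by (rule dist_triangle)
  then have "dist x z < p + d" using step by linarith
  moreover have "dist x z \<in> A" using U \<open>x \<in> U\<close> step by (simp add: V_sub_iff)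
  ultimately show ?case by (intro gap)
qed (use p in simp)

text \<open>An enumeration of the rationals: the distance between two classes is coded by countably
  many relations, one for each rational bound.\<close>

definition rt :: "nat \<Rightarrow> real" where
  "rt i = real_of_rat (from_nat i)"

lemma rt_dense: "x < y \<Longrightarrow> \<exists>i. x < rt i \<and> rt i < y"
  unfolding rt_def using of_rat_dense[of x y] by (metis from_nat_to_nat)

text \<open>Even indices record distances between classes, odd ones the level of a class.\<close>
definition node_rel :: "nat \<times> 'a::metric_space set \<Rightarrow> nat \<times> 'a set \<Rightarrow> nat \<Rightarrow> bool" where
  "node_rel c d j \<longleftrightarrow> (if even j then \<exists>x\<in>snd c. \<exists>y\<in>snd d. dist x y < rt (j div 2)
     else c = d \<and> fst c = j div 2)"

lemma node_rel_even: "node_rel c d (2 * i) \<longleftrightarrow> (\<exists>x\<in>snd c. \<exists>y\<in>snd d. dist x y < rt i)"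
  by (simp add: node_rel_def)

lemma node_rel_odd: "node_rel c d (2 * i + 1) \<longleftrightarrow> c = d \<and> fst c = i"
  by (simp add: node_rel_def)

lemma node_rel_sym: "node_rel c d j \<longleftrightarrow> node_rel d c j"
proof -
  have "node_rel d c j" if "node_rel c d j" for c d :: "nat \<times> 'a set"
  proof (cases "even j")
    case True
    with that show ?thesis unfolding node_rel_def by simp (metis dist_commute)
  next
    case False
    with that show ?thesis unfolding node_rel_def by auto
  qed
  then show ?thesis by blast
qed

text \<open>No element of \<open>A\<close> lies strictly between \<open>p k\<close> and
  \<open>p k + \<delta> k\<close>. The left end bounds the diameter of a chain class for steps below
  \<open>\<delta> k\<close>, while two such classes are at least \<open>\<delta> k\<close> apart; as
  the left ends tend to 0, the classes determine the points.\<close>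

locale gap_sequence =
  fixes A :: "real set" and p \<delta> :: "nat \<Rightarrow> real"
  assumes p: "\<And>k. 0 \<le> p k" "p \<longlonglongrightarrow> 0" and \<delta>: "\<And>k. 0 < \<delta> k"
    and gap: "\<And>k c. c \<in> A \<Longrightarrow> c < p k + \<delta> k \<Longrightarrow> c \<le> p k"
begin

text \<open>The level belongs to the node because one set may be a class at several levels.\<close>

definition node :: "'a::metric_space set \<Rightarrow> nat \<Rightarrow> 'a \<Rightarrow> nat \<times> 'a set" where
  "node U k x = (k, Collect (chain U (\<delta> k) x))"

definition nodes :: "'a::metric_space set \<Rightarrow> (nat \<times> 'a set) set" where
  "nodes U = {node U k x | k x. x \<in> U}"

lemma node_eq_iff: "node U k x = node U l y \<longleftrightarrow> k = l \<and> chain U (\<delta> k) x y"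
  unfolding node_def prod.inject using chain_class_eq[of U "\<delta> k" x y] by auto

lemma fst_node [simp]: "fst (node U k x) = k"
  by (simp add: node_def)

lemma mem_node: "y \<in> snd (node U k x) \<longleftrightarrow> chain U (\<delta> k) x y"
  by (simp add: node_def)

lemma nodesI: "x \<in> U \<Longrightarrow> node U k x \<in> nodes U"
  by (auto simp: nodes_def)

lemma node_dist_le:
  assumes "U \<in> V_sub A" "x \<in> U" "y \<in> snd (node U k x)"
  shows "y \<in> U" "dist x y \<le> p k"
  using assms chain_in chain_dist_le[OF assms(1) p(1) gap] by (auto simp: mem_node)

lemma node_rel_node_self: "x \<in> U \<Longrightarrow> 0 < rt i \<Longrightarrow> node_rel (node U k x) (node U l x) (2 * i)"
  unfolding node_rel_even by (intro bexI[of _ x]) (auto simp: mem_node chain_refl)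

lemma node_rel_dist_le:
  assumes U: "U \<in> V_sub A" and "x \<in> U" "y \<in> U" and R: "node_rel (node U k x) (node U l y) (2 * i)"
  shows "dist x y < p k + rt i + p l"
proof -
  obtain z w where "z \<in> snd (node U k x)" "w \<in> snd (node U l y)" and zw: "dist z w < rt i"
    using R unfolding node_rel_even by blast
  then have "dist x z \<le> p k" "dist y w \<le> p l" using node_dist_le[OF U] assms(2,3) by auto
  then show ?thesis
    using zw dist_triangle[of x y z] dist_triangle2[of z y w] by linarith
qed

lemma node_rel_cases:
  assumes "x \<in> U" "y \<in> U" "dist x y < rt i"
  shows "node_rel (node U k x) (node U l y) (2 * i)"
  unfolding node_rel_even
  by (intro bexI[of _ x] bexI[of _ y]) (auto simp: mem_node chain_refl assms)

text \<open>The images of the classes of \<open>x\<close> have diameters tending to 0 and mutual distances 0, so they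
  shrink to a point; it belongs to each of them since distinct classes are \<open>\<delta> k\<close> apart.\<close>
lemma node_map_point:
  fixes U V :: "'a::complete_space set"
  assumes U: "U \<in> V_sub A" and V: "V \<in> V_sub A" and g: "\<And>c. c \<in> nodes U \<Longrightarrow> g c \<in> nodes V"
    and R: "\<And>c d j. c \<in> nodes U \<Longrightarrow> d \<in> nodes U \<Longrightarrow> node_rel (g c) (g d) j \<longleftrightarrow> node_rel c d j"
    and x: "x \<in> U"
  shows "\<exists>y\<in>V. \<forall>k. g (node U k x) = node V k y"
proof -
  have "\<exists>w\<in>V. g (node U k x) = node V k w" for k
  proof -
    have n: "node U k x \<in> nodes U" using x by (rule nodesI)
    obtain l w where w: "w \<in> V" "g (node U k x) = node V l w" using g[OF n] by (auto simp: nodes_def)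
    \<comment> \<open>The odd relation with index \<open>2 * k + 1\<close> holds between a node and
      itself just at level \<open>k\<close>, so \<open>g\<close> preserves levels.\<close>
    have "node_rel (node U k x) (node U k x) (2 * k + 1)" unfolding node_rel_odd by simp
    then have "node_rel (node V l w) (node V l w) (2 * k + 1)" using R[OF n n, of "2 * k + 1"] w(2) by simp
    then have "l = k" unfolding node_rel_odd by simp
    with w show ?thesis by blast
  qed
  then obtain w where w: "\<And>k. w k \<in> V" "\<And>k. g (node U k x) = node V k (w k)" by metis
  have R': "node_rel (node V k (w k)) (node V l (w l)) (2 * i)" if "0 < rt i" for k l i
    using R[OF nodesI[OF x] nodesI[OF x]] node_rel_node_self[OF x that] w(2) by metis
  have ww: "dist (w k) (w l) \<le> p k + p l" for k l
  proof (rule field_le_epsilon)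
    fix e :: real assume "0 < e"
    then obtain i where "0 < rt i" "rt i < e" using rt_dense by blast
    then show "dist (w k) (w l) \<le> p k + p l + e"
      using node_rel_dist_le[OF V w(1) w(1) R', of i k l] by linarith
  qed
  have small: "\<exists>K. \<forall>k\<ge>K. p k < e" if "0 < e" for e
    using LIMSEQ_D[OF p(2) that] p(1) by (auto simp: abs_of_nonneg)
  have "Cauchy w"
  proof (rule metric_CauchyI)
    fix e :: real assume "0 < e"
    then obtain K where K: "\<forall>k\<ge>K. p k < e / 2" using small[of "e / 2"] by auto
    have "dist (w m) (w n) < e" if "K \<le> m" "K \<le> n" for m n
      using ww[of m n] K that by (smt (verit) field_sum_of_halves)
    then show "\<exists>M. \<forall>m\<ge>M. \<forall>n\<ge>M. dist (w m) (w n) < e" by blast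
  qed
  then obtain y where y: "w \<longlonglongrightarrow> y" using Cauchy_convergent convergent_def by blast
  have closedV: "closed V" using V by (simp add: V_sub_iff)
  have yV: "y \<in> V" using closed_sequentially[OF closedV w(1) y] .
  have wy: "dist (w k) y \<le> p k" for k
  proof (rule LIMSEQ_le)
    show "(\<lambda>l. dist (w k) (w l)) \<longlonglongrightarrow> dist (w k) y" by (intro tendsto_dist tendsto_const y)
    show "(\<lambda>l. p k + p l) \<longlonglongrightarrow> p k" using tendsto_add[OF tendsto_const p(2), of "p k"] by simp
  qed (use ww in auto)
  have "chain V (\<delta> k) (w k) y" for k
  proof -
    have "0 < \<delta> k / 4" using \<delta>[of k] by simp
    \<comment> \<open>Three quarters suffice: the distances from \<open>z\<close> to
      \<open>z'\<close>, from \<open>z'\<close> to \<open>w l\<close>, and from \<open>w l\<close>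
      to \<open>y\<close> are each below \<open>\<delta> k / 4\<close>.\<close>
    then obtain l where l: "p l < \<delta> k / 4" using small by blast
    obtain i where i: "0 < rt i" "rt i < \<delta> k / 4" using rt_dense[OF \<open>0 < \<delta> k / 4\<close>] by blast
    obtain z z' where z: "z \<in> snd (node V k (w k))" "z' \<in> snd (node V l (w l))" "dist z z' < rt i"
      using R'[OF i(1), of k l] unfolding node_rel_even by blast
    have "dist (w l) z' \<le> p l" using node_dist_le[OF V w(1) z(2)] by simp
    then have "dist z y < \<delta> k"
      using wy[of l] l i z(3) dist_triangle[of z y z'] dist_triangle[of z' y "w l"] \<delta>[of k]
      by (simp add: dist_commute)
    moreover have "z \<in> V" using node_dist_le[OF V w(1) z(1)] by simp
    ultimately show ?thesis using z(1) yV chain_step chain_trans by (metis mem_node)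
  qed
  then show ?thesis using yV w(2) by (intro bexI[of _ y]) (auto simp: node_eq_iff)
qed

text \<open>A point is the same as its sequence of classes. The relations bound the distance of two
  points by any rational above it, up to the diameters of their classes, which tend to 0 with
  growing \<open>k\<close>; so the induced map on points preserves distances, and
  \<open>node_map_point\<close> for the inverse of \<open>g\<close> makes it onto.\<close>

lemma nodes_iso_imp_isometric:
  fixes U V :: "'a::complete_space set"
  assumes U: "U \<in> V_sub A" and V: "V \<in> V_sub A" and g: "bij_betw g (nodes U) (nodes V)"
    and R: "\<And>c d j. c \<in> nodes U \<Longrightarrow> d \<in> nodes U \<Longrightarrow> node_rel (g c) (g d) j \<longleftrightarrow> node_rel c d j"
  shows "isometric_sets U V"
proof -
  define T where "T x y \<longleftrightarrow> (\<forall>k. g (node U k x) = node V k y)" for x y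
  have le: "dist y y' \<le> dist x x'"
    if W: "W \<in> V_sub A" "W' \<in> V_sub A" and xy: "x \<in> W" "x' \<in> W" "y \<in> W'" "y' \<in> W'"
      and rel: "\<And>k j. node_rel (node W k x) (node W k x') j \<Longrightarrow> node_rel (node W' k y) (node W' k y') j"
    for W W' :: "'a set" and x x' y y'
  proof (rule field_le_epsilon)
    fix e :: real assume "0 < e"
    then obtain i where i: "dist x x' < rt i" "rt i < dist x x' + e / 2"
      using rt_dense[of "dist x x'" "dist x x' + e / 2"] by auto
    obtain k where "p k < e / 4"
      using LIMSEQ_D[OF p(2), of "e / 4"] \<open>0 < e\<close> p(1) by (auto simp: abs_of_nonneg)
    moreover have "dist y y' < p k + rt i + p k"
      by (rule node_rel_dist_le[OF W(2) xy(3,4)]) (rule rel, rule node_rel_cases[OF xy(1,2) i(1)])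
    ultimately show "dist y y' \<le> dist x x' + e" using i by linarith
  qed
  have T_dist: "dist y y' = dist x x'"
    if xy: "x \<in> U" "x' \<in> U" "y \<in> V" "y' \<in> V" "T x y" "T x' y'" for x x' y y'
  proof -
    have "node_rel (node U k x) (node U k x') j \<longleftrightarrow> node_rel (node V k y) (node V k y') j" for k j
      using R[OF nodesI[OF xy(1)] nodesI[OF xy(2)]] xy(5,6) by (metis T_def)
    then show ?thesis
      using le[OF U V xy(1-4)] le[OF V U xy(3,4,1,2)] by (meson antisym)
  qed
  have gm: "g c \<in> nodes V" if "c \<in> nodes U" for c using g that by (rule bij_betw_apply)
  have "\<forall>x\<in>U. \<exists>y\<in>V. T x y" unfolding T_def using node_map_point[OF U V gm R] by blast
  then obtain f where f: "\<And>x. x \<in> U \<Longrightarrow> f x \<in> V \<and> T x (f x)" by metis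
  define h where "h = inv_into (nodes U) g"
  have h: "h c \<in> nodes U" "g (h c) = c" if "c \<in> nodes V" for c
    using g that by (auto simp: h_def bij_betw_inv_into_right bij_betw_def inv_into_into)
  have hR: "node_rel (h c) (h d) j \<longleftrightarrow> node_rel c d j" if "c \<in> nodes V" "d \<in> nodes V" for c d j
    using R[OF h(1)[OF that(1)] h(1)[OF that(2)]] h(2) that by simp
  have "f ` U = V"
  proof (intro equalityI subsetI)
    fix y assume y: "y \<in> V"
    then obtain x where x: "x \<in> U" "\<forall>k. h (node V k y) = node U k x"
      using node_map_point[OF V U h(1) hR] by blast
    then have "T x y" unfolding T_def using h(2)[OF nodesI[OF y]] by metis
    then have "dist (f x) y = dist x x" using T_dist f x y by blast
    with x show "y \<in> f ` U" by auto
  qed (use f in auto)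
  moreover have "dist (f x) (f x') = dist x x'" if "x \<in> U" "x' \<in> U" for x x'
    using T_dist[OF that] f that by simp
  ultimately show ?thesis unfolding isometric_sets_def by blast
qed

lemma isometric_imp_nodes_iso:
  assumes U: "U \<in> V_sub A" and iso: "isometric_sets U V"
  obtains g where "bij_betw g (nodes U) (nodes V)"
    "\<And>c d j. c \<in> nodes U \<Longrightarrow> d \<in> nodes U \<Longrightarrow> node_rel (g c) (g d) j \<longleftrightarrow> node_rel c d j"
proof -
  obtain f where f: "f ` U = V" "\<And>x y. x \<in> U \<Longrightarrow> y \<in> U \<Longrightarrow> dist (f x) (f y) = dist x y"
    using iso by (rule isometric_setsE) (rule that, assumption, blast)
  have inj: "inj_on f U" by (rule inj_onI) (metis f(2) dist_eq_0_iff)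
  define r where "r = inv_into U f"
  have r: "r (f x) = x" if "x \<in> U" for x unfolding r_def using inj that by (rule inv_into_f_f)
  have rV: "r ` V = U" unfolding f(1)[symmetric] image_image using r by simp
  have rd: "dist (r x) (r y) = dist x y" if "x \<in> V" "y \<in> V" for x y
    using that r f(2) unfolding f(1)[symmetric] by auto
  have ch: "chain U d x y \<longleftrightarrow> chain V d (f x) (f y)" if xy: "x \<in> U" "y \<in> U" for d x y
  proof
    show "chain V d (f x) (f y)" if "chain U d x y" by (rule chain_isometry[OF that xy(1) f])
    assume "chain V d (f x) (f y)"
    moreover have "f x \<in> V" using f(1) xy by blast
    ultimately have "chain U d (r (f x)) (r (f y))" using rV rd by (rule chain_isometry)
    then show "chain U d x y" using r xy by simp
  qed
  define g where "g c = (fst c, f ` snd c)" for c :: "nat \<times> 'a set"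
  have gnode: "g (node U k x) = node V k (f x)" if x: "x \<in> U" for k x
  proof -
    have "f ` Collect (chain U (\<delta> k) x) = Collect (chain V (\<delta> k) (f x))"
    proof (intro equalityI subsetI)
      fix y assume "y \<in> Collect (chain V (\<delta> k) (f x))"
      then have y: "chain V (\<delta> k) (f x) y" by simp
      then have "y \<in> V" using chain_in x f(1) by blast
      then obtain z where "z \<in> U" "y = f z" using f(1) by blast
      with y ch[OF x] show "y \<in> f ` Collect (chain U (\<delta> k) x)" by auto
    next
      fix y assume "y \<in> f ` Collect (chain U (\<delta> k) x)"
      then obtain z where z: "chain U (\<delta> k) x z" "y = f z" by blast
      then have "z \<in> U" using chain_in x by blast
      with z ch[OF x] show "y \<in> Collect (chain V (\<delta> k) (f x))" by auto
    qed
    then show ?thesis by (simp add: g_def node_def)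
  qed
  have sub: "snd c \<subseteq> U" if "c \<in> nodes U" for c
    using that chain_in by (auto simp: nodes_def node_def)
  have ginj: "c = d" if "c \<in> nodes U" "d \<in> nodes U" "g c = g d" for c d
    using inj_on_image_eq_iff[OF inj sub sub] that by (auto simp: g_def prod_eq_iff)
  show ?thesis
  proof
    have "g ` nodes U = nodes V"
    proof (intro equalityI subsetI)
      fix c assume "c \<in> g ` nodes U"
      then obtain k x where "x \<in> U" "c = g (node U k x)" by (auto simp: nodes_def)
      then show "c \<in> nodes V" using gnode f(1) by (auto intro: nodesI)
    next
      fix c assume "c \<in> nodes V"
      then obtain k y where "y \<in> V" "c = node V k y" by (auto simp: nodes_def)
      moreover then obtain x where "x \<in> U" "y = f x" using f(1) by blast
      ultimately show "c \<in> g ` nodes U" using gnode nodesI by (metis imageI)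
    qed
    then show "bij_betw g (nodes U) (nodes V)" using ginj by (auto simp: bij_betw_def inj_on_def)
    fix c d j assume cd: "c \<in> nodes U" "d \<in> nodes U"
    have "(\<exists>x\<in>snd (g c). \<exists>y\<in>snd (g d). dist x y < s) \<longleftrightarrow> (\<exists>x\<in>snd c. \<exists>y\<in>snd d. dist x y < s)" for s
    proof -
      have "dist (f x) (f y) = dist x y" if "x \<in> snd c" "y \<in> snd d" for x y
        using f(2) that sub cd by blast
      then show ?thesis by (auto simp: g_def)
    qed
    moreover have "g c = g d \<longleftrightarrow> c = d" using ginj cd by blast
    moreover have "fst (g c) = fst c" by (simp add: g_def)
    ultimately show "node_rel (g c) (g d) j \<longleftrightarrow> node_rel c d j" by (simp add: node_rel_def)
  qed
qed

end

text \<open>Chains run through arbitrary points of \<open>U\<close>; strictness of the bound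
  \<open>d\<close> leaves room to replace each of them by a nearby member of the dense sequence.
  This makes chain equivalence a countable condition, and so a Borel one.\<close>

lemma chain_via_dense:
  fixes s :: "nat \<Rightarrow> 'a::metric_space"
  assumes sU: "\<And>n. s n \<in> U" and dense: "\<And>x e. x \<in> U \<Longrightarrow> 0 < e \<Longrightarrow> \<exists>n. dist (s n) x < e" and d: "0 < d"
  shows "chain U d (s n) (s m) \<longleftrightarrow> (\<lambda>i j. dist (s i) (s j) < d)\<^sup>*\<^sup>* n m"
proof
  let ?I = "(\<lambda>i j. dist (s i) (s j) < d)\<^sup>*\<^sup>*"
  \<comment> \<open>Inner points of the chain need not occur in the sequence, so the induction
    carries approximability of the current end to every precision.\<close>
  have approx: "\<forall>e>0. \<exists>k. ?I n k \<and> dist (s k) x < e" if "chain U d (s n) x" for x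
    using that unfolding chain_def
  proof (induction rule: rtranclp_induct)
    case base
    show ?case by (auto intro!: exI[of _ n])
  next
    case (step x y)
    show ?case
    proof (intro allI impI)
      fix e :: real assume "0 < e"
      define r where "r = (d - dist x y) / 2"
      have r: "0 < r" using step by (simp add: r_def)
      obtain k where k: "?I n k" "dist (s k) x < r" using step.IH r by blast
      obtain l where l: "dist (s l) y < min e r" using dense[of y "min e r"] step \<open>0 < e\<close> r by auto
      have "dist (s k) (s l) < d"
        using k(2) l dist_triangle[of "s k" "s l" x] dist_triangle2[of x "s l" y] by (simp add: r_def)
      with k(1) have "?I n l" by (rule rtranclp.rtrancl_into_rtrancl)
      with l show "\<exists>k. ?I n k \<and> dist (s k) y < e" by auto
    qed
  qed
  assume "chain U d (s n) (s m)"
  then obtain k where "?I n k" "dist (s k) (s m) < d" using approx d by blast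
  then show "?I n m" by (rule rtranclp.rtrancl_into_rtrancl)
next
  assume "(\<lambda>i j. dist (s i) (s j) < d)\<^sup>*\<^sup>* n m"
  then show "chain U d (s n) (s m)"
  proof (induction rule: rtranclp_induct)
    case (step k l)
    then show ?case using chain_step[OF sU sU] chain_trans by blast
  qed (rule chain_refl)
qed

lemma measurable_rtranclp:
  fixes R :: "'w \<Rightarrow> nat \<Rightarrow> nat \<Rightarrow> bool"
  assumes [measurable]: "\<And>n m. Measurable.pred M (\<lambda>w. R w n m)"
  shows "Measurable.pred M (\<lambda>w. (R w)\<^sup>*\<^sup>* n m)"
proof -
  have [measurable]: "Measurable.pred M (\<lambda>w. (R w ^^ k) n m)" for k m
  proof (induction k arbitrary: m)
    case (Suc k)
    note [measurable] = Suc
    have "Measurable.pred M (\<lambda>w. \<exists>l. (R w ^^ k) n l \<and> R w l m)" by measurable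
    then show ?case by (simp add: OO_def)
  qed simp
  have "Measurable.pred M (\<lambda>w. \<exists>k. (R w ^^ k) n m)" by measurable
  then show ?thesis by (simp add: rtranclp_power)
qed

context gap_sequence
begin

text \<open>The nodes of \<open>U\<close> are countable but come without a canonical enumeration.
  They are named by pairs of a level and an index of the dense sequence, with repetitions;
  accordingly the vertices are named by the fixed graph vertices over pairs of naturals, and the
  metric of the graph becomes a pseudometric on names, which is realized in a Borel way.\<close>

lemma graph_reducible:
  assumes ab: "0 < a" "a < b" "b \<le> 2 * a"
  shows "isometry_reducible (V_sub A :: 'u::urysohn_space set set) (V_sub {0, a, b} :: 'u set set)"
proof -
  define M where "M = restrict_space effros (V_sub A :: 'u set set)"
  have spM: "space M = V_sub A" using V_sub_subset_space by (auto simp: M_def space_restrict_space)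
  obtain \<sigma> :: "nat \<Rightarrow> 'u set \<Rightarrow> 'u" where \<sigma>0: "\<And>n. \<sigma> n \<in> borel_measurable effros"
    "\<And>n U. U \<in> space effros \<Longrightarrow> \<sigma> n U \<in> U"
    "\<And>U x e. U \<in> space effros \<Longrightarrow> x \<in> U \<Longrightarrow> 0 < e \<Longrightarrow> \<exists>n. dist (\<sigma> n U) x < e"
    by (rule effros_dense_selectors[where 'a = 'u], rule that)
  have \<sigma>_meas[measurable]: "\<sigma> n \<in> borel_measurable M" for n
    unfolding M_def by (rule measurable_restrict_space1) (rule \<sigma>0)
  have \<sigma>: "\<sigma> n U \<in> U" "\<And>x e. x \<in> U \<Longrightarrow> 0 < e \<Longrightarrow> \<exists>n. dist (\<sigma> n U) x < e" if "U \<in> V_sub A" for n U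
    using \<sigma>0(2,3) that V_sub_subset_space by blast+
  have chain_meas[measurable]: "Measurable.pred M (\<lambda>U. chain U (\<delta> k) (\<sigma> n U) (\<sigma> m U))" for k n m
  proof -
    have "Measurable.pred M (\<lambda>U. (\<lambda>i j. dist (\<sigma> i U) (\<sigma> j U) < \<delta> k)\<^sup>*\<^sup>* n m)"
      by (rule measurable_rtranclp) measurable
    moreover have "chain U (\<delta> k) (\<sigma> n U) (\<sigma> m U) \<longleftrightarrow> (\<lambda>i j. dist (\<sigma> i U) (\<sigma> j U) < \<delta> k)\<^sup>*\<^sup>* n m"
      if "U \<in> space M" for U
      using that \<sigma> \<delta> by (intro chain_via_dense) (auto simp: spM)
    ultimately show ?thesis by (simp cong: measurable_cong)
  qed
  define nd where "nd U c = (case c of (k, n) \<Rightarrow> node U k (\<sigma> n U))" for U and c :: "nat \<times> nat"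
  have nd_eq[measurable]: "Measurable.pred M (\<lambda>U. nd U c = nd U d)" for c d
    by (cases c; cases d) (simp add: nd_def node_eq_iff)
  have nd_rel[measurable]: "Measurable.pred M (\<lambda>U. node_rel (nd U c) (nd U d) j)" for c d j
  proof (cases "even j")
    case False
    have "Measurable.pred M (\<lambda>U. nd U c = nd U d \<and> fst c = j div 2)" by measurable
    with False show ?thesis by (cases c) (simp add: node_rel_def nd_def)
  next
    case True
    obtain k n l m where cd: "c = (k, n)" "d = (l, m)" by fastforce
    let ?Q = "\<lambda>U. \<exists>n' m'. chain U (\<delta> k) (\<sigma> n U) (\<sigma> n' U) \<and> chain U (\<delta> l) (\<sigma> m U) (\<sigma> m' U) \<and>
      dist (\<sigma> n' U) (\<sigma> m' U) < rt (j div 2)"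
    \<comment> \<open>Classes are open in \<open>U\<close> and the bound is strict, so witnesses may
      be taken from the dense sequence.\<close>
    have "node_rel (nd U c) (nd U d) j \<longleftrightarrow> ?Q U" if "U \<in> space M" for U
    proof
      assume "node_rel (nd U c) (nd U d) j"
      then obtain x y where xy: "chain U (\<delta> k) (\<sigma> n U) x" "chain U (\<delta> l) (\<sigma> m U) y" "dist x y < rt (j div 2)"
        using True by (auto simp: node_rel_def nd_def cd mem_node)
      have U: "U \<in> V_sub A" using that by (simp add: spM)
      have xyU: "x \<in> U" "y \<in> U" using xy chain_in \<sigma>(1)[OF U] by blast+
      define r where "r = (rt (j div 2) - dist x y) / 2"
      have r: "0 < r" using xy by (simp add: r_def)
      obtain n' where n': "dist (\<sigma> n' U) x < min r (\<delta> k)" using \<sigma>(2)[OF U xyU(1)] r \<delta> by (metis min_less_iff_conj)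
      obtain m' where m': "dist (\<sigma> m' U) y < min r (\<delta> l)" using \<sigma>(2)[OF U xyU(2)] r \<delta> by (metis min_less_iff_conj)
      have "chain U (\<delta> k) x (\<sigma> n' U)" "chain U (\<delta> l) y (\<sigma> m' U)"
        using n' m' xyU \<sigma>(1)[OF U] by (auto intro!: chain_step simp: dist_commute)
      then have "chain U (\<delta> k) (\<sigma> n U) (\<sigma> n' U)" "chain U (\<delta> l) (\<sigma> m U) (\<sigma> m' U)"
        using xy chain_trans by blast+
      moreover have "dist (\<sigma> n' U) (\<sigma> m' U) < rt (j div 2)"
        using n' m' dist_triangle[of "\<sigma> n' U" "\<sigma> m' U" x] dist_triangle2[of x "\<sigma> m' U" y]
        by (simp add: r_def)
      ultimately show "?Q U" by blast
    next
      assume "?Q U"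
      then obtain n' m' where nm: "chain U (\<delta> k) (\<sigma> n U) (\<sigma> n' U)" "chain U (\<delta> l) (\<sigma> m U) (\<sigma> m' U)"
        "dist (\<sigma> n' U) (\<sigma> m' U) < rt (j div 2)" by blast
      have "\<exists>x\<in>snd (nd U c). \<exists>y\<in>snd (nd U d). dist x y < rt (j div 2)"
        by (intro bexI[where x = "\<sigma> n' U"] bexI[where x = "\<sigma> m' U"]) (use nm in \<open>simp_all add: nd_def cd mem_node\<close>)
      then show "node_rel (nd U c) (nd U d) j" using True by (simp add: node_rel_def)
    qed
    moreover have "Measurable.pred M ?Q" by measurable
    ultimately show ?thesis by (simp cong: measurable_cong)
  qed
  define \<iota> where "\<iota> = from_nat_into (verts (UNIV :: (nat \<times> nat) set))"
  have "verts (UNIV :: (nat \<times> nat) set) \<noteq> {}" using verts_simps(1)[of undefined UNIV] by blast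
  then have range_\<iota>: "range \<iota> = verts UNIV"
    unfolding \<iota>_def by (rule range_from_nat_into) simp
  define val where "val U n = map_vert (nd U) (\<iota> n)" for U n
  have range_nd: "range (nd U) = nodes U" if U: "U \<in> V_sub A" for U
  proof (intro equalityI subsetI)
    fix c assume "c \<in> nodes U"
    then obtain k x where x: "x \<in> U" "c = node U k x" by (auto simp: nodes_def)
    obtain n where "dist (\<sigma> n U) x < \<delta> k" using \<sigma>(2)[OF U x(1) \<delta>] by blast
    then have "c = nd U (k, n)"
      using x \<sigma>(1)[OF U] by (simp add: nd_def node_eq_iff chain_step dist_commute)
    then show "c \<in> range (nd U)" by blast
  next
    fix c assume "c \<in> range (nd U)"
    then obtain d where "c = nd U d" by blast
    then have c: "c = node U (fst d) (\<sigma> (snd d) U)" by (simp add: nd_def case_prod_unfold)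
    show "c \<in> nodes U" unfolding c by (rule nodesI) (rule \<sigma>(1)[OF U])
  qed
  have range_val: "range (val U) = verts (nodes U)" if "U \<in> V_sub A" for U
  proof -
    have "range (val U) = map_vert (nd U) ` range \<iota>" by (auto simp: val_def)
    then show ?thesis by (simp add: range_\<iota> map_vert_verts range_nd[OF that])
  qed
  define D where "D n m U = gdist a b node_rel (val U n) (val U m)" for n m U
  note gd = gdist_metric[OF ab]
  have D_meas: "D n m \<in> borel_measurable M" for n m
  proof -
    have [measurable]: "Measurable.pred M (\<lambda>U. val U n = val U m)"
      unfolding val_def by (cases "\<iota> n"; cases "\<iota> m") simp_all
    have [measurable]: "Measurable.pred M (\<lambda>U. adj node_rel (val U n) (val U m))"
      unfolding val_def by (cases "\<iota> n"; cases "\<iota> m") simp_all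
    show ?thesis unfolding D_def gdist_def by measurable
  qed
  obtain e :: "nat \<Rightarrow> 'u set \<Rightarrow> 'u" where e: "\<And>n. e n \<in> borel_measurable M"
    "\<And>U n m. U \<in> space M \<Longrightarrow> dist (e n U) (e m U) = D n m U"
  proof (rule measurable_pseudometric_realization[where 'u = 'u, of D M])
    show "D n n U = 0" "D n m U = D m n U" "D n k U \<le> D n m U + D m k U" for U n m k
      unfolding D_def by (rule gd)+
  qed (rule D_meas, rule that)
  define \<Phi> where "\<Phi> U = closure (range (\<lambda>n. e n U))" for U
  have \<Phi>_range: "\<Phi> U = range (\<lambda>n. e n U)" if U: "U \<in> V_sub A" for U
  proof -
    \<comment> \<open>Distinct points are at least \<open>a\<close> apart, so closing up adds
      nothing.\<close>
    have "closed (range (\<lambda>n. e n U))"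
    proof (rule discrete_imp_closed[OF ab(1)], intro ballI impI)
      fix x y assume "x \<in> range (\<lambda>n. e n U)" "y \<in> range (\<lambda>n. e n U)" and xy: "dist y x < a"
      then obtain n m where "y = e n U" "x = e m U" by blast
      with xy have "dist y x = 0"
        using e(2)[of U n m] U ab by (auto simp: spM D_def gdist_def split: if_splits)
      then show "y = x" by simp
    qed
    then show ?thesis by (simp add: \<Phi>_def closure_closed)
  qed
  define J where "J U v = e (SOME n. val U n = v) U" for U v
  have val_some: "val U (SOME n. val U n = v) = v" if "U \<in> V_sub A" "v \<in> verts (nodes U)" for U v
  proof (rule someI_ex)
    show "\<exists>n. val U n = v" using that range_val[OF that(1)] by (metis imageE)
  qed
  have J_dist: "dist (J U v) (J U w) = gdist a b node_rel v w"
    if "U \<in> V_sub A" "v \<in> verts (nodes U)" "w \<in> verts (nodes U)" for U v w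
    using that val_some by (simp add: J_def e(2) spM D_def)
  have J_image: "J U ` verts (nodes U) = \<Phi> U" if U: "U \<in> V_sub A" for U
  proof -
    have "J U (val U n) = e n U" for n
    proof -
      have "val U n \<in> verts (nodes U)" using range_val[OF U] by blast
      then have "dist (J U (val U n)) (e n U) = 0"
        using val_some[OF U] U by (simp add: J_def e(2) spM D_def gd)
      then show ?thesis by simp
    qed
    then show ?thesis unfolding range_val[OF U, symmetric] \<Phi>_range[OF U] by (simp add: image_image)
  qed
  show ?thesis
  proof (rule isometry_reducibleI[where \<Phi> = \<Phi>])
    show "\<Phi> \<in> restrict_space effros (V_sub A) \<rightarrow>\<^sub>M effros"
      unfolding \<Phi>_def M_def[symmetric] by (rule measurable_closure_range) (rule e)
    fix U :: "'u set" assume U: "U \<in> V_sub A"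
    have "dist x y \<in> {0, a, b}" if xy: "x \<in> \<Phi> U" "y \<in> \<Phi> U" for x y
    proof -
      obtain n m where "x = e n U" "y = e m U" using xy unfolding \<Phi>_range[OF U] by blast
      then have "dist x y = gdist a b node_rel (val U n) (val U m)" using e(2) U by (simp only: spM D_def)
      then show ?thesis by (simp add: gdist_def)
    qed
    moreover have "closed (\<Phi> U)" "\<Phi> U \<noteq> {}" by (simp_all add: \<Phi>_def)
    ultimately show "\<Phi> U \<in> V_sub {0, a, b}" unfolding V_sub_iff by blast
    fix V :: "'u set" assume V: "V \<in> V_sub A"
    let ?P = "\<lambda>h. bij_betw h (verts (nodes U)) (verts (nodes V)) \<and> (\<forall>v\<in>verts (nodes U). \<forall>w\<in>verts (nodes U).
      gdist a b node_rel (h v) (h w) = gdist a b node_rel v w)"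
    have \<Phi>_iso: "isometric_sets (\<Phi> U) (\<Phi> V) \<longleftrightarrow> (\<exists>h. ?P h)"
      unfolding J_image[OF U, symmetric] J_image[OF V, symmetric]
      by (rule isometric_images_iff) (use J_dist U V gd(4) in blast)+
    show "isometric_sets U V \<longleftrightarrow> isometric_sets (\<Phi> U) (\<Phi> V)"
      unfolding \<Phi>_iso
    proof
      assume "isometric_sets U V"
      then obtain g where g: "bij_betw g (nodes U) (nodes V)"
        "\<And>c d j. c \<in> nodes U \<Longrightarrow> d \<in> nodes U \<Longrightarrow> node_rel (g c) (g d) j \<longleftrightarrow> node_rel c d j"
        using isometric_imp_nodes_iso[OF U] by blast
      have ginj: "inj_on g (nodes U)" "g ` nodes U = nodes V" using g(1) by (auto simp: bij_betw_def)
      have inj: "inj_on (map_vert g) (verts (nodes U))" by (rule inj_on_map_vert[OF ginj(1)])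
      have "gdist a b node_rel (map_vert g v) (map_vert g w) = gdist a b node_rel v w"
        if "v \<in> verts (nodes U)" "w \<in> verts (nodes U)" for v w
        using adj_map_vert[where R = node_rel, OF ginj(1) g(2) that] inj_on_eq_iff[OF inj that] by (simp add: gdist_def)
      moreover have "bij_betw (map_vert g) (verts (nodes U)) (verts (nodes V))"
        unfolding bij_betw_def using inj map_vert_verts[of g "nodes U"] ginj(2) by simp
      ultimately show "\<exists>h. ?P h" by blast
    next
      assume "\<exists>h. ?P h"
      then obtain h where h: "bij_betw h (verts (nodes U)) (verts (nodes V))"
        "\<forall>v\<in>verts (nodes U). \<forall>w\<in>verts (nodes U). gdist a b node_rel (h v) (h w) = gdist a b node_rel v w"
        by blast
      have "adj node_rel (h v) (h w) \<longleftrightarrow> adj node_rel v w"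
        if "v \<in> verts (nodes U)" "w \<in> verts (nodes U)" for v w
        using h(2) that gd(5) by metis
      from graph_iso_recover[OF node_rel_sym h(1) this]
      obtain g where "bij_betw g (nodes U) (nodes V)"
        "\<And>c d j. c \<in> nodes U \<Longrightarrow> d \<in> nodes U \<Longrightarrow> node_rel (g c) (g d) j \<longleftrightarrow> node_rel c d j"
        by blast
      then show "isometric_sets U V" by (rule nodes_iso_imp_isometric[OF U V])
    qed
  qed (rule V_sub_subset_space)
qed

end

section \<open>Existence of gaps near 0, and sets too sparse to carry graphs\<close>

lemma gap_sequence_exists:
  assumes A: "A \<subseteq> {0..}" "0 \<in> A"
    and nd: "\<forall>\<epsilon>>0. \<not> {0..<\<epsilon>} \<subseteq> closure (A \<inter> {0..<\<epsilon>})"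
  obtains p \<delta> where "gap_sequence A p \<delta>"
proof -
  have "\<exists>p \<delta>. 0 \<le> p \<and> p \<le> \<epsilon> \<and> 0 < \<delta> \<and> (\<forall>c\<in>A. c < p + \<delta> \<longrightarrow> c \<le> p)" if \<epsilon>: "0 < \<epsilon>" for \<epsilon> :: real
  proof -
    obtain x where x: "0 \<le> x" "x < \<epsilon>" "x \<notin> closure (A \<inter> {0..<\<epsilon>})" using nd \<epsilon> by fastforce
    then obtain r where r: "0 < r" "\<And>c. c \<in> A \<Longrightarrow> 0 \<le> c \<Longrightarrow> c < \<epsilon> \<Longrightarrow> r \<le> dist c x"
      unfolding closure_approachable by (auto simp: not_less)
    have "x \<noteq> 0" using r(2)[of 0] r(1) A \<epsilon> by auto
    \<comment> \<open>The gap lies just below \<open>x\<close>: elements of \<open>A\<close> below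
      \<open>x\<close> stay at least \<open>r\<close> away from it, and halving
      \<open>min r x\<close> gives \<open>s < r\<close> and keeps \<open>x - s\<close>
      nonnegative.\<close>
    define s where "s = min r x / 2"
    have s: "0 < s" "s < r" "s \<le> x" using r x \<open>x \<noteq> 0\<close> by (auto simp: s_def)
    have "c \<le> x - s" if "c \<in> A" "c < x - s + s" for c
    proof -
      have "0 \<le> c" using that A by auto
      with r(2)[OF that(1)] that x s show ?thesis by (auto simp: dist_real_def)
    qed
    with s x show ?thesis by (intro exI[of _ "x - s"] exI[of _ s]) auto
  qed
  then have "\<forall>k. \<exists>p \<delta>. 0 \<le> p \<and> p \<le> 1 / real (Suc k) \<and> 0 < \<delta> \<and> (\<forall>c\<in>A. c < p + \<delta> \<longrightarrow> c \<le> p)"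
    by (simp del: of_nat_Suc)
  then obtain p \<delta> where pd: "\<And>k. 0 \<le> p k" "\<And>k. p k \<le> 1 / real (Suc k)" "\<And>k. 0 < \<delta> k"
    "\<And>k. \<forall>c\<in>A. c < p k + \<delta> k \<longrightarrow> c \<le> p k" by metis
  have "p \<longlonglongrightarrow> 0"
    by (rule tendsto_sandwich[OF _ _ tendsto_const LIMSEQ_inverse_real_of_nat])
      (use pd(1,2) in \<open>auto simp: inverse_eq_divide\<close>)
  with pd have "gap_sequence A p \<delta>" unfolding gap_sequence_def by blast
  then show ?thesis by (rule that)
qed

text \<open>Metrics with values in a set whose elements at least double are ultrametrics, so every
  monotone map preserves them; shifting all large elements to their successors misses one of them.\<close>
lemma well_spaced_shift:
  assumes A: "A \<subseteq> {0..}" "0 \<in> A" and nomax: "\<And>x. x \<in> A \<Longrightarrow> \<exists>y\<in>A. x < y"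
    and spaced: "\<And>a b. a \<in> A \<Longrightarrow> b \<in> A \<Longrightarrow> 0 < a \<Longrightarrow> a < b \<Longrightarrow> 2 * a < b"
  obtains f where "f \<in> A \<rightarrow> A" "polish_metric_preserving A f" "inj_on f A" "f ` A \<noteq> A"
proof -
  obtain c where c: "c \<in> A" "0 < c" using nomax[OF A(2)] by blast
  have succ_ex: "\<exists>y\<in>A. x < y \<and> (\<forall>z\<in>A. x < z \<longrightarrow> y \<le> z)" if x: "x \<in> A" "0 < x" for x
  proof -
    define S where "S = {y \<in> A. x < y}"
    have S: "S \<noteq> {}" "bdd_below S" using nomax[OF x(1)] by (auto simp: S_def intro!: bdd_belowI[of _ x])
    have I: "x \<le> Inf S" using S by (intro cInf_greatest) (auto simp: S_def)
    \<comment> \<open>\<open>Inf S\<close> is attained: of two different elements of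
      \<open>S\<close> the larger is more than twice the smaller, so at most one lies below
      \<open>2 * Inf S\<close>.\<close>
    then have "Inf S < 2 * Inf S" using x by simp
    then obtain y where y: "y \<in> S" "y < 2 * Inf S" using cInf_less_iff[OF S] by blast
    have "y \<le> z" if z: "z \<in> A" "x < z" for z
    proof (rule ccontr)
      assume "\<not> y \<le> z"
      then have "2 * z < y" using spaced[of z y] z x y by (auto simp: S_def)
      moreover have "Inf S \<le> z" using z S by (intro cInf_lower) (auto simp: S_def)
      ultimately show False using y by simp
    qed
    with y show ?thesis by (auto simp: S_def)
  qed
  \<comment> \<open>Below \<open>c\<close> the map is the identity, which gives continuity at 0;
    from \<open>c\<close> on each element moves to its successor in \<open>A\<close>, so
    \<open>c\<close> itself is not a value.\<close>
  define f where "f x = (if x < c then x else (SOME y. y \<in> A \<and> x < y \<and> (\<forall>z\<in>A. x < z \<longrightarrow> y \<le> z)))" for x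
  have f_small: "f x = x" if "x < c" for x using that by (simp add: f_def)
  have f_succ: "f x \<in> A \<and> x < f x \<and> (\<forall>z\<in>A. x < z \<longrightarrow> f x \<le> z)" if "x \<in> A" "c \<le> x" for x
  proof -
    have "\<exists>y. y \<in> A \<and> x < y \<and> (\<forall>z\<in>A. x < z \<longrightarrow> y \<le> z)" using succ_ex[of x] that c by auto
    then show ?thesis unfolding f_def using that by (simp only: not_less[symmetric] if_False) (rule someI_ex)
  qed
  have fA: "f x \<in> A" if "x \<in> A" for x using that f_small f_succ by (cases "x < c") auto
  have ge: "x \<le> f x" if "x \<in> A" for x using that f_small[of x] f_succ[of x] by (cases "x < c") auto
  have smono: "f x < f y" if "x \<in> A" "y \<in> A" "x < y" for x y
  proof (cases "c \<le> x")
    case True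
    then have "f x \<le> y" "y < f y" using f_succ[of x] f_succ[of y] that by auto
    then show ?thesis by simp
  next
    case False
    then show ?thesis using f_small[of x] ge[OF that(2)] that by simp
  qed
  have mono: "f x \<le> f y" if "x \<in> A" "y \<in> A" "x \<le> y" for x y
    using smono[OF that(1,2)] that(3) by (cases "x = y") auto
  have pos: "0 \<le> x" if "x \<in> A" for x using that A by auto
  have f0: "f x = 0 \<longleftrightarrow> x = 0" if "x \<in> A" for x
    using f_small[of 0] c(2) ge[OF that] pos[OF that] by auto
  \<comment> \<open>If \<open>x\<close> exceeds both \<open>y\<close> and \<open>z\<close>, it
    exceeds twice each of them that is not 0, which contradicts
    \<open>x \<le> y + z\<close>.\<close>
  have ultra: "x \<le> y \<or> x \<le> z" if xyz: "x \<in> A" "y \<in> A" "z \<in> A" "x \<le> y + z" for x y z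
  proof (rule ccontr)
    assume neg: "\<not> (x \<le> y \<or> x \<le> z)"
    then have "2 * y \<le> x" "2 * z \<le> x" "y < x"
      using spaced[of y x] spaced[of z x] xyz pos[of y] pos[of z] by (cases "y = 0"; cases "z = 0"; force)+
    then have "y + z \<le> x" "2 * y < x \<or> 2 * z < x \<or> y = 0 \<and> z = 0"
      using spaced[of y x] spaced[of z x] xyz pos[of y] pos[of z] neg by force+
    then show False using xyz(4) neg pos[OF xyz(2)] \<open>2 * y \<le> x\<close> \<open>2 * z \<le> x\<close> by auto
  qed
  have "metric_preserving A f"
    unfolding metric_preserving_def
  proof (intro conjI allI impI)
    show "f \<in> A \<rightarrow> {0..}" using fA pos by auto
    fix N :: "real set" and d assume "Metric_space N d \<and> (\<forall>x\<in>N. \<forall>y\<in>N. d x y \<in> A)"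
    then interpret Metric_space N d by simp
    have dA: "d x y \<in> A" if "x \<in> N" "y \<in> N" for x y
      using \<open>Metric_space N d \<and> (\<forall>x\<in>N. \<forall>y\<in>N. d x y \<in> A)\<close> that by blast
    show "Metric_space N (\<lambda>x y. if x \<in> N \<and> y \<in> N then f (d x y) else 0)"
    proof
      fix x y
      show "0 \<le> (if x \<in> N \<and> y \<in> N then f (d x y) else 0)" using fA pos dA by auto
      show "(if x \<in> N \<and> y \<in> N then f (d x y) else 0) = (if y \<in> N \<and> x \<in> N then f (d y x) else 0)"
        by (simp add: commute[of x y])
      assume xy: "x \<in> N" "y \<in> N"
      then show "(if x \<in> N \<and> y \<in> N then f (d x y) else 0) = 0 \<longleftrightarrow> x = y" using f0 dA by auto
      fix z assume z: "z \<in> N"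
      have "f (d x z) \<le> f (d x y) \<or> f (d x z) \<le> f (d y z)"
        using ultra[OF dA dA dA triangle, of x z y] mono dA xy z by blast
      moreover have "0 \<le> f (d x y)" "0 \<le> f (d y z)" using fA pos dA xy z by auto
      ultimately show "(if x \<in> N \<and> z \<in> N then f (d x z) else 0) \<le>
          (if x \<in> N \<and> y \<in> N then f (d x y) else 0) + (if y \<in> N \<and> z \<in> N then f (d y z) else 0)"
        using xy z by auto
    qed
  qed
  moreover have "continuous (at 0 within A) f"
    unfolding continuous_within_eps_delta
  proof (intro allI impI)
    fix e :: real assume "0 < e"
    then show "\<exists>d>0. \<forall>x'\<in>A. dist x' 0 < d \<longrightarrow> dist (f x') (f 0) < e"
      using c f_small by (intro exI[of _ "min e c"]) (auto simp: dist_real_def)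
  qed
  moreover have "\<exists>d>0. \<forall>a\<in>A. f a < d \<longrightarrow> a < e" if "0 < e" for e
    using that ge by (intro exI[of _ e]) force
  ultimately have "polish_metric_preserving A f" by (auto simp: polish_metric_preserving_def)
  moreover have "inj_on f A"
  proof (rule inj_onI)
    fix x y assume "x \<in> A" "y \<in> A" "f x = f y"
    then show "x = y" using smono[of x y] smono[of y x] by (cases x y rule: linorder_cases) auto
  qed
  moreover have "c \<notin> f ` A"
  proof
    assume "c \<in> f ` A"
    then obtain x where x: "x \<in> A" "c = f x" by blast
    then show False using f_small[of x] f_succ[of x] by (cases "x < c") auto
  qed
  ultimately show ?thesis using fA c by (intro that[of f]) auto
qed

lemma shift_reducible:
  assumes ne: "V_star A \<noteq> ({} :: 'u::urysohn_space set set)" and A: "A \<subseteq> {0..}" "0 \<in> A"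
    and nomax: "\<And>x. x \<in> A \<Longrightarrow> \<exists>y\<in>A. x < y"
    and f: "f \<in> A \<rightarrow> A" "polish_metric_preserving A f" "inj_on f A" "f ` A \<noteq> A"
  shows "isometry_reducible (V_sub A :: 'u set set) (V_star A :: 'u set set)"
proof -
  obtain a where a: "a \<in> A" "a \<notin> f ` A" using f(1,4) by blast
  have "f 0 = 0" using f(2) A(2) by (auto simp: polish_metric_preserving_def intro: metric_preserving_zero)
  then have "0 \<in> f ` A" using A(2) by force
  then have "0 < a" using a A(1) by (metis atLeast_iff order_le_less subsetD)
  obtain b where b: "b \<in> A" "a < b" using nomax[OF a(1)] by blast
  have "isometry_reducible (V_sub A :: 'u set set) (V_sub (f ` A) :: 'u set set)"
    by (rule polish_metric_preserving_reducible[OF ne A(1) f(2,3)])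
  moreover have "isometry_reducible (V_sub (f ` A) :: 'u set set) (V_sub (A - {a}) :: 'u set set)"
    using f(1) a(2) by (intro isometry_reducible_mono V_sub_mono V_sub_subset_space) auto
  moreover have "isometry_reducible (V_sub (A - {a}) :: 'u set set) (V_star A :: 'u set set)"
    by (rule avoiding_reducible_V_star[OF ne a(1) \<open>0 < a\<close> b])
  ultimately show ?thesis by (meson borel_reducible_trans)
qed

lemma gap_reducible:
  assumes ne: "V_star A \<noteq> ({} :: 'u::urysohn_space set set)" and A: "A \<subseteq> {0..}" "0 \<in> A"
    and nomax: "\<And>x. x \<in> A \<Longrightarrow> \<exists>y\<in>A. x < y"
    and nd: "\<forall>\<epsilon>>0. \<not> {0..<\<epsilon>} \<subseteq> closure (A \<inter> {0..<\<epsilon>})"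
  shows "isometry_reducible (V_sub A :: 'u set set) (V_star A :: 'u set set)"
proof (cases "\<exists>a\<in>A. \<exists>b\<in>A. 0 < a \<and> a < b \<and> b \<le> 2 * a")
  case True
  then obtain a b where ab: "a \<in> A" "b \<in> A" "0 < a" "a < b" "b \<le> 2 * a" by blast
  \<comment> \<open>\<open>c\<close> will be the missed value, above \<open>b\<close> so that the
    graph spaces avoid it, and \<open>d\<close> the larger element that separates the distinguished
    point.\<close>
  obtain c where c: "c \<in> A" "b < c" using nomax[OF ab(2)] by blast
  obtain d where d: "d \<in> A" "c < d" using nomax[OF c(1)] by blast
  obtain p \<delta> where "gap_sequence A p \<delta>" using gap_sequence_exists[OF A nd] .
  then interpret gap_sequence A p \<delta> .
  have "isometry_reducible (V_sub A :: 'u set set) (V_sub {0, a, b} :: 'u set set)"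
    by (rule graph_reducible[OF ab(3-5)])
  moreover have "isometry_reducible (V_sub {0, a, b} :: 'u set set) (V_sub (A - {c}) :: 'u set set)"
    using A(2) ab c by (intro isometry_reducible_mono V_sub_mono V_sub_subset_space) auto
  moreover have "isometry_reducible (V_sub (A - {c}) :: 'u set set) (V_star A :: 'u set set)"
    using ab c d by (intro avoiding_reducible_V_star[OF ne c(1) _ d]) simp
  ultimately show ?thesis by (meson borel_reducible_trans)
next
  case False
  then have "\<And>a b. a \<in> A \<Longrightarrow> b \<in> A \<Longrightarrow> 0 < a \<Longrightarrow> a < b \<Longrightarrow> 2 * a < b" by (meson not_less)
  then obtain f where "f \<in> A \<rightarrow> A" "polish_metric_preserving A f" "inj_on f A" "f ` A \<noteq> A"
    using well_spaced_shift[OF A nomax] by blast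
  then show ?thesis using shift_reducible[OF ne A] nomax by blast
qed

section \<open>The theorem\<close>

theorem theorem7p10:
  fixes A :: "real set"
  assumes "A \<subseteq> {0..}"
    and "realizable TYPE('u::urysohn_space) A"
    and "(\<exists>m\<in>A. \<forall>a\<in>A. a \<le> m)
       \<or> (\<exists>f. f \<in> A \<rightarrow> A \<and> polish_metric_preserving A f \<and> inj_on f A \<and> f ` A \<noteq> A)
       \<or> (\<exists>a b. a < b \<and> {a<..<b} \<subseteq> A)
       \<or> (\<forall>\<epsilon>>0. \<not> {0..<\<epsilon>} \<subseteq> closure (A \<inter> {0..<\<epsilon>}))"
  shows "borel_bireducible
           (restrict_space effros (V_sub A :: 'u set set)) isometric_sets
           (restrict_space effros (V_star A :: 'u set set)) isometric_sets"
proof -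
  have ne: "V_star A \<noteq> ({} :: 'u set set)" using assms(2) by (simp add: realizable_def)
  then obtain U :: "'u set" where "U \<in> V_star A" by blast
  then have zero: "0 \<in> A" by (auto simp: V_star_iff V_sub_iff) (metis dist_self)
  have "isometry_reducible (V_sub A :: 'u set set) (V_star A :: 'u set set)"
  proof (cases "\<exists>m\<in>A. \<forall>a\<in>A. a \<le> m")
    case True
    then show ?thesis using max_reducible[OF ne assms(1)] by blast
  next
    case False
    then have nomax: "\<exists>y\<in>A. x < y" if "x \<in> A" for x using that by (meson not_le)
    from False assms(3) consider
      (shift) f where "f \<in> A \<rightarrow> A" "polish_metric_preserving A f" "inj_on f A" "f ` A \<noteq> A"
      | (interval) \<alpha> \<beta> where "\<alpha> < \<beta>" "{\<alpha><..<\<beta>} \<subseteq> A"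
      | (gaps) "\<forall>\<epsilon>>0. \<not> {0..<\<epsilon>} \<subseteq> closure (A \<inter> {0..<\<epsilon>})"
      by blast
    then show ?thesis
    proof cases
      case shift
      then show ?thesis using shift_reducible[OF ne assms(1) zero] nomax by blast
    next
      case interval
      then obtain a b where ab: "a \<in> A" "0 < a" "b \<in> A" "a < b"
        and red: "isometry_reducible (V_sub A :: 'u set set) (V_sub (A - {a}) :: 'u set set)"
        using interval_reducible[OF assms(1), where 'u = 'u] by blast
      then show ?thesis using avoiding_reducible_V_star[OF ne ab] by (meson borel_reducible_trans)
    next
      case gaps
      then show ?thesis using gap_reducible[OF ne assms(1) zero] nomax by blast
    qed
  qed
  moreover have "isometry_reducible (V_star A :: 'u set set) (V_sub A :: 'u set set)"
    by (rule isometry_reducible_mono[OF V_star_subset_V_sub])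
      (use V_star_subset_V_sub V_sub_subset_space in blast)
  ultimately show ?thesis unfolding borel_bireducible_def by blast
qed

end
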